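(* Let $\sigma\in\{\mathbf i,\mathbf e\}$ and let $n$ be an integer with $n\ge 1$ if $\sigma=\mathbf i$, and $n\le -2$ if $\sigma=\mathbf e$. Consider the following functions, restricted to $\mathbb B^\sigma$: $$Z_{n,0}^{+}=U_{n,1}^{-}e_1-U_{n,1}^{+}e_2,$$ $$Z_{n,m}^{\pm}=\big(U_{n,m+1}^{\mp}+(n-m)(n-m+1)\,U_{n,m-1}^{\mp}\big)e_1\mp\big(U_{n,m+1}^{\pm}-(n-m)(n-m+1)\,U_{n,m-1}^{\pm}\big)e_2$$ for $1\le m\le |n-\tfrac12|-\tfrac12$ (that is, $1\le m\le n-1$ if $\sigma=\mathbf i$ and $1\le m\le -n$ if $\sigma=\mathbf e$), and, only when $\sigma=\mathbf e$, additionally the scalar-valued functions $$Z_{n,-n+1}^{\pm}=U_{n,-n-1}^{\pm}.$$ Then these functions form an orthogonal basis of $\mathcal N^\sigma(n)$.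
   Context: $\mathbb B^{\mathbf i}=\{x\in\mathbb R^3: |x|<1\}$ and $\mathbb B^{\mathbf e}=\{x\in\mathbb R^3:|x|>1\}$. Write $x=(x_0,x_1,x_2)=(\rho\cos\theta,\rho\sin\theta\cos\phi,\rho\sin\theta\sin\phi)$. Spherical harmonics: $U_{n,m}^{\pm}(x)=\rho^nP_n^m(\cos\theta)\Phi_m^{\pm}(\phi)$, $\Phi_m^+(\phi)=\cos(m\phi)$, $\Phi_m^-(\phi)=\sin(m\phi)$, $m\ge 0$. For $n\ge0$, $P_n^m(t)=(-1)^m(1-t^2)^{m/2}\frac{d^m}{dt^m}P_n(t)$ is the associated Legendre function ($P_n$ the Legendre polynomial); for $n<0$, $P_n^m=P_{-n-1}^m$. So $U_{n,m}^\pm=0$ when $m>n\ge0$ or when $n<0$, $m>-n-1$; also $U_{n,0}^-=0$. $\mathcal A=\{a_0+a_1e_1+a_2e_2: a_i\in\mathbb R\}$ is the real subspace of the quaternions (basis $1,e_1,e_2,e_3$) with zero $e_3$-component; conjugation is $\overline{a_0+a_1e_1+a_2e_2}=a_0-a_1e_1-a_2e_2$. A real-valued function is identified with an $\mathcal A$-valued function with zero $e_1,e_2$-components. A smooth $\mathcal A$-valued $f$ is monogenic if $\overline\partial f=0$, where $\overline\partial=\frac{\partial}{\partial x_0}+e_1\frac{\partial}{\partial x_1}+e_2\frac{\partial}{\partial x_2}$ (quaternionic multiplication from the left). $\mathcal H^\sigma(n)$ is the real vector space of real-valued harmonic functions in $L^2(\mathbb B^\sigma)$ that are homogeneous of degree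 $n$ (including $0$). $\mathcal M^\sigma(n)$ is the space of $\mathcal A$-valued monogenic functions in $L^2(\mathbb B^\sigma)$ that are homogeneous of degree $n$ (including $0$), and $\overline{\mathcal M}^\sigma(n)=\{\overline f: f\in\mathcal M^\sigma(n)\}$. The inner product is $\langle f,g\rangle_\sigma=\int_{\mathbb B^\sigma}(f_0g_0+f_1g_1+f_2g_2)\,dV$ (Lebesgue measure). $(\mathcal H^\sigma(n))^3$ is identified with the $\mathcal A$-valued functions having components in $\mathcal H^\sigma(n)$, and $\mathcal N^\sigma(n)=(\mathcal M^\sigma(n)+\overline{\mathcal M}^\sigma(n))^\perp\subseteq(\mathcal H^\sigma(n))^3$ is the space of homogeneous contragenic functions of degree $n$. *)

theory Defs
  imports "HOL-Analysis.Analysis" "HOL-Library.Function_Algebras"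
    "HOL-Computational_Algebra.Polynomial"
begin

text \<open>Pointwise vector space structure on functions, so that the library notions
  \<open>span\<close> and \<open>independent\<close> apply to function spaces.\<close>

instantiation "fun" :: (type, real_vector) real_vector
begin

definition scaleR_fun :: "real \<Rightarrow> ('a \<Rightarrow> 'b) \<Rightarrow> 'a \<Rightarrow> 'b" where
  "scaleR_fun c f = (\<lambda>x. c *\<^sub>R f x)"

instance
  by standard (auto simp: scaleR_fun_def plus_fun_def fun_eq_iff algebra_simps)

end

text \<open>A point \<open>(x\<^sub>0, x\<^sub>1, x\<^sub>2)\<close> is represented by \<open>x :: real ^ 3\<close> with
  \<open>x\<^sub>0 = x $ 1\<close>, \<open>x\<^sub>1 = x $ 2\<close>, \<open>x\<^sub>2 = x $ 3\<close>. A function on a domain \<open>B\<close> is represented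
  by the total function that vanishes outside \<open>B\<close>.\<close>

datatype side = Inner | Outer

fun region :: "side \<Rightarrow> (real ^ 3) set" where
  "region Inner = {x. norm x < 1}"
| "region Outer = {x. norm x > 1}"

definition restr :: "'a set \<Rightarrow> ('a \<Rightarrow> 'b::zero) \<Rightarrow> 'a \<Rightarrow> 'b" where
  "restr B f = (\<lambda>x. if x \<in> B then f x else 0)"

definition vanishes_outside :: "'a set \<Rightarrow> ('a \<Rightarrow> 'b::zero) \<Rightarrow> bool" where
  "vanishes_outside B f \<longleftrightarrow> (\<forall>x. x \<notin> B \<longrightarrow> f x = 0)"

definition partial :: "3 \<Rightarrow> (real ^ 3 \<Rightarrow> 'b::real_normed_vector) \<Rightarrow> real ^ 3 \<Rightarrow> 'b" where
  "partial i f x = frechet_derivative f (at x) (axis i 1)"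

text \<open>\<open>Ck_on k S f\<close> is the class \<open>C\<^sup>k\<close> on an open set \<open>S\<close>.\<close>

primrec Ck_on :: "nat \<Rightarrow> (real ^ 3) set \<Rightarrow> (real ^ 3 \<Rightarrow> 'b::real_normed_vector) \<Rightarrow> bool" where
  "Ck_on 0 S f \<longleftrightarrow> continuous_on S f"
| "Ck_on (Suc k) S f \<longleftrightarrow>
     (\<forall>x\<in>S. f differentiable (at x)) \<and> (\<forall>i. Ck_on k S (partial i f))"

definition smooth_on :: "(real ^ 3) set \<Rightarrow> (real ^ 3 \<Rightarrow> 'b::real_normed_vector) \<Rightarrow> bool" where
  "smooth_on S f \<longleftrightarrow> (\<forall>k. Ck_on k S f)"

definition laplacian :: "(real ^ 3 \<Rightarrow> real) \<Rightarrow> real ^ 3 \<Rightarrow> real" where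
  "laplacian u x = (\<Sum>i\<in>UNIV. partial i (partial i u) x)"

definition harmonic_on :: "(real ^ 3) set \<Rightarrow> (real ^ 3 \<Rightarrow> real) \<Rightarrow> bool" where
  "harmonic_on S u \<longleftrightarrow> Ck_on 2 S u \<and> (\<forall>x\<in>S. laplacian u x = 0)"

definition homogeneous_on ::
    "(real ^ 3) set \<Rightarrow> int \<Rightarrow> (real ^ 3 \<Rightarrow> 'b::real_vector) \<Rightarrow> bool" where
  "homogeneous_on B n f \<longleftrightarrow>
     (\<forall>x\<in>B. \<forall>t>0. t *\<^sub>R x \<in> B \<longrightarrow> f (t *\<^sub>R x) = (t powi n) *\<^sub>R f x)"

definition L2_on :: "(real ^ 3) set \<Rightarrow> (real ^ 3 \<Rightarrow> 'b::real_normed_vector) \<Rightarrow> bool" where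
  "L2_on B f \<longleftrightarrow> f \<in> borel_measurable (lebesgue_on B) \<and>
     integrable (lebesgue_on B) (\<lambda>x. (norm (f x))\<^sup>2)"

text \<open>The components \<open>q $ 1, q $ 2, q $ 3, q $ 4\<close> are the coefficients of
  \<open>1, e\<^sub>1, e\<^sub>2, e\<^sub>3\<close> respectively.\<close>

type_synonym quat = "real ^ 4"

definition mk_quat :: "real \<Rightarrow> real \<Rightarrow> real \<Rightarrow> real \<Rightarrow> quat" where
  "mk_quat a b c d = (\<chi> i. if i = 1 then a else if i = 2 then b else if i = 3 then c else d)"

definition e1 :: quat where "e1 = mk_quat 0 1 0 0"
definition e2 :: quat where "e2 = mk_quat 0 0 1 0"
definition e3 :: quat where "e3 = mk_quat 0 0 0 1"

definition of_scalar :: "real \<Rightarrow> quat" where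
  "of_scalar a = mk_quat a 0 0 0"

definition qmult :: "quat \<Rightarrow> quat \<Rightarrow> quat" where
  "qmult p q = mk_quat
     (p$1 * q$1 - p$2 * q$2 - p$3 * q$3 - p$4 * q$4)
     (p$1 * q$2 + p$2 * q$1 + p$3 * q$4 - p$4 * q$3)
     (p$1 * q$3 - p$2 * q$4 + p$3 * q$1 + p$4 * q$2)
     (p$1 * q$4 + p$2 * q$3 - p$3 * q$2 + p$4 * q$1)"

definition qconj :: "quat \<Rightarrow> quat" where
  "qconj q = mk_quat (q$1) (- q$2) (- q$3) (- q$4)"

definition reduced_quats :: "quat set" where
  "reduced_quats = {q. q$4 = 0}"

lemma mk_quat_component [simp]:
  "mk_quat a b c d $ 1 = a" "mk_quat a b c d $ 2 = b"
  "mk_quat a b c d $ 3 = c" "mk_quat a b c d $ 4 = d"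
  by (simp_all add: mk_quat_def)

lemma quat_eq_iff: "p = q \<longleftrightarrow> p$1 = q$1 \<and> p$2 = q$2 \<and> p$3 = q$3 \<and> p$4 = q$4"
  for p q :: quat
  by (simp add: vec_eq_iff forall_4)

lemma quat_units:
  "qmult e1 e1 = of_scalar (-1)" "qmult e2 e2 = of_scalar (-1)" "qmult e3 e3 = of_scalar (-1)"
  "qmult e1 e2 = e3" "qmult e2 e3 = e1" "qmult e3 e1 = e2"
  "qmult e2 e1 = - e3" "qmult e3 e2 = - e1" "qmult e1 e3 = - e2"
  by (simp_all add: quat_eq_iff qmult_def e1_def e2_def e3_def of_scalar_def)

definition dbar :: "(real ^ 3 \<Rightarrow> quat) \<Rightarrow> real ^ 3 \<Rightarrow> quat" where
  "dbar f x = partial 1 f x + qmult e1 (partial 2 f x) + qmult e2 (partial 3 f x)"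

definition monogenic_on :: "(real ^ 3) set \<Rightarrow> (real ^ 3 \<Rightarrow> quat) \<Rightarrow> bool" where
  "monogenic_on S f \<longleftrightarrow>
     (\<forall>x\<in>S. f x \<in> reduced_quats) \<and> smooth_on S f \<and> (\<forall>x\<in>S. dbar f x = 0)"

definition harmonics :: "side \<Rightarrow> int \<Rightarrow> (real ^ 3 \<Rightarrow> real) set" where
  "harmonics \<sigma> n = {u. vanishes_outside (region \<sigma>) u \<and> harmonic_on (region \<sigma>) u \<and>
     L2_on (region \<sigma>) u \<and> homogeneous_on (region \<sigma>) n u}"

definition harmonics3 :: "side \<Rightarrow> int \<Rightarrow> (real ^ 3 \<Rightarrow> quat) set" where
  "harmonics3 \<sigma> n = {f. (\<lambda>x. f x $ 1) \<in> harmonics \<sigma> n \<and> (\<lambda>x. f x $ 2) \<in> harmonics \<sigma> n \<and>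
     (\<lambda>x. f x $ 3) \<in> harmonics \<sigma> n \<and> (\<forall>x. f x \<in> reduced_quats)}"

definition monogenics :: "side \<Rightarrow> int \<Rightarrow> (real ^ 3 \<Rightarrow> quat) set" where
  "monogenics \<sigma> n = {f. vanishes_outside (region \<sigma>) f \<and> monogenic_on (region \<sigma>) f \<and>
     L2_on (region \<sigma>) f \<and> homogeneous_on (region \<sigma>) n f}"

definition antimonogenics :: "side \<Rightarrow> int \<Rightarrow> (real ^ 3 \<Rightarrow> quat) set" where
  "antimonogenics \<sigma> n = (\<lambda>f. \<lambda>x. qconj (f x)) ` monogenics \<sigma> n"

definition ip :: "side \<Rightarrow> (real ^ 3 \<Rightarrow> quat) \<Rightarrow> (real ^ 3 \<Rightarrow> quat) \<Rightarrow> real" where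
  "ip \<sigma> f g =
     (LINT x | lebesgue_on (region \<sigma>). f x $ 1 * g x $ 1 + f x $ 2 * g x $ 2 + f x $ 3 * g x $ 3)"

definition contragenics :: "side \<Rightarrow> int \<Rightarrow> (real ^ 3 \<Rightarrow> quat) set" where
  "contragenics \<sigma> n = {f \<in> harmonics3 \<sigma> n.
     \<forall>g \<in> {a + b | a b. a \<in> monogenics \<sigma> n \<and> b \<in> antimonogenics \<sigma> n}. ip \<sigma> f g = 0}"

text \<open>Legendre polynomial by Rodrigues' formula.\<close>

definition legendre :: "nat \<Rightarrow> real poly" where
  "legendre n = smult (1 / (2 ^ n * fact n)) ((pderiv ^^ n) ([:-1, 0, 1:] ^ n))"

text \<open>The factor \<open>(1 - t\<^sup>2)\<^bsup>m/2\<^esup>\<close> is written as a natural power of the square root, because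
  \<open>0 powr 0 = 0\<close> would give the wrong value at \<open>t = \<plusminus>1\<close> for \<open>m = 0\<close>.\<close>

definition legendre_assoc :: "int \<Rightarrow> nat \<Rightarrow> real \<Rightarrow> real" where
  "legendre_assoc n m t = (let k = (if n \<ge> 0 then nat n else nat (- n - 1)) in
     (-1) ^ m * sqrt (1 - t\<^sup>2) ^ m * poly ((pderiv ^^ m) (legendre k)) t)"

datatype sgn_pm = Plus | Minus

fun flip :: "sgn_pm \<Rightarrow> sgn_pm" where
  "flip Plus = Minus"
| "flip Minus = Plus"

fun pm :: "sgn_pm \<Rightarrow> real" where
  "pm Plus = 1"
| "pm Minus = -1"

fun Phi :: "sgn_pm \<Rightarrow> nat \<Rightarrow> real \<Rightarrow> real" where
  "Phi Plus m \<phi> = cos (real m * \<phi>)"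
| "Phi Minus m \<phi> = sin (real m * \<phi>)"

definition point :: "real \<Rightarrow> real \<Rightarrow> real \<Rightarrow> real ^ 3" where
  "point \<rho> \<theta> \<phi> = vector [\<rho> * cos \<theta>, \<rho> * sin \<theta> * cos \<phi>, \<rho> * sin \<theta> * sin \<phi>]"

text \<open>A particular choice of spherical coordinates is made here; by \<open>U_point\<close> below the
  value does not depend on it.\<close>

definition U :: "int \<Rightarrow> nat \<Rightarrow> sgn_pm \<Rightarrow> real ^ 3 \<Rightarrow> real" where
  "U n m s x = norm x powi n * legendre_assoc n m (cos (arccos (x$1 / norm x)))
     * Phi s m (Arg (Complex (x$2) (x$3)))"

lemma norm_point: "\<rho> \<ge> 0 \<Longrightarrow> norm (point \<rho> \<theta> \<phi>) = \<rho>"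
proof -
  assume "\<rho> \<ge> 0"
  have "(\<rho> * cos \<theta>)\<^sup>2 + (\<rho> * sin \<theta> * cos \<phi>)\<^sup>2 + (\<rho> * sin \<theta> * sin \<phi>)\<^sup>2
      = \<rho>\<^sup>2 * ((cos \<theta>)\<^sup>2 + (sin \<theta>)\<^sup>2 * ((cos \<phi>)\<^sup>2 + (sin \<phi>)\<^sup>2))"
    by (simp only: power_mult_distrib algebra_simps)
  also have "\<dots> = \<rho>\<^sup>2"
    by simp
  finally show ?thesis
    using \<open>\<rho> \<ge> 0\<close>
    by (simp add: norm_vec_def L2_set_def sum_3 point_def)
qed

lemma U_point:
  assumes "\<rho> > 0" "0 \<le> \<theta>" "\<theta> \<le> pi"
  shows "U n m s (point \<rho> \<theta> \<phi>) = \<rho> powi n * legendre_assoc n m (cos \<theta>) * Phi s m \<phi>"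
proof -
  define z where "z = Complex (point \<rho> \<theta> \<phi> $ 2) (point \<rho> \<theta> \<phi> $ 3)"
  have z: "z = of_real (\<rho> * sin \<theta>) * cis \<phi>"
    by (simp add: z_def point_def complex_eq_iff)
  have "sin \<theta> \<ge> 0"
    using assms by (simp add: sin_ge_zero)
  then consider "sin \<theta> = 0" "m = 0" | "sin \<theta> = 0" "m > 0" | "sin \<theta> > 0"
    by (cases "sin \<theta> = 0"; cases "m = 0") auto
  then have *: "legendre_assoc n m (cos \<theta>) * Phi s m (Arg z)
      = legendre_assoc n m (cos \<theta>) * Phi s m \<phi>"
  proof cases
    case 1
    then show ?thesis by (cases s) auto
  next
    case 2
    then have "sqrt (1 - (cos \<theta>)\<^sup>2) = 0"
      using sin_squared_eq[of \<theta>] by simp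
    with 2 show ?thesis by (simp add: legendre_assoc_def Let_def power_0_left)
  next
    case 3
    then have "\<rho> * sin \<theta> > 0" using assms by simp
    then have "z \<noteq> 0" "sgn z = cis \<phi>"
      using \<open>\<rho> > 0\<close> \<open>sin \<theta> > 0\<close> z by (auto simp: sgn_mult sgn_of_real)
    then have "cis (Arg z) = cis \<phi>" by (metis cis_Arg)
    then have "cis (real m * Arg z) = cis (real m * \<phi>)"
      by (metis Complex.DeMoivre)
    then show ?thesis by (cases s) (auto simp: complex_eq_iff)
  qed
  have "point \<rho> \<theta> \<phi> $ 1 / norm (point \<rho> \<theta> \<phi>) = cos \<theta>"
    using assms by (simp add: norm_point) (simp add: point_def)
  then show ?thesis
    using * assms by (simp add: U_def norm_point arccos_cos mult.assoc flip: z_def)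
qed

definition Z0 :: "int \<Rightarrow> real ^ 3 \<Rightarrow> quat" where
  "Z0 n x = U n 1 Minus x *\<^sub>R e1 - U n 1 Plus x *\<^sub>R e2"

definition Zpm :: "int \<Rightarrow> nat \<Rightarrow> sgn_pm \<Rightarrow> real ^ 3 \<Rightarrow> quat" where
  "Zpm n m s x = (let c = (of_int n - real m) * (of_int n - real m + 1) in
     (U n (m + 1) (flip s) x + c * U n (m - 1) (flip s) x) *\<^sub>R e1
     - pm s *\<^sub>R ((U n (m + 1) s x - c * U n (m - 1) s x) *\<^sub>R e2))"

definition Zlast :: "int \<Rightarrow> sgn_pm \<Rightarrow> real ^ 3 \<Rightarrow> quat" where
  "Zlast n s x = of_scalar (U n (nat (- n - 1)) s x)"

datatype label = Zero | Mid nat sgn_pm | Last sgn_pm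

definition labels :: "side \<Rightarrow> int \<Rightarrow> label set" where
  "labels \<sigma> n = {Zero}
     \<union> {Mid m s | m s. 1 \<le> m \<and> real m \<le> \<bar>of_int n - 1/2\<bar> - 1/2}
     \<union> (if \<sigma> = Outer then {Last Plus, Last Minus} else {})"

fun Zfun :: "int \<Rightarrow> label \<Rightarrow> real ^ 3 \<Rightarrow> quat" where
  "Zfun n Zero = Z0 n"
| "Zfun n (Mid m s) = Zpm n m s"
| "Zfun n (Last s) = Zlast n s"

definition Z :: "side \<Rightarrow> int \<Rightarrow> label \<Rightarrow> real ^ 3 \<Rightarrow> quat" where
  "Z \<sigma> n l = restr (region \<sigma>) (Zfun n l)"

definition orthogonal_basis ::
    "side \<Rightarrow> 'i set \<Rightarrow> ('i \<Rightarrow> real ^ 3 \<Rightarrow> quat) \<Rightarrow> (real ^ 3 \<Rightarrow> quat) set \<Rightarrow> bool" where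
  "orthogonal_basis \<sigma> I b V \<longleftrightarrow>
     inj_on b I \<and> independent (b ` I) \<and> span (b ` I) = V \<and>
     (\<forall>i\<in>I. \<forall>j\<in>I. i \<noteq> j \<longrightarrow> ip \<sigma> (b i) (b j) = 0)"

end

theory Submission
  imports Defs
begin

text \<open>
  Write \<open>\<zeta> = x\<^sub>1 + i x\<^sub>2\<close> and \<open>V\<^sub>n\<^sub>,\<^sub>m = U\<^sup>+ + i U\<^sup>-\<close>. Everything rests on the fact that
  \<open>\<partial>\<^sub>0\<close> multiplies \<open>V\<close> by \<open>n + m\<close> and lowers \<open>n\<close>, while \<open>\<partial>\<^sub>1 \<plusminus> i \<partial>\<^sub>2\<close> lowers \<open>n\<close> and moves
  \<open>m\<close> to \<open>m \<plusminus> 1\<close>, with the factor \<open>1\<close> upwards and \<open>-(n + m)(n + m - 1)\<close> downwards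
  (\<open>partial_1_U\<close>, \<open>partial_2_U_Suc\<close>, \<open>partial_3_U_Suc\<close>). These formulas hold for all
  integers \<open>n\<close>, so the ball and its exterior can be treated together.

  A monogenic function is \<open>(\<partial>\<^sub>0u, -\<partial>\<^sub>1u, -\<partial>\<^sub>2u)\<close> for a harmonic \<open>u\<close> of degree \<open>n + 1\<close>: its system
  says that \<open>F = (f\<^sub>0, -f\<^sub>1, -f\<^sub>2)\<close> is curl and divergence free, and for a homogeneous curl-free field
  Euler's identity gives the potential \<open>x \<cdot> F / (n + 1)\<close> (\<open>monogenics_expansion\<close>). Adding and
  subtracting conjugates, orthogonality to \<open>M + M\<close>-bar becomes orthogonality to the scalar parts
  \<open>\<partial>\<^sub>0u\<close> and, separately, to the vector parts \<open>(\<partial>\<^sub>1u, \<partial>\<^sub>2u)\<close>. By the formulas above the vector part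
  for \<open>u = U\<^sub>n\<^sub>+\<^sub>1\<^sub>,\<^sub>m\<close> is a combination \<open>A - c' B\<close> of a term \<open>A\<close> of order \<open>m + 1\<close> and a term \<open>B\<close>
  of order \<open>m - 1\<close>, and \<open>Z\<^sub>n\<^sub>,\<^sub>m = A + c B\<close>. All the \<open>A\<close> and \<open>B\<close> are mutually orthogonal and
  \<open>|A|\<^sup>2 = c c' |B|\<^sup>2\<close> (\<open>order_norm_ratio\<close>), so \<open>Z\<^sub>n\<^sub>,\<^sub>m\<close> is exactly the orthogonal complement of the
  vector part in the plane of \<open>A\<close> and \<open>B\<close>; as \<open>c + c' > 0\<close>, the two span that plane. The
  remaining members of the family are the \<open>A\<close>, \<open>B\<close> and scalar functions for which the
  corresponding gradient vanishes.

  Two analytic facts are needed, and both come from one lemma: the infinitesimal rotations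
  \<open>x\<^sub>a \<partial>\<^sub>b - x\<^sub>b \<partial>\<^sub>a\<close> integrate to zero, hence are skew-symmetric (\<open>lint_rot_deriv\<close>,
  \<open>wip_rot_deriv\<close>). The rotation about the polar axis gives the orthogonality of the \<open>U\<close>, and a
  rotation about another axis gives the ratio of their norms for consecutive orders. The sum of
  the squares of the three rotations acts on homogeneous harmonic functions of degree \<open>d\<close> as
  \<open>-d(d + 1)\<close>, so a harmonic function of degree \<open>d\<close> orthogonal to all \<open>U\<^sub>d\<^sub>,\<^sub>m\<close> is orthogonal to every \<open>U\<close>
  on the sphere. Since these span all polynomials on the sphere, the Stone--Weierstrass theorem
  shows that the \<open>U\<^sub>d\<^sub>,\<^sub>m\<close> exhaust the harmonic functions of degree \<open>d\<close> (\<open>hharm_expansion\<close>).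
\<close>

section \<open>Legendre polynomials of integer degree\<close>

lemma pderiv_funpow_commute: "(pderiv ^^ m) (pderiv p) = pderiv ((pderiv ^^ m) p)"
  by (induction m) simp_all

lemma pderiv_funpow_smult: "(pderiv ^^ m) (smult c p) = smult c ((pderiv ^^ m) p)"
  for p :: "real poly"
  by (induction m) (simp_all add: pderiv_smult)

lemma pderiv_funpow_X_times:
  "(pderiv ^^ Suc m) ([:0, 1:] * p)
     = [:0, 1:] * (pderiv ^^ Suc m) p + smult (real (Suc m)) ((pderiv ^^ m) p)"
  for p :: "real poly"
proof (induction m)
  case 0
  show ?case by (simp add: pderiv_mult pderiv_pCons)
next
  case (Suc m)
  have "(pderiv ^^ Suc (Suc m)) ([:0, 1:] * p) = pderiv ((pderiv ^^ Suc m) ([:0, 1:] * p))"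
    by simp
  also have "\<dots> = pderiv ([:0, 1:] * (pderiv ^^ Suc m) p + smult (real (Suc m)) ((pderiv ^^ m) p))"
    by (simp only: Suc)
  also have "\<dots> = [:0, 1:] * (pderiv ^^ Suc (Suc m)) p + smult (real (Suc (Suc m))) ((pderiv ^^ Suc m) p)"
    by (rule poly_ext) (simp add: pderiv_mult pderiv_pCons pderiv_add pderiv_smult algebra_simps)
  finally show ?case .
qed

text \<open>Differentiate \<open>(t\<^sup>2 - 1) w' = 2 k t w\<close>, valid for \<open>w = (t\<^sup>2 - 1)\<^sup>k\<close>, another \<open>k + 1\<close> times.\<close>

lemma legendre_differential_equation:
  "[:1, 0, -1:] * pderiv (pderiv (legendre k)) - smult 2 ([:0, 1:] * pderiv (legendre k))
     + smult (real k * (real k + 1)) (legendre k) = 0"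
proof -
  define w :: "real poly" where "w = [:-1, 0, 1:] ^ k"
  have w1: "[:0, 1:] * ([:0, 1:] * pderiv w) - pderiv w = smult (2 * real k) ([:0, 1:] * w)"
  proof (cases k)
    case 0
    then show ?thesis by (simp add: w_def)
  next
    case (Suc j)
    show ?thesis
      by (rule poly_ext) (simp add: w_def Suc pderiv_power_Suc pderiv_pCons algebra_simps del: power_Suc, simp add: algebra_simps)
  qed
  have "[:1, 0, -1:] * (pderiv ^^ Suc (Suc k)) w - smult 2 ([:0, 1:] * (pderiv ^^ Suc k) w)
      + smult (real k * (real k + 1)) ((pderiv ^^ k) w) = 0"
  proof (rule poly_ext)
    fix t
    have "poly ((pderiv ^^ Suc k) ([:0, 1:] * ([:0, 1:] * pderiv w) - pderiv w)) t
        = poly ((pderiv ^^ Suc k) (smult (2 * real k) ([:0, 1:] * w))) t"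
      by (simp only: w1)
    moreover have "(pderiv ^^ m) (p - q) = (pderiv ^^ m) p - (pderiv ^^ m) q"
      for m and p q :: "real poly"
      by (induction m) (simp_all add: pderiv_diff)
    moreover have "poly ((pderiv ^^ k) ([:0, 1:] * pderiv w)) t
        = t * poly ((pderiv ^^ Suc k) w) t + real k * poly ((pderiv ^^ k) w) t"
    proof (cases k)
      case (Suc j)
      then show ?thesis
        using pderiv_funpow_X_times[of j "pderiv w"]
        by (simp only: pderiv_funpow_commute) (simp add: pderiv_funpow_commute algebra_simps)
    qed simp
    ultimately show "poly ([:1, 0, -1:] * (pderiv ^^ Suc (Suc k)) w
        - smult 2 ([:0, 1:] * (pderiv ^^ Suc k) w)
        + smult (real k * (real k + 1)) ((pderiv ^^ k) w)) t = poly 0 t"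
      by (simp only: pderiv_funpow_X_times pderiv_funpow_smult)
         (simp add: pderiv_funpow_commute algebra_simps)
  qed
  then have "smult (1 / (2 ^ k * fact k)) ([:1, 0, -1:] * (pderiv ^^ Suc (Suc k)) w
      - smult 2 ([:0, 1:] * (pderiv ^^ Suc k) w)
      + smult (real k * (real k + 1)) ((pderiv ^^ k) w)) = 0"
    by simp
  then show ?thesis
    by (simp add: legendre_def pderiv_smult smult_add_right smult_diff_right mult.commute w_def)
qed

lemma pderiv_legendre_Suc:
  "pderiv (legendre (Suc k)) = [:0, 1:] * pderiv (legendre k) + smult (real k + 1) (legendre k)"
proof -
  define w :: "real poly" where "w = [:-1, 0, 1:] ^ k"
  have "pderiv ([:-1, 0, 1:] ^ Suc k) = smult (2 * (real k + 1)) ([:0, 1:] * w)"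
    by (rule poly_ext) (simp add: w_def pderiv_power_Suc pderiv_pCons algebra_simps del: power_Suc)
  then have *: "(pderiv ^^ Suc (Suc k)) ([:-1, 0, 1:] ^ Suc k)
      = smult (2 * (real k + 1)) ([:0, 1:] * (pderiv ^^ Suc k) w
          + smult (real (Suc k)) ((pderiv ^^ k) w))"
    by (metis pderiv_funpow_commute funpow.simps(2) comp_apply pderiv_funpow_X_times
        pderiv_funpow_smult)
  have "pderiv (legendre (Suc k))
      = smult (1 / (2 ^ Suc k * fact (Suc k))) ((pderiv ^^ Suc (Suc k)) ([:-1, 0, 1:] ^ Suc k))"
    by (simp add: legendre_def pderiv_smult del: power_Suc fact_Suc)
  also have "\<dots> = smult (1 / (2 ^ Suc k * fact (Suc k)) * (2 * (real k + 1)))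
      ([:0, 1:] * (pderiv ^^ Suc k) w + smult (real (Suc k)) ((pderiv ^^ k) w))"
    by (simp only: * smult_smult)
  also have "1 / (2 ^ Suc k * fact (Suc k)) * (2 * (real k + 1)) = 1 / (2 ^ k * fact k)"
    by (simp add: divide_simps)
  finally show ?thesis
    by (simp add: legendre_def pderiv_smult smult_add_right mult.commute w_def add.commute)
qed

text \<open>Eliminating second derivatives between the differential equations for \<open>k\<close> and \<open>k + 1\<close> and the
  recurrence above leaves this one, multiplied by \<open>k + 2\<close>.\<close>

lemma pderiv_legendre_pred:
  "pderiv (legendre k) = [:0, 1:] * pderiv (legendre (Suc k)) - smult (real k + 1) (legendre (Suc k))"
proof (rule poly_ext)
  fix t
  define R R1 R2 where "R = poly (legendre k) t" and "R1 = poly (pderiv (legendre k)) t"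
    and "R2 = poly (pderiv (pderiv (legendre k))) t"
  define P P1 P2 where "P = poly (legendre (Suc k)) t" and "P1 = poly (pderiv (legendre (Suc k))) t"
    and "P2 = poly (pderiv (pderiv (legendre (Suc k)))) t"
  have P1: "P1 = t * R1 + (real k + 1) * R"
    by (simp add: P1_def pderiv_legendre_Suc R_def R1_def)
  have P2: "P2 = t * R2 + (real k + 2) * R1"
    by (simp add: P2_def pderiv_legendre_Suc R2_def R1_def pderiv_add pderiv_mult pderiv_smult
        pderiv_pCons algebra_simps)
  have R: "(1 - t * t) * R2 - 2 * t * R1 + real k * (real k + 1) * R = 0"
    using arg_cong[OF legendre_differential_equation[of k], of "\<lambda>p. poly p t"]
    by (simp add: R_def R1_def R2_def algebra_simps)
  have P: "(1 - t * t) * P2 - 2 * t * P1 + (real k + 1) * (real k + 2) * P = 0"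
    using arg_cong[OF legendre_differential_equation[of "Suc k"], of "\<lambda>p. poly p t"]
    by (simp add: P_def P1_def P2_def algebra_simps)
  have "(real k + 2) * ((real k + 1) * P) = (real k + 2) * (t * P1 - R1)"
    using P1 P2 R P by algebra
  then have "(real k + 1) * P = t * P1 - R1"
    by (simp add: add_eq_0_iff)
  then show "poly (pderiv (legendre k)) t = poly ([:0, 1:] * pderiv (legendre (Suc k))
      - smult (real k + 1) (legendre (Suc k))) t"
    by (simp add: P_def P1_def R1_def)
qed

text \<open>The reflection \<open>n \<mapsto> -n - 1\<close> preserves \<open>n(n + 1)\<close>; the functions of degree \<open>n < 0\<close> are the Kelvin
  transforms of those of degree \<open>-n - 1\<close>.\<close>

definition legendre_index :: "int \<Rightarrow> nat" where
  "legendre_index n = (if n \<ge> 0 then nat n else nat (- n - 1))"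

definition LP :: "int \<Rightarrow> nat \<Rightarrow> real poly" where
  "LP n m = (pderiv ^^ m) (legendre (legendre_index n))"

lemma pderiv_LP: "pderiv (LP n m) = LP n (Suc m)"
  by (simp add: LP_def)

text \<open>Lowering \<open>n\<close> lowers the Legendre index for positive \<open>n\<close> and raises it for negative \<open>n\<close>. The two
  recurrences between neighbouring Legendre polynomials trade places accordingly, which is why
  each of the relations below holds for all integers \<open>n\<close>.\<close>

lemma legendre_index_step:
  obtains (pos) k where "n = int k + 1" "legendre_index n = Suc k" "legendre_index (n - 1) = k"
  | (zero) "n = 0" "legendre_index n = 0" "legendre_index (n - 1) = 0"
  | (neg) k where "n = - int k - 1" "legendre_index n = k" "legendre_index (n - 1) = Suc k"
proof (cases "n \<ge> 1")
  case True
  then show ?thesis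
    by (intro pos[of "nat (n - 1)"]) (auto simp: legendre_index_def)
next
  case False
  then show ?thesis
    using zero neg[of "nat (- n - 1)"] by (cases "n = 0") (auto simp: legendre_index_def)
qed

lemma legendre_index_eigenvalue:
  "real (legendre_index n) * (real (legendre_index n) + 1) = of_int n * (of_int n + 1)"
  by (auto simp: legendre_index_def algebra_simps)

lemma LP_differential_equation_poly:
  "[:1, 0, -1:] * LP n (Suc (Suc m)) - smult (2 * (real m + 1)) ([:0, 1:] * LP n (Suc m))
     + smult ((of_int n + real m + 1) * (of_int n - real m)) (LP n m) = 0"
proof (induction m)
  case 0
  then show ?case
    using legendre_differential_equation[of "legendre_index n"]
    by (simp add: LP_def legendre_index_eigenvalue mult.commute)
next
  case (Suc m)
  show ?case
  proof (rule poly_ext)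
    fix t
    show "poly ([:1, 0, -1:] * LP n (Suc (Suc (Suc m)))
        - smult (2 * (real (Suc m) + 1)) ([:0, 1:] * LP n (Suc (Suc m)))
        + smult ((of_int n + real (Suc m) + 1) * (of_int n - real (Suc m))) (LP n (Suc m))) t
        = poly 0 t"
      using arg_cong[OF Suc, of "\<lambda>p. poly (pderiv p) t"]
      by (simp add: pderiv_add pderiv_diff pderiv_mult pderiv_smult pderiv_pCons pderiv_minus pderiv_LP
          algebra_simps)
  qed
qed

lemma LP_lower_poly:
  "LP (n - 1) (Suc m) = [:0, 1:] * LP n (Suc m) - smult (of_int n - real m) (LP n m)"
proof (induction m)
  case 0
  show ?case
  proof (cases rule: legendre_index_step[of n])
    case (pos k)
    then show ?thesis using pderiv_legendre_pred[of k] by (simp add: LP_def)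
  next
    case zero
    then show ?thesis by (simp add: LP_def legendre_def)
  next
    case (neg k)
    show ?thesis
      by (rule poly_ext) (simp add: LP_def neg(2,3) neg(1)[THEN arg_cong, of real_of_int] pderiv_legendre_Suc[of k] algebra_simps)
  qed
next
  case (Suc m)
  show ?case
  proof (rule poly_ext)
    fix t
    show "poly (LP (n - 1) (Suc (Suc m))) t = poly ([:0, 1:] * LP n (Suc (Suc m))
        - smult (of_int n - real (Suc m)) (LP n (Suc m))) t"
      using arg_cong[OF Suc, of "\<lambda>p. poly (pderiv p) t"]
      by (simp add: pderiv_add pderiv_diff pderiv_mult pderiv_smult pderiv_pCons pderiv_minus pderiv_LP
          algebra_simps)
  qed
qed

lemma LP_raise_poly:
  "LP n (Suc m) = [:0, 1:] * LP (n - 1) (Suc m) + smult (of_int n + real m) (LP (n - 1) m)"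
proof (induction m)
  case 0
  show ?case
  proof (cases rule: legendre_index_step[of n])
    case (pos k)
    then show ?thesis using pderiv_legendre_Suc[of k] by (simp add: LP_def)
  next
    case zero
    then show ?thesis by (simp add: LP_def legendre_def)
  next
    case (neg k)
    show ?thesis
      by (rule poly_ext) (simp add: LP_def neg(2,3) neg(1)[THEN arg_cong, of real_of_int] pderiv_legendre_pred[of k] algebra_simps)
  qed
next
  case (Suc m)
  show ?case
  proof (rule poly_ext)
    fix t
    show "poly (LP n (Suc (Suc m))) t = poly ([:0, 1:] * LP (n - 1) (Suc (Suc m))
        + smult (of_int n + real (Suc m)) (LP (n - 1) (Suc m))) t"
      using arg_cong[OF Suc, of "\<lambda>p. poly (pderiv p) t"]
      by (simp add: pderiv_add pderiv_diff pderiv_mult pderiv_smult pderiv_pCons pderiv_minus pderiv_LP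
          algebra_simps)
  qed
qed

abbreviation lp :: "int \<Rightarrow> nat \<Rightarrow> real \<Rightarrow> real" where
  "lp n m t \<equiv> poly (LP n m) t"

lemma lp_differential_equation:
  "(1 - t\<^sup>2) * lp n (Suc (Suc m)) t
     = 2 * (real m + 1) * t * lp n (Suc m) t - (of_int n + real m + 1) * (of_int n - real m) * lp n m t"
  using arg_cong[OF LP_differential_equation_poly[of n m], of "\<lambda>p. poly p t"]
  by (simp add: algebra_simps power2_eq_square)

lemma lp_lower: "lp (n - 1) (Suc m) t = t * lp n (Suc m) t - (of_int n - real m) * lp n m t"
  using arg_cong[OF LP_lower_poly[of n m], of "\<lambda>p. poly p t"] by simp

lemma lp_raise: "lp n (Suc m) t = t * lp (n - 1) (Suc m) t + (of_int n + real m) * lp (n - 1) m t"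
  using arg_cong[OF LP_raise_poly[of n m], of "\<lambda>p. poly p t"] by simp

section \<open>The solid harmonics in Cartesian coordinates\<close>

fun sectoral :: "sgn_pm \<Rightarrow> nat \<Rightarrow> real ^ 3 \<Rightarrow> real" where
  "sectoral Plus m x = Re (Complex (x$2) (x$3) ^ m)"
| "sectoral Minus m x = Im (Complex (x$2) (x$3) ^ m)"

lemma norm3_squared: "(norm x)\<^sup>2 = (x$1)\<^sup>2 + (x$2)\<^sup>2 + (x$3)\<^sup>2" for x :: "real ^ 3"
  by (simp add: norm_vec_def L2_set_def sum_3)

text \<open>The factor \<open>sin\<^sup>m \<theta>\<close> of the associated Legendre function turns the angular factor of order \<open>m\<close> into
  the real or imaginary part of \<open>\<zeta>\<^sup>m\<close>, up to the power \<open>|x|\<^sup>m\<close>.\<close>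

lemma U_cartesian:
  assumes "x \<noteq> 0"
  shows "U n m s x = (-1) ^ m * norm x powi (n - int m) * lp n m (x$1 / norm x) * sectoral s m x"
proof -
  define z where "z = Complex (x$2) (x$3)"
  define t where "t = x$1 / norm x"
  have \<rho>: "norm x > 0" using assms by simp
  have t: "\<bar>t\<bar> \<le> 1"
    using component_le_norm_cart[of x 1] \<rho> by (simp add: t_def divide_simps)
  have z: "norm z = norm x * sqrt (1 - t\<^sup>2)"
  proof -
    have "(norm x)\<^sup>2 * t\<^sup>2 = (x$1)\<^sup>2"
      using \<rho> by (simp add: t_def power_divide)
    then have "(norm z)\<^sup>2 = (norm x)\<^sup>2 * (1 - t\<^sup>2)"
      using \<rho> norm3_squared[of x] by (simp add: z_def cmod_def right_diff_distrib)
    then show ?thesis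
      by (metis norm_ge_zero real_sqrt_mult real_sqrt_abs abs_of_nonneg)
  qed
  have "z ^ m = rcis (norm z ^ m) (real m * Arg z)"
    by (metis DeMoivre2 rcis_cmod_Arg)
  then have "sectoral s m x = norm z ^ m * Phi s m (Arg z)"
    by (cases s) (simp_all add: z_def[symmetric])
  moreover have "norm x powi n = norm x powi (n - int m) * norm x ^ m"
    using \<rho> by (simp add: power_int_diff)
  ultimately show ?thesis
    using t by (simp add: U_def legendre_assoc_def LP_def legendre_index_def Let_def
        z_def[symmetric] t_def[symmetric] cos_arccos_abs z power_mult_distrib)
qed

lemma U_0 [simp]: "n \<noteq> 0 \<Longrightarrow> U n m s 0 = 0"
  by (simp add: U_def power_int_0_left_if)

lemma partial_eqI: "(f has_derivative D) (at x) \<Longrightarrow> partial i f x = D (axis i 1)"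
  unfolding partial_def using frechet_derivative_at by metis

lemma sectoral_has_derivative:
  "(sectoral s m has_derivative (\<lambda>h. real m * (sectoral s (m - 1) x * h$2
      - pm s * sectoral (flip s) (m - 1) x * h$3))) (at x)"
proof -
  have lin: "bounded_linear (\<lambda>x::real^3. Complex (x$2) (x$3))"
    unfolding Complex_eq
    by (intro bounded_linear_intros bounded_linear_add bounded_linear_vec_nth
        bounded_linear_compose[OF bounded_linear_of_real] bounded_linear_const_mult)
  have z: "((\<lambda>x. Complex (x$2) (x$3) ^ m) has_derivative
      (\<lambda>h. of_nat m * Complex (h$2) (h$3) * Complex (x$2) (x$3) ^ (m - 1))) (at x)"
    using has_derivative_power[OF bounded_linear_imp_has_derivative[OF lin], of m x UNIV]
    by simp
  show ?thesis
  proof (cases s)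
    case Plus
    have "sectoral s m = (\<lambda>x. Re (Complex (x$2) (x$3) ^ m))"
      by (auto simp: Plus)
    with has_derivative_Re[OF z] show ?thesis
      by (auto simp: Plus algebra_simps elim!: has_derivative_eq_rhs)
  next
    case Minus
    have "sectoral s m = (\<lambda>x. Im (Complex (x$2) (x$3) ^ m))"
      by (auto simp: Minus)
    with has_derivative_Im[OF z] show ?thesis
      by (auto simp: Minus algebra_simps elim!: has_derivative_eq_rhs)
  qed
qed

lemma sectoral_0 [simp]: "sectoral s 0 x = (if s = Plus then 1 else 0)"
  by (cases s) auto

lemma sectoral_Suc:
  "sectoral s (Suc m) x = x$2 * sectoral s m x - pm s * x$3 * sectoral (flip s) m x"
  by (cases s) simp_all

lemma pm_squared [simp]: "pm s * pm s = 1" "pm (flip s) = - pm s" "flip (flip s) = s"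
  "pm s * (pm s * a) = a"
  by (cases s; simp)+

lemma sectoral_Suc_Suc:
  "2 * x$2 * sectoral s (Suc m) x
     = sectoral s (Suc (Suc m)) x + ((x$2)\<^sup>2 + (x$3)\<^sup>2) * sectoral s m x"
  "2 * pm s * x$3 * sectoral (flip s) (Suc m) x
     = ((x$2)\<^sup>2 + (x$3)\<^sup>2) * sectoral s m x - sectoral s (Suc (Suc m)) x"
  by (simp_all add: sectoral_Suc algebra_simps power2_eq_square)

text \<open>The factors are differentiated separately: those in \<open>|x|\<close> and \<open>x\<^sub>0 / |x|\<close> contribute a multiple
  of the first coordinate of \<open>h\<close> and a multiple of \<open>x \<bullet> h\<close>.\<close>

lemma U_has_derivative_cartesian:
  assumes "x \<noteq> 0"
  defines "\<rho> \<equiv> norm x" and "t \<equiv> x$1 / norm x"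
  shows "(U n m s has_derivative (\<lambda>h. (-1) ^ m *
     ((\<rho> powi (n - int m - 1) * lp n (Suc m) t * h$1
       + \<rho> powi (n - int m - 2) * ((of_int n - real m) * lp n m t - t * lp n (Suc m) t) * (x \<bullet> h))
        * sectoral s m x
      + \<rho> powi (n - int m) * lp n m t * (real m * (sectoral s (m - 1) x * h$2
           - pm s * sectoral (flip s) (m - 1) x * h$3))))) (at x)"
proof -
  have \<rho>: "\<rho> \<noteq> 0" using assms by simp
  have t_def': "t = x$1 / \<rho>" by (simp add: t_def \<rho>_def)
  have norm: "(norm has_derivative (\<lambda>h. (x \<bullet> h) / \<rho>)) (at x)"
    using has_derivative_norm[OF assms(1)] assms(1)
    by (simp add: \<rho>_def sgn_div_norm inner_scaleR_right inner_commute divide_inverse mult.commute)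
  have t: "((\<lambda>y. y$1 / norm y) has_derivative (\<lambda>h. h$1 / \<rho> - t * (x \<bullet> h) / \<rho>\<^sup>2)) (at x)"
    using has_derivative_divide'[OF bounded_linear_imp_has_derivative[OF bounded_linear_vec_nth] norm, of 1]
      assms(1)
    by (auto simp: \<rho>_def t_def divide_simps power2_eq_square elim!: has_derivative_eq_rhs)
  have q: "((\<lambda>y. lp n m (y$1 / norm y)) has_derivative
      (\<lambda>h. lp n (Suc m) t * (h$1 / \<rho> - t * (x \<bullet> h) / \<rho>\<^sup>2))) (at x)"
    using has_derivative_compose[OF t, of "lp n m" "\<lambda>h. lp n (Suc m) t * h"]
      poly_DERIV[of "LP n m" t]
    by (simp add: t_def pderiv_LP has_field_derivative_def)
  have r: "((\<lambda>y. norm y powi (n - int m)) has_derivative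
      (\<lambda>h. (x \<bullet> h) / \<rho> * (of_int (n - int m) * \<rho> powi (n - int m - 1)))) (at x)"
    using has_derivative_power_int[OF _ norm, of "n - int m"] assms(1) by (simp add: \<rho>_def)
  have pow: "\<rho> powi (n - int m - 1) = \<rho> powi (n - int m - 2) * \<rho>"
    "\<rho> powi (n - int m) = \<rho> powi (n - int m - 2) * (\<rho> * \<rho>)"
    using \<rho> by (simp_all add: power_int_diff power2_eq_square)
  have "((\<lambda>y. (-1) ^ m * (norm y powi (n - int m) * lp n m (y$1 / norm y) * sectoral s m y))
      has_derivative (\<lambda>h. (-1) ^ m *
     ((\<rho> powi (n - int m - 1) * lp n (Suc m) t * h$1
       + \<rho> powi (n - int m - 2) * ((of_int n - real m) * lp n m t - t * lp n (Suc m) t) * (x \<bullet> h))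
        * sectoral s m x
      + \<rho> powi (n - int m) * lp n m t * (real m * (sectoral s (m - 1) x * h$2
           - pm s * sectoral (flip s) (m - 1) x * h$3))))) (at x)"
    apply (rule has_derivative_eq_rhs)
     apply (rule has_derivative_mult_right has_derivative_mult r q sectoral_has_derivative)+
    unfolding \<rho>_def[symmetric] t_def'[symmetric] pow
    using \<rho> by (simp add: fun_eq_iff power2_eq_square divide_simps) (simp add: algebra_simps)
  then show ?thesis
    by (rule has_derivative_transform_within_open[where s = "- {0}"])
      (use assms(1) in \<open>auto simp: U_cartesian mult.assoc\<close>)
qed

text \<open>These two identities are \<open>\<partial>\<^sub>0\<close> and \<open>\<partial>\<^sub>1 - i \<partial>\<^sub>2\<close> on solid harmonics, written in the
  variable \<open>t = x\<^sub>0 / |x|\<close>.\<close>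

lemma lp_degree_pred:
  "(of_int n + real m) * lp (n - 1) m t = (of_int n - real m) * t * lp n m t + (1 - t\<^sup>2) * lp n (Suc m) t"
proof -
  have "(of_int n + real m) * lp (n - 1) m t = lp n (Suc m) t - t * lp (n - 1) (Suc m) t"
    using lp_raise[of n m t] by simp
  then show ?thesis
    by (simp add: lp_lower power2_eq_square algebra_simps)
qed

lemma lp_degree_order_pred:
  "2 * (real j + 1) * lp n (Suc j) t - (1 - t\<^sup>2) * lp (n - 1) (Suc (Suc j)) t
     = (of_int n + real j + 1) * (of_int n + real j) * lp (n - 1) j t"
  using lp_differential_equation[of t "n - 1" j] lp_raise[of n j t]
  by (simp add: algebra_simps)

lemma U_differentiable: "x \<noteq> 0 \<Longrightarrow> U n m s differentiable (at x)"
  using U_has_derivative_cartesian differentiableI by blast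

text \<open>The ladder: partial derivatives keep the family of solid harmonics and lower the degree by one,
  rotations keep the degree. The rotation about the polar axis also keeps the order, the other one
  moves it by one. For order \<open>0\<close> the two functions of order
  \<open>m - 1\<close> and \<open>m + 1\<close> coincide up to a factor, hence the separate formulas.\<close>

lemma
  assumes "x \<noteq> 0"
  shows partial_1_U: "partial 1 (U n m s) x = (of_int n + real m) * U (n - 1) m s x"
    and partial_2_U_Suc: "partial 2 (U n (Suc j) s) x = (U (n - 1) (Suc (Suc j)) s x
          - (of_int n + real j + 1) * (of_int n + real j) * U (n - 1) j s x) / 2"
    and partial_3_U_Suc: "partial 3 (U n (Suc j) s) x = pm s * (U (n - 1) (Suc (Suc j)) (flip s) x
          + (of_int n + real j + 1) * (of_int n + real j) * U (n - 1) j (flip s) x) / 2"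
    and partial_2_U_0: "partial 2 (U n 0 s) x = (if s = Plus then U (n - 1) 1 Plus x else 0)"
    and partial_3_U_0: "partial 3 (U n 0 s) x = (if s = Plus then U (n - 1) 1 Minus x else 0)"
    and rotation_axis_U: "x$2 * partial 3 (U n m s) x - x$3 * partial 2 (U n m s) x
          = - (pm s * real m * U n m (flip s) x)"
    and rotation_12_U_Suc: "x$1 * partial 2 (U n (Suc j) s) x - x$2 * partial 1 (U n (Suc j) s) x
          = (U n (Suc (Suc j)) s x
              - (of_int n + real j + 1) * (of_int n - real j) * U n j s x) / 2"
    and rotation_12_U_0: "x$1 * partial 2 (U n 0 s) x - x$2 * partial 1 (U n 0 s) x
          = (if s = Plus then U n 1 Plus x else 0)"
proof -
  define \<rho> where "\<rho> = norm x"
  define t where "t = x$1 / \<rho>"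
  have \<rho>: "\<rho> \<noteq> 0" using assms by (simp add: \<rho>_def)
  have x1: "x$1 = t * \<rho>" using \<rho> by (simp add: t_def)
  have x23: "(x$2)\<^sup>2 + (x$3)\<^sup>2 = \<rho>\<^sup>2 * (1 - t\<^sup>2)"
    using norm3_squared[of x] x1 by (simp add: \<rho>_def power_mult_distrib right_diff_distrib mult.commute)
  note U = U_cartesian[OF assms, folded \<rho>_def, folded t_def]
  note D = partial_eqI[OF U_has_derivative_cartesian[OF assms], folded \<rho>_def, folded t_def]
  have inner: "x \<bullet> axis i 1 = x$i" for i
    by (simp add: inner_axis)
  have ax: "axis i (1::real) $ j = (if j = i then 1 else 0)" for i j :: 3
    by (simp add: axis_def)
  have pow: "\<rho> powi (a + 1) = \<rho> powi a * \<rho>" "\<rho> powi (a + 2) = \<rho> powi a * \<rho>\<^sup>2" for a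
    using \<rho> by (simp_all add: power_int_add)
  have pow1: "\<rho> powi (n - int m - 1) = \<rho> powi (n - int m - 2) * \<rho>"
    "\<rho> powi (n - int m) = \<rho> powi (n - int m - 2) * \<rho>\<^sup>2"
    "\<rho> powi (n - 1 - int m) = \<rho> powi (n - int m - 2) * \<rho>"
    "\<rho> powi (n - 1 - int (Suc m)) = \<rho> powi (n - int m - 2)"
    "\<rho> powi (n - int (Suc m)) = \<rho> powi (n - int m - 2) * \<rho>" for m
    using pow(1)[of "n - int m - 2"] pow(2)[of "n - int m - 2"] by (simp_all add: algebra_simps)
  have pow2: "\<rho> powi (n - 1 - int j) = \<rho> powi (n - int (Suc j) - 2) * \<rho>\<^sup>2"
    "\<rho> powi (n - int j) = \<rho> powi (n - int (Suc j) - 2) * \<rho> ^ 3" for j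
    using pow(2)[of "n - int (Suc j) - 2"] pow(1)[of "n - int (Suc j) - 1"]
      pow(1)[of "n - int (Suc j) - 2"] pow(2)[of "n - int (Suc j) - 1"]
    by (simp_all add: algebra_simps power3_eq_cube power2_eq_square)
  show "partial 1 (U n m s) x = (of_int n + real m) * U (n - 1) m s x" for m s
  proof -
    have "partial 1 (U n m s) x = (-1) ^ m * \<rho> powi (n - int m - 2) * \<rho> * sectoral s m x *
        ((of_int n - real m) * t * lp n m t + (1 - t\<^sup>2) * lp n (Suc m) t)"
      unfolding D inner ax pow1(1,2)[of m] by (simp add: x1 algebra_simps power2_eq_square)
    also have "\<dots> = (of_int n + real m) * U (n - 1) m s x"
      unfolding lp_degree_pred[symmetric] U pow1(3)[of m] by (simp add: algebra_simps)
    finally show ?thesis .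
  qed
  define p where "p = \<rho> powi (n - int (Suc j) - 2)"
  have D2: "partial 2 (U n (Suc j) s) x = (-1) ^ Suc j * p *
      (\<rho>\<^sup>2 * lp n (Suc j) t * (real j + 1) * sectoral s j x
        - lp (n - 1) (Suc (Suc j)) t * x$2 * sectoral s (Suc j) x)" for s
    unfolding D inner ax pow1(1,2)[of "Suc j"] p_def[symmetric] by (simp add: lp_lower algebra_simps)
  have D3: "partial 3 (U n (Suc j) s) x = (-1) ^ Suc j * p *
      (- pm s * \<rho>\<^sup>2 * lp n (Suc j) t * (real j + 1) * sectoral (flip s) j x
        - lp (n - 1) (Suc (Suc j)) t * x$3 * sectoral s (Suc j) x)" for s
    unfolding D inner ax pow1(1,2)[of "Suc j"] p_def[symmetric] by (simp add: lp_lower algebra_simps)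
  show "partial 2 (U n (Suc j) s) x = (U (n - 1) (Suc (Suc j)) s x
          - (of_int n + real j + 1) * (of_int n + real j) * U (n - 1) j s x) / 2"
  proof -
    have "2 * partial 2 (U n (Suc j) s) x = (-1) ^ Suc j * p *
      (\<rho>\<^sup>2 * (2 * (real j + 1) * lp n (Suc j) t) * sectoral s j x
        - lp (n - 1) (Suc (Suc j)) t * (2 * x$2 * sectoral s (Suc j) x))"
      unfolding D2 by (simp add: algebra_simps)
    also have "\<dots> = (-1) ^ Suc j * p * (\<rho>\<^sup>2 * sectoral s j x *
        (2 * (real j + 1) * lp n (Suc j) t - (1 - t\<^sup>2) * lp (n - 1) (Suc (Suc j)) t)
        - lp (n - 1) (Suc (Suc j)) t * sectoral s (Suc (Suc j)) x)"
      unfolding sectoral_Suc_Suc x23 by (simp add: algebra_simps)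
    also have "\<dots> = U (n - 1) (Suc (Suc j)) s x
        - (of_int n + real j + 1) * (of_int n + real j) * U (n - 1) j s x"
      unfolding lp_degree_order_pred U pow1(4)[of "Suc j"] pow2[of j] p_def[symmetric]
      by (simp add: algebra_simps)
    finally show ?thesis by simp
  qed
  show "partial 3 (U n (Suc j) s) x = pm s * (U (n - 1) (Suc (Suc j)) (flip s) x
          + (of_int n + real j + 1) * (of_int n + real j) * U (n - 1) j (flip s) x) / 2"
  proof -
    have "2 * pm s * partial 3 (U n (Suc j) s) x = (-1) ^ Suc j * p *
      (- (\<rho>\<^sup>2 * (2 * (real j + 1) * lp n (Suc j) t) * sectoral (flip s) j x)
        + lp (n - 1) (Suc (Suc j)) t * (2 * pm (flip s) * x$3 * sectoral (flip (flip s)) (Suc j) x))"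
      unfolding D3 by (simp add: algebra_simps)
    also have "\<dots> = (-1) ^ Suc j * p * (- (\<rho>\<^sup>2 * sectoral (flip s) j x *
        (2 * (real j + 1) * lp n (Suc j) t - (1 - t\<^sup>2) * lp (n - 1) (Suc (Suc j)) t))
        - lp (n - 1) (Suc (Suc j)) t * sectoral (flip s) (Suc (Suc j)) x)"
      unfolding sectoral_Suc_Suc x23 by (simp add: algebra_simps)
    also have "\<dots> = U (n - 1) (Suc (Suc j)) (flip s) x
        + (of_int n + real j + 1) * (of_int n + real j) * U (n - 1) j (flip s) x"
      unfolding lp_degree_order_pred U pow1(4)[of "Suc j"] pow2[of j] p_def[symmetric]
      by (simp add: algebra_simps)
    finally have "pm s * (2 * pm s * partial 3 (U n (Suc j) s) x)
      = pm s * (U (n - 1) (Suc (Suc j)) (flip s) x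
        + (of_int n + real j + 1) * (of_int n + real j) * U (n - 1) j (flip s) x)"
      by simp
    then show ?thesis by (simp add: mult.assoc mult.left_commute[of _ 2])
  qed
  have D20: "partial i (U n 0 s) x = - (\<rho> powi (n - 2) * lp (n - 1) 1 t * x$i * sectoral s 0 x)"
    if "i \<noteq> 1" for i s
    unfolding D inner ax using that by (simp add: lp_lower algebra_simps)
  show "partial 2 (U n 0 s) x = (if s = Plus then U (n - 1) 1 Plus x else 0)"
    by (simp add: D20 U)
  show "partial 3 (U n 0 s) x = (if s = Plus then U (n - 1) 1 Minus x else 0)"
    by (simp add: D20 U)
  show "x$2 * partial 3 (U n m s) x - x$3 * partial 2 (U n m s) x
          = - (pm s * real m * U n m (flip s) x)"
  proof (cases m)
    case (Suc k)
    have "x$2 * partial 3 (U n m s) x - x$3 * partial 2 (U n m s) x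
      = - (pm s * real m * ((-1) ^ m * \<rho> powi (n - int m) * lp n m t *
        (x$2 * sectoral (flip s) (m - 1) x + pm s * x$3 * sectoral s (m - 1) x)))"
      unfolding D inner ax by (simp add: algebra_simps)
    then show ?thesis by (simp add: U Suc sectoral_Suc)
  qed (simp add: D20)
  show "x$1 * partial 2 (U n (Suc j) s) x - x$2 * partial 1 (U n (Suc j) s) x
          = (U n (Suc (Suc j)) s x
              - (of_int n + real j + 1) * (of_int n - real j) * U n j s x) / 2"
  proof -
    have "2 * (x$1 * partial 2 (U n (Suc j) s) x - x$2 * partial 1 (U n (Suc j) s) x)
        = (-1) ^ Suc j * p * \<rho> *
      (\<rho>\<^sup>2 * (2 * (real j + 1) * t * lp n (Suc j) t) * sectoral s j x
        - lp n (Suc (Suc j)) t * (2 * x$2 * sectoral s (Suc j) x))"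
      unfolding D inner ax pow1(1,2)[of "Suc j"] p_def[symmetric]
      by (simp add: x1 algebra_simps power2_eq_square)
    also have "\<dots> = (-1) ^ Suc j * p * \<rho> * (\<rho>\<^sup>2 * sectoral s j x *
        (2 * (real j + 1) * t * lp n (Suc j) t - (1 - t\<^sup>2) * lp n (Suc (Suc j)) t)
        - lp n (Suc (Suc j)) t * sectoral s (Suc (Suc j)) x)"
      unfolding sectoral_Suc_Suc x23 by (simp add: algebra_simps)
    also have "\<dots> = U n (Suc (Suc j)) s x
              - (of_int n + real j + 1) * (of_int n - real j) * U n j s x"
      unfolding lp_differential_equation U pow1(5)[of "Suc j"] pow2[of j] p_def[symmetric]
      by (simp add: algebra_simps power2_eq_square power3_eq_cube)
    finally show ?thesis by simp
  qed
  show "x$1 * partial 2 (U n 0 s) x - x$2 * partial 1 (U n 0 s) x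
          = (if s = Plus then U n 1 Plus x else 0)"
    unfolding D inner ax using pow1(1)[of 0] by (simp add: U x1 algebra_simps)
qed

section \<open>Differentiability classes\<close>

lemma has_derivative_cong_open:
  assumes "open S" "x \<in> S" "\<And>y. y \<in> S \<Longrightarrow> f y = g y"
  shows "(f has_derivative D) (at x) \<longleftrightarrow> (g has_derivative D) (at x)"
  using has_derivative_transform_within_open[OF _ assms(1,2)] assms(3) by metis

lemma differentiable_cong_open:
  assumes "open S" "x \<in> S" "\<And>y. y \<in> S \<Longrightarrow> f y = g y"
  shows "f differentiable (at x) \<longleftrightarrow> g differentiable (at x)"
  unfolding differentiable_def using has_derivative_cong_open[OF assms] by auto

lemma partial_cong_open:
  assumes "open S" "x \<in> S" "\<And>y. y \<in> S \<Longrightarrow> f y = g y"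
  shows "partial i f x = partial i g x"
  unfolding partial_def frechet_derivative_def using has_derivative_cong_open[OF assms] by auto

lemma Ck_on_cong:
  assumes "open S" "\<And>y. y \<in> S \<Longrightarrow> f y = g y"
  shows "Ck_on k S f \<longleftrightarrow> Ck_on k S g"
  using assms(2)
proof (induction k arbitrary: f g)
  case 0
  then show ?case by (auto intro: continuous_on_cong)
next
  case (Suc k)
  have "Ck_on k S (partial i f) \<longleftrightarrow> Ck_on k S (partial i g)" for i
    by (intro Suc.IH partial_cong_open[OF assms(1)]) (use Suc.prems in auto)
  moreover have "f differentiable (at x) \<longleftrightarrow> g differentiable (at x)" if "x \<in> S" for x
    using differentiable_cong_open[OF assms(1) that] Suc.prems by blast
  ultimately show ?case by auto
qed

lemma smooth_on_cong:
  assumes "open S" "\<And>y. y \<in> S \<Longrightarrow> f y = g y"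
  shows "smooth_on S f \<longleftrightarrow> smooth_on S g"
  unfolding smooth_on_def using Ck_on_cong[OF assms(1), of f g] assms(2) by auto

lemma Ck_on_subset: "Ck_on k S f \<Longrightarrow> T \<subseteq> S \<Longrightarrow> Ck_on k T f"
  by (induction k arbitrary: f) (auto intro: continuous_on_subset)

lemma Ck_on_SucD: "Ck_on (Suc k) S f \<Longrightarrow> Ck_on k S f"
proof (induction k arbitrary: f)
  case 0
  then show ?case
    by (auto intro!: continuous_at_imp_continuous_on differentiable_imp_continuous_within)
next
  case (Suc k)
  then show ?case by (metis Ck_on.simps(2))
qed

lemma has_derivative_partial:
  assumes "f differentiable (at x)"
  shows "(f has_derivative (\<lambda>h. \<Sum>i\<in>UNIV. h$i *\<^sub>R partial i f x)) (at x)"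
proof -
  have lin: "linear (frechet_derivative f (at x))"
    by (rule linear_frechet_derivative[OF assms])
  have "frechet_derivative f (at x) h = (\<Sum>i\<in>UNIV. h$i *\<^sub>R partial i f x)" for h
  proof -
    have "h = (\<Sum>i\<in>UNIV. h$i *\<^sub>R axis i 1)"
      by (metis basis_expansion scalar_mult_eq_scaleR)
    then have "frechet_derivative f (at x) h
        = frechet_derivative f (at x) (\<Sum>i\<in>UNIV. h$i *\<^sub>R axis i 1)"
      by simp
    then show ?thesis
      by (simp only: linear_sum[OF lin] linear_scale[OF lin] partial_def)
  qed
  then show ?thesis
    using frechet_derivative_works assms by (metis (no_types, lifting) ext)
qed

lemma partial_add:
  "f differentiable (at x) \<Longrightarrow> g differentiable (at x) \<Longrightarrow>
     partial i (\<lambda>x. f x + g x) x = partial i f x + partial i g x"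
  by (rule partial_eqI[OF has_derivative_add[OF has_derivative_partial has_derivative_partial],
        THEN trans]) (auto simp: axis_def if_distrib if_distribR cong: if_cong)

lemma partial_bounded_linear:
  "bounded_linear T \<Longrightarrow> f differentiable (at x) \<Longrightarrow>
     partial i (\<lambda>x. T (f x)) x = T (partial i f x)"
  by (rule partial_eqI[OF bounded_linear.has_derivative[OF _ has_derivative_partial],
        THEN trans]) (auto simp: axis_def if_distrib if_distribR cong: if_cong)

lemma partial_mult:
  fixes f g :: "real ^ 3 \<Rightarrow> real"
  shows "f differentiable (at x) \<Longrightarrow> g differentiable (at x) \<Longrightarrow>
     partial i (\<lambda>x. f x * g x) x = f x * partial i g x + partial i f x * g x"
  by (rule partial_eqI[OF has_derivative_mult[OF has_derivative_partial has_derivative_partial],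
        THEN trans]) (auto simp: axis_def if_distrib if_distribR cong: if_cong)

lemma partial_cmult:
  fixes f :: "real ^ 3 \<Rightarrow> real"
  shows "f differentiable (at x) \<Longrightarrow> partial i (\<lambda>x. c * f x) x = c * partial i f x"
  by (rule partial_bounded_linear[OF bounded_linear_mult_right])

lemma partial_const [simp]: "partial i (\<lambda>x. c) = (\<lambda>x. 0)"
  by (auto intro!: ext partial_eqI)

lemma partial_coordinate [simp]: "partial i (\<lambda>x. x$j) = (\<lambda>x. if i = j then 1 else 0)"
  using partial_eqI[OF bounded_linear_imp_has_derivative[OF bounded_linear_vec_nth]]
  by (auto simp: fun_eq_iff axis_def)

lemma Ck_on_add:
  assumes "open S"
  shows "Ck_on k S f \<Longrightarrow> Ck_on k S g \<Longrightarrow> Ck_on k S (\<lambda>x. f x + g x)"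
proof (induction k arbitrary: f g)
  case 0
  then show ?case by (auto intro: continuous_on_add)
next
  case (Suc k)
  have "Ck_on k S (\<lambda>x. partial i f x + partial i g x)" for i
    using Suc by auto
  moreover have "partial i (\<lambda>x. f x + g x) x = partial i f x + partial i g x" if "x \<in> S" for i x
    using Suc.prems that by (auto intro: partial_add)
  ultimately have "Ck_on k S (partial i (\<lambda>x. f x + g x))" for i
    using Ck_on_cong[OF assms, of "partial i (\<lambda>x. f x + g x)" "\<lambda>x. partial i f x + partial i g x"]
    by simp
  then show ?case using Suc.prems by auto
qed

lemma Ck_on_bounded_linear:
  assumes "open S" "bounded_linear T"
  shows "Ck_on k S f \<Longrightarrow> Ck_on k S (\<lambda>x. T (f x))"
proof (induction k arbitrary: f)
  case 0
  then show ?case by (auto intro: bounded_linear.continuous_on[OF assms(2)])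
next
  case (Suc k)
  have "Ck_on k S (\<lambda>x. T (partial i f x))" for i
    using Suc by auto
  moreover have "partial i (\<lambda>x. T (f x)) x = T (partial i f x)" if "x \<in> S" for i x
    using Suc.prems that by (auto intro: partial_bounded_linear[OF assms(2)])
  ultimately have "Ck_on k S (partial i (\<lambda>x. T (f x)))" for i
    using Ck_on_cong[OF assms(1), of "partial i (\<lambda>x. T (f x))" "\<lambda>x. T (partial i f x)"]
    by simp
  then show ?case
    using Suc.prems
    by (auto simp: differentiable_def) (use bounded_linear.has_derivative[OF assms(2)] in blast)
qed

text \<open>An algebra of functions that is closed under partial derivatives, so that its members are smooth.
  Powers of the norm are admitted only away from the origin.\<close>

inductive elementary :: "(real ^ 3) set \<Rightarrow> (real ^ 3 \<Rightarrow> real) \<Rightarrow> bool" for S where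
  const: "elementary S (\<lambda>x. c)"
| coordinate: "elementary S (\<lambda>x. x$i)"
| norm_powi: "0 \<notin> S \<Longrightarrow> elementary S (\<lambda>x. norm x powi n)"
| add: "elementary S f \<Longrightarrow> elementary S g \<Longrightarrow> elementary S (\<lambda>x. f x + g x)"
| mult: "elementary S f \<Longrightarrow> elementary S g \<Longrightarrow> elementary S (\<lambda>x. f x * g x)"
| cong: "elementary S f \<Longrightarrow> (\<And>x. x \<in> S \<Longrightarrow> f x = g x) \<Longrightarrow> elementary S g"

lemmas elementary_intros = elementary.const elementary.coordinate elementary.norm_powi
  elementary.add elementary.mult

lemma norm_powi_has_derivative:
  fixes x :: "real ^ 3"
  assumes "x \<noteq> 0"
  shows "((\<lambda>y. norm y powi n) has_derivative (\<lambda>h. of_int n * norm x powi (n - 2) * (x \<bullet> h))) (at x)"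
proof -
  have "norm x powi (n - 1) = norm x powi (n - 2) * norm x"
    using assms power_int_add[of "norm x" "n - 2" 1] by simp
  then show ?thesis
    using has_derivative_power_int[OF _ has_derivative_norm[OF assms], of n] assms
    by (auto simp: sgn_div_norm inner_commute field_simps elim!: has_derivative_eq_rhs)
qed

lemma partial_norm_powi:
  "x \<noteq> 0 \<Longrightarrow> partial i (\<lambda>y. norm y powi n) x = of_int n * norm x powi (n - 2) * x$i"
  using partial_eqI[OF norm_powi_has_derivative] by (simp add: inner_axis)

lemma elementary_differentiable_partial:
  assumes "open S"
  shows "elementary S f \<Longrightarrow> (\<forall>x\<in>S. f differentiable (at x)) \<and> (\<forall>i. elementary S (partial i f))"
proof (induction rule: elementary.induct)
  case (const c)
  then show ?case by (auto intro: elementary.const)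
next
  case (coordinate i)
  then show ?case
    by (auto intro: elementary.const bounded_linear_imp_differentiable[OF bounded_linear_vec_nth])
next
  case (norm_powi n)
  have "(\<lambda>y. norm y powi n) differentiable (at x)" if "x \<in> S" for x :: "real ^ 3"
    using norm_powi_has_derivative[of x] that norm_powi differentiableI by metis
  moreover have "elementary S (partial i (\<lambda>y. norm y powi n))" for i
    by (rule elementary.cong[where f = "\<lambda>x. of_int n * norm x powi (n - 2) * x$i"])
       (use norm_powi in \<open>auto intro!: elementary_intros partial_norm_powi[symmetric]\<close>)
  ultimately show ?case by blast
next
  case (add f g)
  have "elementary S (partial i (\<lambda>y. f y + g y))" for i
    by (rule elementary.cong[where f = "\<lambda>x. partial i f x + partial i g x"])
       (use add in \<open>auto intro: elementary.add simp: partial_add\<close>)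
  then show ?case using add by auto
next
  case (mult f g)
  have "elementary S (partial i (\<lambda>y. f y * g y))" for i
    by (rule elementary.cong[where f = "\<lambda>x. f x * partial i g x + partial i f x * g x"])
       (use mult in \<open>auto intro!: elementary.add elementary.mult simp: partial_mult\<close>)
  then show ?case using mult by auto
next
  case (cong f g)
  have "elementary S (partial i g)" for i
    by (rule elementary.cong[where f = "partial i f"])
       (use cong partial_cong_open[OF assms, of _ f g] in auto)
  moreover have "g differentiable (at x)" if "x \<in> S" for x
    using cong differentiable_cong_open[OF assms that, of f g] that by auto
  ultimately show ?case by auto
qed

lemma elementary_differentiable:
  "open S \<Longrightarrow> elementary S f \<Longrightarrow> x \<in> S \<Longrightarrow> f differentiable (at x)"
  using elementary_differentiable_partial by blast

lemma elementary_partial: "open S \<Longrightarrow> elementary S f \<Longrightarrow> elementary S (partial i f)"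
  using elementary_differentiable_partial by blast

lemma elementary_continuous: "open S \<Longrightarrow> elementary S f \<Longrightarrow> continuous_on S f"
  by (auto intro!: continuous_at_imp_continuous_on differentiable_imp_continuous_within
      elementary_differentiable)

lemma elementary_smooth:
  assumes "open S" "elementary S f"
  shows "smooth_on S f"
proof -
  have "Ck_on k S f" for k
    using assms(2) elementary_continuous[OF assms(1)] elementary_differentiable[OF assms(1)]
      elementary_partial[OF assms(1)]
    by (induction k arbitrary: f) auto
  then show ?thesis by (simp add: smooth_on_def)
qed

text \<open>The symmetry of second derivatives is inherited by sums and products, so induction along the
  construction suffices.\<close>

lemma elementary_partial_commute:
  assumes "open S"
  shows "elementary S f \<Longrightarrow> x \<in> S \<Longrightarrow> partial i (partial j f) x = partial j (partial i f) x"
proof (induction arbitrary: x i j rule: elementary.induct)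
  case (const c)
  then show ?case by simp
next
  case (coordinate k)
  then show ?case by simp
next
  case (norm_powi n)
  have eq: "partial i (\<lambda>y. norm y powi n) x = of_int n * (norm x powi (n - 2) * x$i)"
    if "x \<in> S" for x i n
    using that norm_powi.hyps by (subst partial_norm_powi) auto
  have "(\<lambda>y. y$j) differentiable (at x)" for j
    by (rule bounded_linear_imp_differentiable[OF bounded_linear_vec_nth])
  moreover have "(\<lambda>y. norm y powi n) differentiable (at x)" for n
    using norm_powi.hyps norm_powi.prems by (intro differentiableI[OF norm_powi_has_derivative]) auto
  ultimately have d: "partial i (\<lambda>y. of_int n * (norm y powi (n - 2) * y$j)) x
      = of_int n * (norm x powi (n - 2) * (if i = j then 1 else 0)
        + of_int (n - 2) * (norm x powi (n - 2 - 2) * x$i) * x$j)" for i j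
    by (simp add: partial_cmult partial_mult eq[OF norm_powi.prems])
  have e: "partial i (partial j (\<lambda>y. norm y powi n)) x
      = partial i (\<lambda>y. of_int n * (norm y powi (n - 2) * y$j)) x" for i j
    using eq by (intro partial_cong_open[OF assms norm_powi.prems]) blast
  show ?case
    unfolding e d by (simp add: mult_ac)
next
  case (add f g)
  have d: "f differentiable (at y)" "g differentiable (at y)"
    "partial i f differentiable (at y)" "partial i g differentiable (at y)" if "y \<in> S" for i y
    using add.hyps elementary_differentiable[OF assms _ that] elementary_partial[OF assms] by blast+
  have "partial i (partial j (\<lambda>y. f y + g y)) x
      = partial i (partial j f) x + partial i (partial j g) x" for i j
    by (subst partial_cong_open[OF assms \<open>x \<in> S\<close>, where g = "\<lambda>x. partial j f x + partial j g x"])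
       (simp_all add: partial_add d add.prems)
  then show ?case using add.IH add.prems by simp
next
  case (mult f g)
  have d: "f differentiable (at y)" "g differentiable (at y)"
    "partial i f differentiable (at y)" "partial i g differentiable (at y)" if "y \<in> S" for i y
    using mult.hyps elementary_differentiable[OF assms _ that] elementary_partial[OF assms] by blast+
  have "partial i (partial j (\<lambda>y. f y * g y)) x
      = (f x * partial i (partial j g) x + partial i f x * partial j g x)
        + (partial j f x * partial i g x + partial i (partial j f) x * g x)" for i j
    by (subst partial_cong_open[OF assms \<open>x \<in> S\<close>,
          where g = "\<lambda>x. f x * partial j g x + partial j f x * g x"])
       (simp_all add: partial_add partial_mult d mult.prems)
  then show ?case using mult.IH mult.prems by simp
next
  case (cong f g)
  have "partial i (partial j g) x = partial i (partial j f) x" for i j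
    by (intro partial_cong_open[OF assms \<open>x \<in> S\<close>] partial_cong_open[OF assms]) (use cong in auto)
  then show ?case using cong.IH cong.prems by simp
qed

lemma elementary_sum: "(\<And>i. i \<in> I \<Longrightarrow> elementary S (f i)) \<Longrightarrow> elementary S (\<lambda>x. \<Sum>i\<in>I. f i x)"
  by (induction I rule: infinite_finite_induct) (simp_all add: elementary.const elementary.add)

lemma elementary_power: "elementary S f \<Longrightarrow> elementary S (\<lambda>x. f x ^ n)"
  by (induction n) (simp_all add: elementary.const elementary.mult)

lemma elementary_sectoral: "elementary S (sectoral s m)"
proof (induction m arbitrary: s)
  case 0
  have "sectoral s 0 = (\<lambda>x. if s = Plus then 1 else 0)" by auto
  then show ?case by (simp only: elementary.const)
next
  case (Suc m)
  show ?case
    by (rule elementary.cong[where f = "\<lambda>x. x$2 * sectoral s m x + (- pm s) * (x$3 * sectoral (flip s) m x)"])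
       (intro elementary.mult elementary.add elementary.const elementary.coordinate Suc,
         simp add: sectoral_Suc)
qed

lemma elementary_U:
  assumes "0 \<notin> S"
  shows "elementary S (U n m s)"
proof (rule elementary.cong)
  have "elementary S (\<lambda>x. lp n m (x$1 * norm x powi (-1)))"
    unfolding poly_altdef
      by (intro elementary_sum elementary_power elementary.mult elementary.const
          elementary.coordinate elementary.norm_powi assms)
  then show "elementary S (\<lambda>x. (-1) ^ m * norm x powi (n - int m)
      * lp n m (x$1 * norm x powi (-1)) * sectoral s m x)"
    by (intro elementary.mult elementary.const elementary.norm_powi elementary_sectoral assms)
  show "(-1) ^ m * norm x powi (n - int m) * lp n m (x$1 * norm x powi (-1)) * sectoral s m x
      = U n m s x" if "x \<in> S" for x
    using that assms by (subst U_cartesian) (auto simp: divide_inverse power_int_minus simp del: sectoral.simps)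
qed

text \<open>Rodrigues' formula differentiates a polynomial in \<open>t\<^sup>2\<close>, and each derivative flips the parity. In
  \<open>|x|\<^bsup>k-m\<^esup> P\<^bsup>(m)\<^esup>(x\<^sub>0 / |x|)\<close> only even powers of \<open>|x|\<close> survive, which makes the functions of
  degree \<open>n \<ge> 1\<close> smooth at the origin.\<close>

lemma even_legendre_coeff:
  assumes "coeff (LP n m) i \<noteq> 0"
  shows "even (legendre_index n + m + i)"
proof -
  define par :: "nat \<Rightarrow> real poly \<Rightarrow> bool" where "par r p \<longleftrightarrow> (\<forall>i. coeff p i \<noteq> 0 \<longrightarrow> even (i + r))" for r p
  have step: "par (Suc r) (pderiv p)" if "par r p" for r p
    unfolding par_def
  proof (intro allI impI)
    fix i assume "coeff (pderiv p) i \<noteq> 0"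
    then have "coeff p (Suc i) \<noteq> 0" by (simp add: coeff_pderiv)
    then have "even (Suc i + r)" using that unfolding par_def by blast
    then show "even (i + Suc r)" by simp
  qed
  have pderiv: "par (r + k) ((pderiv ^^ k) p)" if "par r p" for r k p
    using that step by (induction k) simp_all
  have "par 0 ([:-1, 0, 1:] ^ k)" for k
  proof (induction k)
    case (Suc k)
    show ?case unfolding par_def
    proof (intro allI impI)
      fix i assume "coeff ([:-1, 0, 1:] ^ Suc k :: real poly) i \<noteq> 0"
      then have "(\<Sum>a\<le>i. coeff [:-1, 0, 1:] a * coeff ([:-1, 0, 1:] ^ k :: real poly) (i - a)) \<noteq> 0"
        unfolding power_Suc coeff_mult .
      then obtain a where "a \<in> {..i}"
        "coeff [:-1, 0, 1:] a * coeff ([:-1, 0, 1:] ^ k :: real poly) (i - a) \<noteq> 0"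
        by (rule sum.not_neutral_contains_not_neutral)
      then have a: "a \<le> i" "coeff ([:-1, 0, 1:] :: real poly) a \<noteq> 0"
        "coeff ([:-1, 0, 1:] ^ k :: real poly) (i - a) \<noteq> 0"
        by simp_all
      moreover have "even a"
        using a(2) by (cases a; cases "a - 1"; cases "a - 2") auto
      moreover have "even (i - a)"
        using Suc a(3) unfolding par_def by force
      ultimately show "even (i + 0)"
        using a(1) by simp
    qed
  qed (simp add: par_def)
  then have w: "par (0 + k) ((pderiv ^^ k) ([:-1, 0, 1:] ^ k))" for k
    using pderiv by blast
  have "par k (legendre k)" for k
    using w[of k] unfolding par_def legendre_def by simp
  then have "par (legendre_index n + m) (LP n m)"
    unfolding LP_def using pderiv by blast
  then show ?thesis using assms by (auto simp: par_def add.commute)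
qed

lemma degree_LP: "degree (LP n m) \<le> legendre_index n - m"
proof -
  have d: "degree ((pderiv ^^ k) p) = degree p - k" for k and p :: "real poly"
    by (induction k) (simp_all add: degree_pderiv)
  have "degree (legendre k) \<le> k" for k
    by (simp add: legendre_def d degree_power_eq)
  then show ?thesis
    by (simp add: LP_def d diff_le_mono)
qed

lemma LP_eq_0:
  assumes "m > legendre_index n"
  shows "LP n m = 0"
proof -
  define k where "k = legendre_index n"
  obtain j where m: "m = j + Suc k"
    using assms by (metis k_def less_imp_Suc_add add_Suc_right add.commute)
  have "degree (LP n k) = 0"
    using degree_LP[of n k] by (simp add: k_def)
  then have "pderiv (LP n k) = 0"
    by (simp add: pderiv_eq_0_iff)
  then have "LP n m = (pderiv ^^ j) 0"
    by (simp add: LP_def m funpow_add pderiv_funpow_commute[symmetric])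
  also have "\<dots> = 0"
    by (induction j) simp_all
  finally show ?thesis .
qed

lemma U_eq_0: "m > legendre_index n \<Longrightarrow> U n m s x = 0"
  by (simp add: U_def legendre_assoc_def Let_def LP_eq_0[unfolded LP_def legendre_index_def]
      legendre_index_def)

lemma elementary_U_nonneg:
  assumes "n \<ge> 1"
  shows "elementary S (U n m s)"
proof (cases "m \<le> nat n")
  case False
  then have "U n m s = (\<lambda>x. 0)"
    using assms by (auto simp: U_eq_0 legendre_index_def)
  then show ?thesis by (auto intro: elementary.const)
next
  case True
  define k where "k = nat n"
  have k: "legendre_index n = k" "m \<le> k" "n = int k" "k \<ge> 1"
    using True assms by (auto simp: k_def legendre_index_def)
  have even: "even (k - m - i)" if "coeff (LP n m) i \<noteq> 0" "i \<le> k - m" for i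
  proof -
    have "even (k + m + i)"
      using even_legendre_coeff[OF that(1)] k(1) by simp
    with that(2) k(2) show ?thesis by presburger
  qed
  define q where "q = (\<lambda>x :: real ^ 3. (x$1)\<^sup>2 + (x$2)\<^sup>2 + (x$3)\<^sup>2)"
  define g where "g = (\<lambda>x. (-1) ^ m * (\<Sum>i\<le>k - m. coeff (LP n m) i * (x$1) ^ i * q x ^ ((k - m - i) div 2))
      * sectoral s m x)"
  have "elementary S g"
    unfolding g_def q_def
    by (intro elementary.mult elementary.add elementary.const elementary_sum elementary_power elementary_sectoral
        elementary.coordinate)
  moreover have "g x = U n m s x" for x
  proof (cases "x = 0")
    case True
    have "(\<Sum>i\<le>k - m. coeff (LP n m) i * 0 ^ i * (0 :: real) ^ ((k - m - i) div 2)) * sectoral s m 0 = 0"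
    proof (cases "m = 0")
      case True
      have "coeff (LP n m) i * 0 ^ i * (0 :: real) ^ ((k - m - i) div 2) = 0" if "i \<le> k - m" for i
      proof (cases "i = 0 \<and> coeff (LP n m) i \<noteq> 0")
        case True
        then have "even k"
          using True even[of i] that \<open>m = 0\<close> by auto
        then have "(k - m - i) div 2 \<noteq> 0"
          using True \<open>m = 0\<close> k(4) by presburger
        then show ?thesis by (simp add: zero_power)
      next
        case False
        then show ?thesis by (cases i) auto
      qed
      then have "(\<Sum>i\<le>k - m. coeff (LP n m) i * 0 ^ i * (0 :: real) ^ ((k - m - i) div 2)) = 0"
        by (intro sum.neutral) auto
      then show ?thesis by (simp only: mult_zero_left)
    next
      case False
      then have "sectoral s m 0 = 0"
        by (cases s) (simp_all add: Complex_eq zero_power)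
      then show ?thesis by simp
    qed
    with True k show ?thesis by (simp add: g_def q_def)
  next
    case False
    define \<rho> where "\<rho> = norm x"
    have \<rho>: "\<rho> \<noteq> 0" "q x = \<rho>\<^sup>2" using False by (simp_all add: \<rho>_def q_def norm3_squared)
    have "\<rho> powi (n - int m) * lp n m (x$1 / \<rho>)
        = (\<Sum>i\<le>k - m. \<rho> ^ (k - m) * (coeff (LP n m) i * (x$1 / \<rho>) ^ i))"
    proof -
      have "lp n m (x$1 / \<rho>) = (\<Sum>i\<le>k - m. coeff (LP n m) i * (x$1 / \<rho>) ^ i)"
        unfolding poly_altdef using degree_LP[of n m] k
        by (intro sum.mono_neutral_left) (auto simp: coeff_eq_0)
      moreover have "\<rho> powi (n - int m) = \<rho> ^ (k - m)"
        using k by (simp add: power_int_nonneg_exp nat_diff_distrib)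
      ultimately show ?thesis by (simp add: sum_distrib_left)
    qed
    also have "\<dots> = (\<Sum>i\<le>k - m. coeff (LP n m) i * (x$1) ^ i * q x ^ ((k - m - i) div 2))"
    proof (rule sum.cong[OF refl])
      fix i assume i: "i \<in> {..k - m}"
      show "\<rho> ^ (k - m) * (coeff (LP n m) i * (x$1 / \<rho>) ^ i)
          = coeff (LP n m) i * (x$1) ^ i * q x ^ ((k - m - i) div 2)"
      proof (cases "coeff (LP n m) i = 0")
        case False
        have "\<rho> ^ (k - m) = \<rho> ^ (k - m - i) * \<rho> ^ i"
          using i by (metis atMost_iff le_add_diff_inverse2 power_add)
        also have "\<rho> ^ (k - m - i) = q x ^ ((k - m - i) div 2)"
          using even[OF False] i by (simp add: \<rho> flip: power_mult)
        finally show ?thesis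
          using \<rho> by (simp add: power_divide)
      qed simp
    qed
    finally show ?thesis
      using False by (simp add: g_def U_cartesian \<rho>_def mult.assoc del: sectoral.simps)
  qed
  ultimately show ?thesis by (rule elementary.cong)
qed

section \<open>Integration and rotations\<close>

definition punctured :: "side \<Rightarrow> (real ^ 3) set" where
  "punctured \<sigma> = region \<sigma> - {0}"

text \<open>Degrees of homogeneity for which continuous functions are integrable on the punctured region; the
  bounds are those that occur below.\<close>

definition admissible :: "side \<Rightarrow> int \<Rightarrow> bool" where
  "admissible \<sigma> N \<longleftrightarrow> (case \<sigma> of Inner \<Rightarrow> N \<ge> 0 | Outer \<Rightarrow> N \<le> -4)"

lemma punctured_simps:
  "x \<in> punctured Inner \<longleftrightarrow> 0 < norm x \<and> norm x < 1"
  "x \<in> punctured Outer \<longleftrightarrow> 1 < norm x"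
  by (auto simp: punctured_def)

lemma open_region: "open (region \<sigma>)"
  by (cases \<sigma>) (auto intro!: open_Collect_less continuous_intros)

lemma open_punctured: "open (punctured \<sigma>)"
  unfolding punctured_def by (intro open_Diff open_region) simp

lemma zero_notin_punctured [simp]: "0 \<notin> punctured \<sigma>"
  by (simp add: punctured_def)

lemma punctured_cong_norm: "norm x = norm y \<Longrightarrow> x \<in> punctured \<sigma> \<longleftrightarrow> y \<in> punctured \<sigma>"
  by (cases \<sigma>) (auto simp: punctured_simps)

lemma measurable_punctured [measurable, simp]: "punctured \<sigma> \<in> sets lebesgue"
  using borel_open[OF open_punctured] by auto

lemma measurable_region [simp]: "region \<sigma> \<in> sets lebesgue"
  using borel_open[OF open_region] by auto

definition ref_radius :: "side \<Rightarrow> real" where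
  "ref_radius \<sigma> = (case \<sigma> of Inner \<Rightarrow> 1 / 2 | Outer \<Rightarrow> 2)"

lemma ref_radius: "ref_radius \<sigma> > 0" "norm x = ref_radius \<sigma> \<Longrightarrow> x \<in> punctured \<sigma>"
  by (cases \<sigma>; simp add: ref_radius_def punctured_simps flip: zero_less_norm_iff)+

lemma homogeneous_onD:
  assumes "homogeneous_on S N f" "x \<in> S" "t > 0" "t *\<^sub>R x \<in> S"
  shows "f (t *\<^sub>R x) = (t powi N) *\<^sub>R f x"
  using assms by (auto simp: homogeneous_on_def)

text \<open>A continuous homogeneous function is controlled by its values on one sphere inside the region.\<close>

lemma homogeneous_norm_bound:
  fixes f :: "real ^ 3 \<Rightarrow> 'b::real_normed_vector"
  assumes "continuous_on (punctured \<sigma>) f" "homogeneous_on (punctured \<sigma>) N f"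
  obtains C where "C \<ge> 0" "\<And>x. x \<in> punctured \<sigma> \<Longrightarrow> norm (f x) \<le> C * norm x powi N"
proof -
  define r where "r = ref_radius \<sigma>"
  have r: "r > 0" "sphere 0 r \<subseteq> punctured \<sigma>"
    using ref_radius(1)[of \<sigma>] ref_radius(2)[of _ \<sigma>] by (auto simp: r_def)
  have "compact (f ` sphere 0 r)"
    using assms(1) r(2) by (intro compact_continuous_image) (auto intro: continuous_on_subset)
  then obtain B where B: "\<And>x. norm x = r \<Longrightarrow> norm (f x) \<le> B"
    by (force dest: compact_imp_bounded simp: bounded_iff)
  have "norm (f x) \<le> (\<bar>B\<bar> * r powi (- N)) * norm x powi N" if x: "x \<in> punctured \<sigma>" for x
  proof -
    define y where "y = (r / norm x) *\<^sub>R x"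
    have x0: "norm x > 0" using x by (metis zero_less_norm_iff zero_notin_punctured)
    then have y: "norm y = r" "x = (norm x / r) *\<^sub>R y"
      using r by (auto simp: y_def)
    then have "y \<in> punctured \<sigma>" using r by auto
    then have "f x = ((norm x / r) powi N) *\<^sub>R f y"
      using homogeneous_onD[OF assms(2), of y "norm x / r"] y(2) x x0 r(1) by auto
    then have "norm (f x) = (norm x / r) powi N * norm (f y)"
      using x0 r by (simp add: power_int_abs)
    also have "\<dots> \<le> (norm x / r) powi N * \<bar>B\<bar>"
      using B[OF y(1)] x0 r by (intro mult_left_mono) auto
    also have "\<dots> = (\<bar>B\<bar> * r powi (- N)) * norm x powi N"
      by (simp add: power_int_divide_distrib power_int_minus field_simps)
    finally show ?thesis .
  qed
  then show thesis
    using r by (intro that[of "\<bar>B\<bar> * r powi (- N)"]) auto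
qed

text \<open>In the exterior, \<open>|x|\<^bsup>-4\<^esup>\<close> is at most \<open>16\<^bsup>-j\<^esup>\<close> on the dyadic shell inside the ball of radius
  \<open>2\<^bsup>j+1\<^esup>\<close>. The volume of that ball grows like \<open>8\<^bsup>j\<^esup>\<close>, so the integral is bounded by a
  geometric series of ratio \<open>1/2\<close>.\<close>

lemma integrable_norm_powi:
  assumes "admissible \<sigma> N"
  shows "integrable (lebesgue_on (punctured \<sigma>)) (\<lambda>x :: real ^ 3. norm x powi N)"
proof (cases \<sigma>)
  case Inner
  have "punctured \<sigma> \<subseteq> ball 0 1" by (auto simp: Inner punctured_simps)
  then have "punctured \<sigma> \<in> lmeasurable"
    by (intro bounded_set_imp_lmeasurable) (auto intro: bounded_subset)
  then have "finite_measure (lebesgue_on (punctured \<sigma>))"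
    by (rule finite_measure_lebesgue_on)
  then have "integrable (lebesgue_on (punctured \<sigma>)) (\<lambda>x. 1 :: real)"
    by (rule finite_measure.integrable_const)
  then show ?thesis
  proof (rule Bochner_Integration.integrable_bound)
    show "(\<lambda>x. norm x powi N) \<in> borel_measurable (lebesgue_on (punctured \<sigma>))"
      by (intro continuous_imp_measurable_on_sets_lebesgue continuous_intros) auto
    show "AE x in lebesgue_on (punctured \<sigma>). norm (norm x powi N) \<le> norm (1 :: real)"
      using assms
      by (intro AE_I2) (auto simp: Inner punctured_simps admissible_def power_int_nonneg_exp power_le_one)
  qed
next
  case Outer
  define V where "V = unit_ball_vol (real DIM(real ^ 3))"
  define c where "c = (\<lambda>j :: nat. (1 / 16) ^ j * (8 * 8 ^ j * V))"
  have ball: "emeasure lebesgue (cball (0 :: real ^ 3) (2 ^ Suc j)) = ennreal (8 * 8 ^ j * V)" for j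
  proof -
    have "(2 ^ Suc j) ^ 3 = (8 :: real) * 8 ^ j"
    proof -
      have "((2 :: real) ^ Suc j) ^ 3 = (2 ^ 3) ^ Suc j"
        by (simp only: power_mult[symmetric] mult.commute)
      then show ?thesis by simp
    qed
    then show ?thesis
      by (simp add: V_def emeasure_cball mult.commute del: power_Suc)
  qed
  have c: "c = (\<lambda>j. (1 / 2) ^ j * (8 * V))"
    by (auto simp: c_def fun_eq_iff power_divide divide_simps power_mult_distrib[symmetric])
  have "summable c"
    unfolding c by (intro summable_mult2 summable_geometric) simp
  have bound: "norm x powi N \<le> (\<Sum>j. ennreal ((1 / 16) ^ j) * indicator (cball 0 (2 ^ Suc j)) x)"
    if x: "x \<in> punctured \<sigma>" for x :: "real ^ 3"
  proof -
    have x1: "norm x > 1" using x by (simp add: Outer punctured_simps)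
    obtain k where k: "norm x < 2 ^ k"
      using real_arch_pow[of 2 "norm x"] by auto
    define j where "j = (LEAST k. norm x < 2 ^ Suc k)"
    have "norm x < 2 ^ Suc k"
      using k by (rule less_le_trans) simp
    then have j: "norm x < 2 ^ Suc j"
      unfolding j_def by (rule LeastI)
    have j': "2 ^ j \<le> norm x"
    proof (cases j)
      case (Suc i)
      then show ?thesis
        using not_less_Least[of i "\<lambda>k. norm x < 2 ^ Suc k"] by (simp add: j_def not_less)
    qed (use x1 in simp)
    have "norm x powi N \<le> norm x powi (- 4)"
      using assms x1 by (intro power_int_increasing) (auto simp: Outer admissible_def)
    also have "\<dots> = inverse (norm x) ^ 4"
      by (simp add: power_int_minus power_inverse)
    also have "\<dots> \<le> inverse (2 ^ j) ^ 4"
      using j' x1 by (intro power_mono le_imp_inverse_le) auto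
    also have "\<dots> = (1 / 16) ^ j"
    proof -
      have "inverse ((2 :: real) ^ j) ^ 4 = (inverse 2 ^ 4) ^ j"
        by (simp only: power_inverse[symmetric] power_mult[symmetric] mult.commute)
      then show ?thesis by (simp add: power_one_over)
    qed
    finally have "ennreal (norm x powi N)
        \<le> (\<Sum>i\<in>{j}. ennreal ((1 / 16) ^ i) * indicator (cball 0 (2 ^ Suc i)) x)"
      using j by (simp add: ennreal_leI)
    also have "\<dots> \<le> (\<Sum>i. ennreal ((1 / 16) ^ i) * indicator (cball 0 (2 ^ Suc i)) x)"
      by (intro sum_le_suminf) auto
    finally show ?thesis .
  qed
  have "(\<integral>\<^sup>+x. ennreal (norm (norm x powi N)) \<partial>lebesgue_on (punctured \<sigma>))
      = (\<integral>\<^sup>+x. ennreal (norm x powi N) * indicator (punctured \<sigma>) x \<partial>lebesgue)"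
    by (subst nn_integral_restrict_space) (auto simp: power_int_abs)
  also have "\<dots> \<le> (\<integral>\<^sup>+x. (\<Sum>j. ennreal ((1 / 16) ^ j) * indicator (cball (0 :: real ^ 3) (2 ^ Suc j)) x) \<partial>lebesgue)"
    using bound by (intro nn_integral_mono) (auto split: split_indicator)
  also have "\<dots> = (\<Sum>j. \<integral>\<^sup>+x. ennreal ((1 / 16) ^ j) * indicator (cball (0 :: real ^ 3) (2 ^ Suc j)) x \<partial>lebesgue)"
    by (intro nn_integral_suminf borel_measurable_times_ennreal borel_measurable_const
        borel_measurable_indicator) (use borel_closed[OF closed_cball] in auto)
  also have "\<dots> = (\<Sum>j. ennreal (c j))"
    by (subst nn_integral_cmult_indicator)
       (auto simp: ball c_def V_def simp flip: ennreal_mult simp del: power_Suc)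
  also have "\<dots> < \<infinity>"
    using \<open>summable c\<close> by (subst suminf_ennreal2) (auto simp: c_def V_def)
  finally show ?thesis
    by (intro integrableI_bounded continuous_imp_measurable_on_sets_lebesgue continuous_intros) auto
qed

abbreviation lint :: "side \<Rightarrow> (real ^ 3 \<Rightarrow> real) \<Rightarrow> real" where
  "lint \<sigma> f \<equiv> (LINT x | lebesgue_on (punctured \<sigma>). f x)"

lemma continuous_measurable_punctured:
  "continuous_on (punctured \<sigma>) f \<Longrightarrow> f \<in> borel_measurable (lebesgue_on (punctured \<sigma>))"
  by (intro continuous_imp_measurable_on_sets_lebesgue) auto

lemma integrable_homogeneous:
  fixes f :: "real ^ 3 \<Rightarrow> real"
  assumes "continuous_on (punctured \<sigma>) f" "homogeneous_on (punctured \<sigma>) N f" "admissible \<sigma> N"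
  shows "integrable (lebesgue_on (punctured \<sigma>)) f"
proof -
  obtain C where C: "C \<ge> 0" "\<And>x. x \<in> punctured \<sigma> \<Longrightarrow> norm (f x) \<le> C * norm x powi N"
    using homogeneous_norm_bound[OF assms(1,2)] by blast
  have "integrable (lebesgue_on (punctured \<sigma>)) (\<lambda>x. C * norm x powi N)"
    using integrable_norm_powi[OF assms(3)] by simp
  then show ?thesis
    by (rule Bochner_Integration.integrable_bound[OF _ continuous_measurable_punctured[OF assms(1)]])
       (use C in \<open>auto intro!: AE_I2 simp: abs_mult power_int_abs\<close>)
qed

text \<open>An orthogonal map preserves the punctured region, and its determinant has absolute value \<open>1\<close>. For the
  linear change of variables the integrand is regarded as a one-dimensional vector.\<close>

lemma lint_orthogonal:
  assumes R: "orthogonal_transformation R" and f: "integrable (lebesgue_on (punctured \<sigma>)) f"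
    and fR: "integrable (lebesgue_on (punctured \<sigma>)) (\<lambda>x. f (R x))"
  shows "lint \<sigma> (\<lambda>x. f (R x)) = lint \<sigma> f"
proof -
  define S where "S = punctured \<sigma>"
  define F where "F = (\<lambda>x. vec (f x) :: real ^ 1)"
  have R': "linear R" "\<And>x. norm (R x) = norm x"
    using R by (auto simp: orthogonal_transformation)
  have im: "R ` S = S"
  proof -
    have "R x \<in> S \<longleftrightarrow> x \<in> S" for x
      unfolding S_def using R'(2) punctured_cong_norm by blast
    then show ?thesis
      using orthogonal_transformation_surj[OF R] by (force simp: surj_def)
  qed
  have abs: "f absolutely_integrable_on S" "(\<lambda>x. f (R x)) absolutely_integrable_on S"
    using f fR by (simp_all add: S_def set_integrable_def integrable_restrict_space)
  then have F: "F absolutely_integrable_on S" "(F \<circ> R) absolutely_integrable_on S"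
    by (simp_all add: absolutely_integrable_on_iff_component S_def F_def)
  have "integral (R ` S) F = \<bar>det (matrix R)\<bar> *\<^sub>R integral S (F \<circ> R)"
    by (rule integral_change_of_variables_linear[OF R'(1)]) (use F im in simp)
  then have "integral S F $ 1 = integral S (F \<circ> R) $ 1"
    using orthogonal_transformation_det[OF R] im by simp
  then have "integral S (\<lambda>x. F x $ 1) = integral S (\<lambda>x. (F \<circ> R) x $ 1)"
    using F[THEN set_lebesgue_integral_eq_integral(1)] by (simp only: integral_component_eq_cart)
  then have "integral S f = integral S (\<lambda>x. f (R x))"
    by (simp add: F_def o_def)
  then show ?thesis
    using lebesgue_integral_eq_integral[OF f] lebesgue_integral_eq_integral[OF fR] by (simp add: S_def)
qed

definition rotation :: "3 \<Rightarrow> 3 \<Rightarrow> real \<Rightarrow> real ^ 3 \<Rightarrow> real ^ 3" where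
  "rotation a b t x = x + ((cos t - 1) * x$a - sin t * x$b) *\<^sub>R axis a 1
     + (sin t * x$a + (cos t - 1) * x$b) *\<^sub>R axis b 1"

lemma rotation_component:
  assumes "a \<noteq> b"
  shows "rotation a b t x $ a = cos t * x$a - sin t * x$b"
    "rotation a b t x $ b = sin t * x$a + cos t * x$b"
  using assms by (simp_all add: rotation_def axis_def algebra_simps)

lemma rotation_0 [simp]: "rotation a b 0 x = x"
  by (simp add: rotation_def)

lemma orthogonal_rotation:
  assumes "a \<noteq> b"
  shows "orthogonal_transformation (rotation a b t)"
  unfolding orthogonal_transformation
proof (intro conjI allI)
  show "linear (rotation a b t)"
    by (rule linearI) (simp_all add: rotation_def algebra_simps)
  show "norm (rotation a b t x) = norm x" for x
  proof -
    define p where "p = (cos t - 1) * x$a - sin t * x$b"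
    define q where "q = sin t * x$a + (cos t - 1) * x$b"
    have ab: "axis a (1 :: real) $ b = 0" "axis b (1 :: real) $ a = 0"
      using assms by (simp_all add: axis_def)
    have "rotation a b t x \<bullet> rotation a b t x = x \<bullet> x + 2 * p * x$a + 2 * q * x$b + p\<^sup>2 + q\<^sup>2"
      using assms ab unfolding rotation_def p_def[symmetric] q_def[symmetric]
      by (simp add: inner_axis inner_axis' inner_axis_axis power2_eq_square algebra_simps)
    also have "\<dots> = x \<bullet> x"
      using sin_cos_squared_add[of t] unfolding p_def q_def by algebra
    finally show ?thesis by (simp add: norm_eq_sqrt_inner)
  qed
qed

text \<open>The generator of the rotations in the plane of the coordinates \<open>a\<close> and \<open>b\<close>.\<close>

definition rot_deriv :: "3 \<Rightarrow> 3 \<Rightarrow> (real ^ 3 \<Rightarrow> real) \<Rightarrow> real ^ 3 \<Rightarrow> real" where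
  "rot_deriv a b f x = x$a * partial b f x - x$b * partial a f x"

lemma rotation_has_derivative:
  assumes "a \<noteq> b" "f differentiable (at (rotation a b s x))"
  shows "((\<lambda>t. f (rotation a b t x)) has_real_derivative rot_deriv a b f (rotation a b s x)) (at s)"
proof -
  define y where "y = rotation a b s x"
  have "((\<lambda>t. rotation a b t x) has_vector_derivative
      (- sin s * x$a - cos s * x$b) *\<^sub>R axis a 1 + (cos s * x$a - sin s * x$b) *\<^sub>R axis b 1) (at s)"
    unfolding rotation_def by (auto intro!: derivative_eq_intros simp: algebra_simps)
  then have "((\<lambda>t. rotation a b t x) has_derivative
      (\<lambda>h. h *\<^sub>R ((- y$b) *\<^sub>R axis a 1 + y$a *\<^sub>R axis b 1))) (at s)"
    using assms(1) by (simp add: has_vector_derivative_def y_def rotation_component algebra_simps)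
  moreover have "(f has_derivative frechet_derivative f (at y)) (at y)"
    using assms(2) frechet_derivative_works by (auto simp: y_def)
  ultimately have "((\<lambda>t. f (rotation a b t x)) has_derivative
      (\<lambda>h. frechet_derivative f (at y) (h *\<^sub>R ((- y$b) *\<^sub>R axis a 1 + y$a *\<^sub>R axis b 1)))) (at s)"
    unfolding y_def by (rule has_derivative_compose)
  moreover have "linear (frechet_derivative f (at y))"
    using assms(2) by (simp add: y_def linear_frechet_derivative)
  ultimately have "((\<lambda>t. f (rotation a b t x)) has_derivative
      (\<lambda>h. h * rot_deriv a b f y)) (at s)"
    by (simp add: rot_deriv_def partial_def linear_add linear_scale linear_diff linear_neg
        algebra_simps)
  then show ?thesis
    by (simp add: has_field_derivative_def y_def mult.commute[of _ "rot_deriv a b f _"])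
qed

lemma partial_homogeneous:
  fixes f :: "real ^ 3 \<Rightarrow> 'b::real_normed_vector"
  assumes "open S" "0 \<notin> S" "homogeneous_on S N f" "\<And>x. x \<in> S \<Longrightarrow> f differentiable (at x)"
  shows "homogeneous_on S (N - 1) (partial i f)"
  unfolding homogeneous_on_def
proof (intro ballI allI impI)
  fix x and t :: real
  assume x: "x \<in> S" and t: "t > 0" and tx: "t *\<^sub>R x \<in> S"
  define W where "W = S \<inter> (\<lambda>y. t *\<^sub>R y) -` S"
  have W: "open W" "x \<in> W"
    using x tx assms(1) by (auto simp: W_def intro!: open_Int open_vimage continuous_intros)
  have "((\<lambda>y. f (t *\<^sub>R y)) has_derivative (\<lambda>h. frechet_derivative f (at (t *\<^sub>R x)) (t *\<^sub>R h))) (at x)"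
    by (rule has_derivative_compose[OF has_derivative_scaleR_right[OF has_derivative_ident]
          frechet_derivative_works[THEN iffD1, OF assms(4)[OF tx]]])
  then have "partial i (\<lambda>y. f (t *\<^sub>R y)) x = t *\<^sub>R partial i f (t *\<^sub>R x)"
    unfolding linear_scale[OF linear_frechet_derivative[OF assms(4)[OF tx]]]
    by (rule partial_eqI[THEN trans]) (simp add: partial_def)
  also have "partial i (\<lambda>y. f (t *\<^sub>R y)) x = partial i (\<lambda>y. (t powi N) *\<^sub>R f y) x"
    using homogeneous_onD[OF assms(3)] t by (intro partial_cong_open[OF W]) (auto simp: W_def)
  also have "\<dots> = (t powi N) *\<^sub>R partial i f x"
    by (rule partial_bounded_linear[OF bounded_linear_scaleR_right assms(4)[OF x]])
  also have "t powi N = t * t powi (N - 1)"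
    using t by (simp add: power_int_diff)
  finally show "partial i f (t *\<^sub>R x) = (t powi (N - 1)) *\<^sub>R partial i f x"
    using t by (simp flip: scaleR_scaleR)
qed

lemma rot_deriv_regular:
  assumes "Ck_on 1 (punctured \<sigma>) G" "homogeneous_on (punctured \<sigma>) N G"
  shows "continuous_on (punctured \<sigma>) (rot_deriv a b G)"
    and "homogeneous_on (punctured \<sigma>) N (rot_deriv a b G)"
proof -
  have d: "G differentiable (at x)" if "x \<in> punctured \<sigma>" for x
    using assms(1) that by simp
  have c: "continuous_on (punctured \<sigma>) (partial i G)" for i
    using assms(1) by simp
  show "continuous_on (punctured \<sigma>) (rot_deriv a b G)"
    unfolding rot_deriv_def by (intro continuous_intros c)
  have "homogeneous_on (punctured \<sigma>) (N - 1) (partial i G)" for i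
    using partial_homogeneous[OF open_punctured _ assms(2) d] by simp
  then show "homogeneous_on (punctured \<sigma>) N (rot_deriv a b G)"
    unfolding homogeneous_on_def rot_deriv_def
    by (auto simp: algebra_simps power_int_diff)
qed

text \<open>The integral of \<open>G \<circ> R\<^sub>t\<close> does not depend on the rotation angle \<open>t\<close>, so its derivative at \<open>t = 0\<close>
  vanishes. The derivative may be taken under the integral: by the mean value theorem the difference
  quotients are values of the generator applied to \<open>G\<close> along the orbit, and this function is
  homogeneous, hence bounded by a multiple of the rotation-invariant \<open>|x|\<^bsup>N\<^esup>\<close>.\<close>

lemma lint_rot_deriv:
  assumes "a \<noteq> b" "Ck_on 1 (punctured \<sigma>) G" "homogeneous_on (punctured \<sigma>) N G" "admissible \<sigma> N"
  shows "lint \<sigma> (rot_deriv a b G) = 0"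
proof -
  let ?P = "punctured \<sigma>" and ?R = "rotation a b"
  have d: "G differentiable (at x)" if "x \<in> ?P" for x
    using assms(2) that by simp
  have G: "continuous_on ?P G"
    using assms(2) Ck_on_SucD[of 0] by simp
  have RP: "?R t x \<in> ?P" if "x \<in> ?P" for t x
    using that punctured_cong_norm orthogonal_transformation_norm[OF orthogonal_rotation[OF assms(1)]]
    by metis
  note L = rot_deriv_regular[OF assms(2,3), of a b]
  obtain C where C: "C \<ge> 0" "\<And>x. x \<in> ?P \<Longrightarrow> norm (rot_deriv a b G x) \<le> C * norm x powi N"
    using homogeneous_norm_bound[OF L] by blast
  define t where "t k = inverse (real (Suc k))" for k
  define h where "h k x = (G (?R (t k) x) - G x) / t k" for k x
  have lin: "linear (?R s)" for s
    using orthogonal_rotation[OF assms(1)] by (rule orthogonal_transformation_linear)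
  have contR: "continuous_on ?P (\<lambda>x. G (?R s x))" for s
    by (rule continuous_on_compose2[OF G linear_continuous_on[OF linear_conv_bounded_linear[THEN iffD1, OF lin]]])
       (use RP in auto)
  have homR: "homogeneous_on ?P N (\<lambda>x. G (?R s x))" for s
    unfolding homogeneous_on_def
  proof (intro ballI allI impI)
    fix x and u :: real assume x: "x \<in> ?P" "u > 0" "u *\<^sub>R x \<in> ?P"
    then show "G (?R s (u *\<^sub>R x)) = (u powi N) *\<^sub>R G (?R s x)"
      using homogeneous_onD[OF assms(3) RP[OF x(1)] x(2), of s] RP[OF x(3), of s]
      by (simp add: linear_scale[OF lin])
  qed
  have int: "integrable (lebesgue_on ?P) G" "integrable (lebesgue_on ?P) (\<lambda>x. G (?R s x))" for s
    using integrable_homogeneous assms G contR homR by blast+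
  have "lint \<sigma> (h k) = 0" for k
    unfolding h_def using int lint_orthogonal[OF orthogonal_rotation[OF assms(1)] int] by simp
  moreover have "(\<lambda>k. lint \<sigma> (h k)) \<longlonglongrightarrow> lint \<sigma> (rot_deriv a b G)"
  proof (rule integral_dominated_convergence)
    show "rot_deriv a b G \<in> borel_measurable (lebesgue_on ?P)"
      by (rule continuous_measurable_punctured[OF L(1)])
    show "h k \<in> borel_measurable (lebesgue_on ?P)" for k
      unfolding h_def by (intro continuous_measurable_punctured continuous_intros contR G) (simp add: t_def)
    show "integrable (lebesgue_on ?P) (\<lambda>x. C * norm x powi N)"
      using integrable_norm_powi[OF assms(4)] by simp
    show "AE x in lebesgue_on ?P. (\<lambda>k. h k x) \<longlonglongrightarrow> rot_deriv a b G x"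
    proof (rule AE_I2)
      fix x assume "x \<in> space (lebesgue_on ?P)"
      then have x: "x \<in> ?P" by simp
      have "((\<lambda>s. G (?R s x)) has_real_derivative rot_deriv a b G x) (at 0)"
        using rotation_has_derivative[OF assms(1), of G 0 x] d[OF x] by simp
      then have "((\<lambda>s. (G (?R s x) - G x) / s) \<longlongrightarrow> rot_deriv a b G x) (at 0)"
        by (simp add: has_field_derivative_iff)
      moreover have "filterlim t (at 0) sequentially"
        unfolding t_def filterlim_at using LIMSEQ_inverse_real_of_nat by auto
      ultimately show "(\<lambda>k. h k x) \<longlonglongrightarrow> rot_deriv a b G x"
        unfolding h_def by (rule filterlim_compose)
    qed
    show "AE x in lebesgue_on ?P. norm (h k x) \<le> C * norm x powi N" for k
    proof (rule AE_I2)
      fix x assume "x \<in> space (lebesgue_on ?P)"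
      then have x: "x \<in> ?P" by simp
      have t: "t k > 0" by (simp add: t_def)
      obtain s where s: "G (?R (t k) x) - G (?R 0 x) = (t k - 0) * rot_deriv a b G (?R s x)"
        using MVT2[OF t, of "\<lambda>s. G (?R s x)" "\<lambda>s. rot_deriv a b G (?R s x)"]
          rotation_has_derivative[OF assms(1) d[OF RP[OF x]]] by auto
      then have "h k x = rot_deriv a b G (?R s x)"
        using t by (simp add: h_def)
      then show "norm (h k x) \<le> C * norm x powi N"
        using C(2)[OF RP[OF x], of s] orthogonal_transformation_norm[OF orthogonal_rotation[OF assms(1)]]
        by simp
    qed
  qed
  ultimately show ?thesis
    by (simp add: LIMSEQ_const_iff)
qed

text \<open>The set where \<open>f\<close> is nonzero is open and negligible, hence empty.\<close>

lemma lint_eq_0D: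
  assumes "continuous_on (punctured \<sigma>) f" "\<And>x. x \<in> punctured \<sigma> \<Longrightarrow> 0 \<le> f x"
    "integrable (lebesgue_on (punctured \<sigma>)) f" "lint \<sigma> f = 0" "x \<in> punctured \<sigma>"
  shows "f x = 0"
proof -
  have "AE x in lebesgue_on (punctured \<sigma>). f x = 0"
    using integral_nonneg_eq_0_iff_AE[OF assms(3) AE_I2] assms(2,4) by simp
  then have "AE x in lebesgue. x \<in> punctured \<sigma> \<longrightarrow> f x = 0"
    by (simp add: AE_restrict_space_iff)
  then have "negligible {x. \<not> (x \<in> punctured \<sigma> \<longrightarrow> f x = 0)}"
    by (simp add: negligible_iff_null_sets completion.AE_iff_null_sets)
  moreover have "{x. \<not> (x \<in> punctured \<sigma> \<longrightarrow> f x = 0)} = punctured \<sigma> \<inter> f -` (- {0})"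
    by auto
  moreover have "open (punctured \<sigma> \<inter> f -` (- {0}))"
    by (rule continuous_open_preimage[OF assms(1) open_punctured]) (rule open_Compl, simp)
  ultimately show ?thesis
    using open_not_negligible assms(5) by fastforce
qed

section \<open>Angular momentum and the orthogonality of the solid harmonics\<close>

lemma Ck_on_mult:
  fixes f g :: "real ^ 3 \<Rightarrow> real"
  assumes "open S"
  shows "Ck_on k S f \<Longrightarrow> Ck_on k S g \<Longrightarrow> Ck_on k S (\<lambda>x. f x * g x)"
proof (induction k arbitrary: f g)
  case 0
  then show ?case by (auto intro: continuous_on_mult)
next
  case (Suc k)
  have "Ck_on k S f" "Ck_on k S g"
    using Suc.prems Ck_on_SucD by blast+
  then have "Ck_on k S (\<lambda>x. f x * partial i g x + partial i f x * g x)" for i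
    using Suc by (intro Ck_on_add[OF assms]) auto
  moreover have "partial i (\<lambda>x. f x * g x) x = f x * partial i g x + partial i f x * g x"
    if "x \<in> S" for i x
    using Suc.prems that by (auto intro: partial_mult)
  ultimately have "Ck_on k S (partial i (\<lambda>x. f x * g x))" for i
    using Ck_on_cong[OF assms, of "partial i (\<lambda>x. f x * g x)"
      "\<lambda>x. f x * partial i g x + partial i f x * g x"] by simp
  then show ?case using Suc.prems by auto
qed

lemma Ck_on_scale:
  fixes f :: "real ^ 3 \<Rightarrow> real"
  shows "open S \<Longrightarrow> Ck_on k S f \<Longrightarrow> Ck_on k S (\<lambda>x. c * f x)"
  by (rule Ck_on_bounded_linear[OF _ bounded_linear_mult_right])

lemma Ck_on_elementary: "open S \<Longrightarrow> elementary S f \<Longrightarrow> Ck_on k S f"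
  using elementary_smooth by (auto simp: smooth_on_def)

lemma Ck_on_2_iff:
  "Ck_on 2 S f \<longleftrightarrow> (\<forall>x\<in>S. f differentiable (at x)) \<and> (\<forall>i. \<forall>x\<in>S. partial i f differentiable (at x))
     \<and> (\<forall>i j. continuous_on S (partial j (partial i f)))"
  by (auto simp: numeral_2_eq_2)

lemma Ck_on_2_imp_1:
  assumes "Ck_on 2 S f"
  shows "Ck_on 1 S f" and "Ck_on 1 S (partial i f)"
  using assms Ck_on_SucD[of 1 S f] by (simp_all add: numeral_2_eq_2)

lemma homogeneous_on_mult:
  fixes f g :: "real ^ 3 \<Rightarrow> real"
  shows "homogeneous_on S p f \<Longrightarrow> homogeneous_on S q g \<Longrightarrow> homogeneous_on S (p + q) (\<lambda>x. f x * g x)"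
  unfolding homogeneous_on_def by (auto simp: power_int_add)

lemma homogeneous_on_add:
  "homogeneous_on S p f \<Longrightarrow> homogeneous_on S p g \<Longrightarrow> homogeneous_on S p (\<lambda>x. f x + g x)"
  unfolding homogeneous_on_def by (auto simp: algebra_simps)

lemma homogeneous_on_scale:
  fixes f :: "real ^ 3 \<Rightarrow> real"
  shows "homogeneous_on S p f \<Longrightarrow> homogeneous_on S p (\<lambda>x. c * f x)"
  unfolding homogeneous_on_def by auto

lemma homogeneous_norm_powi: "homogeneous_on S w (\<lambda>x. norm x powi w)"
  unfolding homogeneous_on_def by (auto simp: power_int_mult_distrib)

lemma homogeneous_on_subset: "homogeneous_on S p f \<Longrightarrow> T \<subseteq> S \<Longrightarrow> homogeneous_on T p f"
  unfolding homogeneous_on_def by blast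

lemma homogeneous_U: "homogeneous_on S n (U n m s)"
proof -
  have "U n m s (t *\<^sub>R x) = t powi n * U n m s x" if "t > 0" for t x
  proof -
    have "Complex (t * x$2) (t * x$3) = of_real t * Complex (x$2) (x$3)"
      by (simp add: complex_eq_iff)
    then have "Arg (Complex (t * x$2) (t * x$3)) = Arg (Complex (x$2) (x$3))"
      using that by (simp add: Arg_times_of_real)
    then show ?thesis
      using that by (simp add: U_def power_int_mult_distrib)
  qed
  then show ?thesis by (simp add: homogeneous_on_def)
qed

text \<open>The weight makes the product integrable when the two degrees of homogeneity do not: being radial, it
  is annihilated by the generators of rotations, so these stay skew-symmetric.\<close>

definition wip :: "side \<Rightarrow> int \<Rightarrow> (real ^ 3 \<Rightarrow> real) \<Rightarrow> (real ^ 3 \<Rightarrow> real) \<Rightarrow> real" where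
  "wip \<sigma> w f g = lint \<sigma> (\<lambda>x. norm x powi w * (f x * g x))"

lemma punctured_nonzero: "x \<in> punctured \<sigma> \<Longrightarrow> x \<noteq> 0"
  by auto

lemma continuous_norm_powi: "continuous_on (punctured \<sigma>) (\<lambda>x. norm x powi w)"
  by (intro continuous_intros) auto

lemma integrable_wip:
  assumes "continuous_on (punctured \<sigma>) f" "continuous_on (punctured \<sigma>) g"
    "homogeneous_on (punctured \<sigma>) p f" "homogeneous_on (punctured \<sigma>) q g" "admissible \<sigma> (w + p + q)"
  shows "integrable (lebesgue_on (punctured \<sigma>)) (\<lambda>x. norm x powi w * (f x * g x))"
proof (rule integrable_homogeneous)
  show "homogeneous_on (punctured \<sigma>) (w + (p + q)) (\<lambda>x. norm x powi w * (f x * g x))"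
    by (intro homogeneous_on_mult homogeneous_norm_powi assms)
  show "continuous_on (punctured \<sigma>) (\<lambda>x. norm x powi w * (f x * g x))"
    by (intro continuous_on_mult continuous_norm_powi assms)
qed (use assms in \<open>simp add: add.assoc\<close>)

lemma wip_commute: "wip \<sigma> w f g = wip \<sigma> w g f"
  by (simp add: wip_def mult.commute)

lemma wip_cong:
  assumes "\<And>x. x \<in> punctured \<sigma> \<Longrightarrow> f x = f' x" "\<And>x. x \<in> punctured \<sigma> \<Longrightarrow> g x = g' x"
  shows "wip \<sigma> w f g = wip \<sigma> w f' g'"
  unfolding wip_def by (intro Bochner_Integration.integral_cong) (use assms in auto)

lemma wip_scale: "wip \<sigma> w (\<lambda>x. c * f x) g = c * wip \<sigma> w f g" "wip \<sigma> w g (\<lambda>x. c * f x) = c * wip \<sigma> w g f"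
proof -
  show *: "wip \<sigma> w (\<lambda>x. c * f x) g = c * wip \<sigma> w f g" for g
  proof -
    have "wip \<sigma> w (\<lambda>x. c * f x) g = lint \<sigma> (\<lambda>x. c * (norm x powi w * (f x * g x)))"
      by (simp add: wip_def algebra_simps)
    then show ?thesis by (simp add: wip_def)
  qed
  show "wip \<sigma> w g (\<lambda>x. c * f x) = c * wip \<sigma> w g f"
    using *[of g] wip_commute by metis
qed

lemma wip_add:
  assumes "continuous_on (punctured \<sigma>) f" "continuous_on (punctured \<sigma>) f'" "continuous_on (punctured \<sigma>) g"
    "homogeneous_on (punctured \<sigma>) p f" "homogeneous_on (punctured \<sigma>) p f'" "homogeneous_on (punctured \<sigma>) q g"
    "admissible \<sigma> (w + p + q)"
  shows "wip \<sigma> w (\<lambda>x. f x + f' x) g = wip \<sigma> w f g + wip \<sigma> w f' g"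
  unfolding wip_def
  by (subst Bochner_Integration.integral_add[symmetric])
     (intro integrable_wip[OF _ _ _ _ assms(7)] assms, intro integrable_wip[OF _ _ _ _ assms(7)] assms,
      simp add: algebra_simps)

lemma rot_deriv_mult:
  assumes "f differentiable (at x)" "g differentiable (at x)"
  shows "rot_deriv a b (\<lambda>x. f x * g x) x = rot_deriv a b f x * g x + f x * rot_deriv a b g x"
  using assms by (simp add: rot_deriv_def partial_mult algebra_simps)

lemma rot_deriv_norm_powi: "x \<noteq> 0 \<Longrightarrow> rot_deriv a b (\<lambda>x. norm x powi w) x = 0"
  by (simp add: rot_deriv_def partial_norm_powi)

lemma wip_rot_deriv:
  assumes "a \<noteq> b" "Ck_on 1 (punctured \<sigma>) f" "Ck_on 1 (punctured \<sigma>) g"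
    "homogeneous_on (punctured \<sigma>) p f" "homogeneous_on (punctured \<sigma>) q g" "admissible \<sigma> (w + p + q)"
  shows "wip \<sigma> w (rot_deriv a b f) g = - wip \<sigma> w f (rot_deriv a b g)"
proof -
  let ?P = "punctured \<sigma>"
  note L = rot_deriv_regular[OF assms(2,4), of a b] rot_deriv_regular[OF assms(3,5), of a b]
  have c: "continuous_on ?P f" "continuous_on ?P g"
    using assms(2,3) Ck_on_SucD[of 0] by simp_all
  have n: "elementary ?P (\<lambda>x. norm x powi w)"
    by (rule elementary.norm_powi) simp
  have d: "f differentiable (at x)" "g differentiable (at x)" "(\<lambda>x. norm x powi w) differentiable (at x)"
    if "x \<in> ?P" for x
    using assms(2,3) that elementary_differentiable[OF open_punctured n that] by simp_all
  define G where "G = (\<lambda>x. norm x powi w * (f x * g x))"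
  have "Ck_on 1 ?P G" unfolding G_def
    by (intro Ck_on_mult open_punctured assms Ck_on_elementary n)
  moreover have "homogeneous_on ?P (w + p + q) G"
    unfolding G_def using homogeneous_on_mult[OF homogeneous_norm_powi homogeneous_on_mult[OF assms(4,5)]]
    by (simp add: add.assoc)
  ultimately have "0 = lint \<sigma> (rot_deriv a b G)"
    using lint_rot_deriv[OF assms(1) _ _ assms(6)] by simp
  also have "\<dots> = lint \<sigma> (\<lambda>x. norm x powi w * (rot_deriv a b f x * g x) + norm x powi w * (f x * rot_deriv a b g x))"
  proof (rule Bochner_Integration.integral_cong[OF refl])
    fix x assume "x \<in> space (lebesgue_on ?P)"
    then have x: "x \<in> ?P" "x \<noteq> 0" by auto
    show "rot_deriv a b G x = norm x powi w * (rot_deriv a b f x * g x) + norm x powi w * (f x * rot_deriv a b g x)"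
      unfolding G_def using d[OF x(1)] x(2)
      by (simp add: rot_deriv_mult rot_deriv_norm_powi algebra_simps)
  qed
  also have "\<dots> = wip \<sigma> w (rot_deriv a b f) g + wip \<sigma> w f (rot_deriv a b g)"
    unfolding wip_def using assms c L
    by (intro Bochner_Integration.integral_add integrable_wip[of _ _ _ p q]) auto
  finally show ?thesis by simp
qed

lemma U_regular:
  "Ck_on k (punctured \<sigma>) (U n m s)" "continuous_on (punctured \<sigma>) (U n m s)"
  "homogeneous_on (punctured \<sigma>) n (U n m s)"
  using Ck_on_elementary[OF open_punctured elementary_U] elementary_continuous[OF open_punctured elementary_U]
    homogeneous_U by simp_all

lemma U_0_Minus: "U n 0 Minus x = 0"
  by (simp add: U_def)

text \<open>Skew-symmetry of the rotation about the polar axis, which exchanges \<open>U\<^sup>+\<close> and \<open>U\<^sup>-\<close> up to the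
  factor \<open>\<plusminus>m\<close>.\<close>

lemma wip_U_axis:
  assumes "admissible \<sigma> (w + n + n)"
  shows "real m * wip \<sigma> w (U n m s) (U n m' s')
     = pm s * pm s' * real m' * wip \<sigma> w (U n m (flip s)) (U n m' (flip s'))"
proof -
  have L: "rot_deriv 2 3 (U n m s) x = (- pm s * real m) * U n m (flip s) x" if "x \<in> punctured \<sigma>" for x m s
    using rotation_axis_U[OF punctured_nonzero[OF that], of n m s] by (simp add: rot_deriv_def)
  have "wip \<sigma> w (rot_deriv 2 3 (U n m (flip s))) (U n m' s') = - wip \<sigma> w (U n m (flip s)) (rot_deriv 2 3 (U n m' s'))"
    by (rule wip_rot_deriv[OF _ _ _ _ _ assms]) (simp_all add: U_regular del: One_nat_def)
  moreover have "wip \<sigma> w (rot_deriv 2 3 (U n m (flip s))) (U n m' s')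
      = wip \<sigma> w (\<lambda>x. (pm s * real m) * U n m s x) (U n m' s')"
    by (rule wip_cong) (use L[of _ m "flip s"] in simp_all)
  moreover have "wip \<sigma> w (U n m (flip s)) (rot_deriv 2 3 (U n m' s'))
      = wip \<sigma> w (U n m (flip s)) (\<lambda>x. (- pm s' * real m') * U n m' (flip s') x)"
    by (rule wip_cong) (use L in simp_all)
  ultimately have eq: "pm s * real m * wip \<sigma> w (U n m s) (U n m' s')
      = pm s' * real m' * wip \<sigma> w (U n m (flip s)) (U n m' (flip s'))"
    unfolding wip_scale by simp
  from arg_cong[OF this, of "\<lambda>z. pm s * z"] show ?thesis
    by (simp add: mult.assoc)
qed

text \<open>Applying the preceding identity twice gives \<open>m\<^sup>2 X = m'\<^sup>2 X\<close> for the product \<open>X\<close>. For equal positive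
  orders and opposite signs it gives \<open>X = -X\<close>; at order \<open>0\<close> the function with sign minus vanishes.\<close>

lemma wip_U_orthogonal:
  assumes "admissible \<sigma> (w + n + n)" "(m, s) \<noteq> (m', s')"
  shows "wip \<sigma> w (U n m s) (U n m' s') = 0"
proof (cases "m = m'")
  case False
  define X where "X = wip \<sigma> w (U n m s) (U n m' s')"
  define Y where "Y = wip \<sigma> w (U n m (flip s)) (U n m' (flip s'))"
  have 1: "real m * X = pm s * pm s' * real m' * Y" "real m * Y = pm s * pm s' * real m' * X"
    using wip_U_axis[OF assms(1), of m s m' s'] wip_U_axis[OF assms(1), of m "flip s" m' "flip s'"]
    by (simp_all add: X_def Y_def)
  have "(pm s * pm s') * (pm s * pm s') = 1" by (cases s; cases s'; simp)
  then have "(real m * real m) * X = (real m' * real m') * X"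
    using 1 by algebra
  moreover have "real m * real m \<noteq> real m' * real m'"
    using False by (metis abs_of_nat abs_mult_self_eq of_nat_eq_iff real_sqrt_abs2)
  ultimately show ?thesis by (simp add: X_def)
next
  case True
  then have s: "s' = flip s" using assms(2) by (cases s; cases s') auto
  show ?thesis
  proof (cases "m = 0")
    case True
    then have "wip \<sigma> w (U n m s) (U n m' s') = wip \<sigma> w (\<lambda>x. 0 * U n m s x) (U n m' s') \<or>
      wip \<sigma> w (U n m s) (U n m' s') = wip \<sigma> w (U n m s) (\<lambda>x. 0 * U n m s x)"
      using s \<open>m = m'\<close> by (cases s) (auto simp: U_0_Minus intro!: wip_cong)
    then show ?thesis unfolding wip_scale by auto
  next
    case False
    then show ?thesis
      using wip_U_axis[OF assms(1), of m s m "flip s"] wip_commute[of \<sigma> w "U n m s"] True s by simp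
  qed
qed

lemma wip_U_flip:
  assumes "admissible \<sigma> (w + n + n)" "m \<noteq> 0"
  shows "wip \<sigma> w (U n m (flip s)) (U n m (flip s)) = wip \<sigma> w (U n m s) (U n m s)"
  using wip_U_axis[OF assms(1), of m s m s] assms(2) by simp

text \<open>Adding the two signs makes the order \<open>0\<close>, where only the plus sign occurs, fit the same ratio formula
  as the other orders.\<close>

definition order_norm :: "side \<Rightarrow> int \<Rightarrow> nat \<Rightarrow> real" where
  "order_norm \<sigma> n m = wip \<sigma> 0 (U n m Plus) (U n m Plus) + wip \<sigma> 0 (U n m Minus) (U n m Minus)"

text \<open>Skew-symmetry of a rotation moving the polar axis, between the orders \<open>m\<close> and \<open>m + 1\<close>: for
  \<open>m \<ge> 1\<close>, half of \<open>U\<^sub>m\<^sub>+\<^sub>1\<close> occurs in the image of \<open>U\<^sub>m\<close>, and \<open>-(n + m + 1)(n - m) / 2\<close> times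
  \<open>U\<^sub>m\<close> in that of \<open>U\<^sub>m\<^sub>+\<^sub>1\<close>. By orthogonality no other order contributes.\<close>

lemma order_norm_Suc:
  assumes "admissible \<sigma> (n + n)"
  shows "order_norm \<sigma> n (Suc m) = (of_int n + real m + 1) * (of_int n - real m) * order_norm \<sigma> n m"
proof -
  have ad: "admissible \<sigma> (0 + n + n)" using assms by simp
  have minus: "wip \<sigma> 0 (U n k Minus) (U n k Minus) = wip \<sigma> 0 (U n k Plus) (U n k Plus)" if "k \<noteq> 0" for k
    using wip_U_flip[OF ad that, of Plus] by simp
  have 0: "wip \<sigma> 0 (U n 0 Minus) (U n 0 Minus) = 0"
    by (simp add: wip_def U_0_Minus)
  have lin: "wip \<sigma> 0 (\<lambda>x. (U n k s x - c * U n k' s x) / 2) (U n l s')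
      = (wip \<sigma> 0 (U n k s) (U n l s') - c * wip \<sigma> 0 (U n k' s) (U n l s')) / 2" for k k' s c l s'
  proof -
    have "wip \<sigma> 0 (\<lambda>x. 1 / 2 * U n k s x + - c / 2 * U n k' s x) (U n l s')
      = wip \<sigma> 0 (\<lambda>x. 1 / 2 * U n k s x) (U n l s') + wip \<sigma> 0 (\<lambda>x. - c / 2 * U n k' s x) (U n l s')"
      by (rule wip_add[of _ _ _ _ n n])
         (intro continuous_intros U_regular homogeneous_on_scale ad)+
    then show ?thesis
      unfolding wip_scale by (simp add: diff_divide_distrib)
  qed
  have skew: "wip \<sigma> 0 (rot_deriv 1 2 (U n m Plus)) (U n (Suc m) Plus)
      = - wip \<sigma> 0 (U n m Plus) (rot_deriv 1 2 (U n (Suc m) Plus))"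
    by (rule wip_rot_deriv[OF _ _ _ _ _ ad]) (simp_all add: U_regular del: One_nat_def)
  have "wip \<sigma> 0 (U n m Plus) (rot_deriv 1 2 (U n (Suc m) Plus))
      = wip \<sigma> 0 (\<lambda>x. (U n (Suc (Suc m)) Plus x
          - ((of_int n + real m + 1) * (of_int n - real m)) * U n m Plus x) / 2) (U n m Plus)"
    by (subst wip_commute, rule wip_cong)
       (simp_all only: rot_deriv_def rotation_12_U_Suc[OF punctured_nonzero])
  also have "\<dots> = - ((of_int n + real m + 1) * (of_int n - real m)
      * wip \<sigma> 0 (U n m Plus) (U n m Plus)) / 2"
    unfolding lin using wip_U_orthogonal[OF ad, of "Suc (Suc m)" Plus m Plus] by simp
  finally have rhs: "- wip \<sigma> 0 (U n m Plus) (rot_deriv 1 2 (U n (Suc m) Plus))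
      = (of_int n + real m + 1) * (of_int n - real m) * wip \<sigma> 0 (U n m Plus) (U n m Plus) / 2"
    by simp
  show ?thesis
  proof (cases m)
    case 0
    have "wip \<sigma> 0 (rot_deriv 1 2 (U n 0 Plus)) (U n (Suc 0) Plus) = wip \<sigma> 0 (U n (Suc 0) Plus) (U n (Suc 0) Plus)"
      by (rule wip_cong) (simp_all add: rot_deriv_def rotation_12_U_0[OF punctured_nonzero])
    then show ?thesis
      using skew rhs minus[of 1] \<open>wip \<sigma> 0 (U n 0 Minus) (U n 0 Minus) = 0\<close> by (simp add: order_norm_def 0)
  next
    case (Suc j)
    have "wip \<sigma> 0 (rot_deriv 1 2 (U n m Plus)) (U n (Suc m) Plus)
      = wip \<sigma> 0 (\<lambda>x. (U n (Suc m) Plus x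
          - ((of_int n + real j + 1) * (of_int n - real j)) * U n j Plus x) / 2) (U n (Suc m) Plus)"
      by (rule wip_cong) (simp_all only: rot_deriv_def rotation_12_U_Suc[OF punctured_nonzero] Suc)
    also have "\<dots> = wip \<sigma> 0 (U n (Suc m) Plus) (U n (Suc m) Plus) / 2"
      unfolding lin using wip_U_orthogonal[OF ad, of j Plus "Suc m" Plus] Suc by simp
    finally show ?thesis
      using skew rhs minus[of m] minus[of "Suc m"] Suc by (simp add: order_norm_def)
  qed
qed

section \<open>Homogeneous harmonic functions\<close>

definition hharm :: "(real ^ 3) set \<Rightarrow> int \<Rightarrow> (real ^ 3 \<Rightarrow> real) \<Rightarrow> bool" where
  "hharm S d u \<longleftrightarrow> harmonic_on S u \<and> homogeneous_on S d u"

lemma hharm_subset: "hharm S d u \<Longrightarrow> T \<subseteq> S \<Longrightarrow> hharm T d u"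
  unfolding hharm_def harmonic_on_def by (meson Ck_on_subset homogeneous_on_subset subsetD)

lemma laplacian_cong_open:
  assumes "open S" "x \<in> S" "\<And>y. y \<in> S \<Longrightarrow> f y = g y"
  shows "laplacian f x = laplacian g x"
  unfolding laplacian_def
  by (intro sum.cong refl partial_cong_open[OF assms(1,2)] partial_cong_open[OF assms(1)] assms(3))

lemma hharm_cong:
  assumes "open S" "\<And>x. x \<in> S \<Longrightarrow> f x = g x"
  shows "hharm S d f \<longleftrightarrow> hharm S d g"
proof -
  have "homogeneous_on S d f \<longleftrightarrow> homogeneous_on S d g"
    using assms(2) by (simp add: homogeneous_on_def)
  moreover have "harmonic_on S f \<longleftrightarrow> harmonic_on S g"
    using Ck_on_cong[OF assms] laplacian_cong_open[OF assms(1) _ assms(2)] by (auto simp: harmonic_on_def)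
  ultimately show ?thesis by (simp add: hharm_def)
qed

lemma hharm_add:
  assumes "open S" "hharm S d f" "hharm S d g"
  shows "hharm S d (\<lambda>x. f x + g x)"
proof -
  have C: "Ck_on 2 S f" "Ck_on 2 S g" and L: "\<And>x. x \<in> S \<Longrightarrow> laplacian f x = 0" "\<And>x. x \<in> S \<Longrightarrow> laplacian g x = 0"
    using assms by (auto simp: hharm_def harmonic_on_def)
  have "partial i (partial i (\<lambda>x. f x + g x)) x = partial i (partial i f) x + partial i (partial i g) x"
    if "x \<in> S" for i x
    using C that
    by (subst partial_cong_open[OF assms(1) that, where g = "\<lambda>x. partial i f x + partial i g x"])
       (simp_all add: Ck_on_2_iff partial_add)
  then have "laplacian (\<lambda>x. f x + g x) x = 0" if "x \<in> S" for x
    using L[OF that] that by (simp add: laplacian_def sum.distrib)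
  then show ?thesis
    using assms Ck_on_add[OF assms(1) C] homogeneous_on_add by (auto simp: hharm_def harmonic_on_def)
qed

lemma hharm_scale:
  assumes "open S" "hharm S d f"
  shows "hharm S d (\<lambda>x. c * f x)"
proof -
  have C: "Ck_on 2 S f" and L: "\<And>x. x \<in> S \<Longrightarrow> laplacian f x = 0"
    using assms by (auto simp: hharm_def harmonic_on_def)
  have "partial i (partial i (\<lambda>x. c * f x)) x = c * partial i (partial i f) x" if "x \<in> S" for i x
    using C that
    by (subst partial_cong_open[OF assms(1) that, where g = "\<lambda>x. c * partial i f x"])
       (simp_all add: Ck_on_2_iff partial_cmult)
  then have "laplacian (\<lambda>x. c * f x) x = 0" if "x \<in> S" for x
    using L[OF that] that by (simp add: laplacian_def flip: sum_distrib_left)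
  then show ?thesis
    using assms Ck_on_scale[OF assms(1) C] homogeneous_on_scale by (auto simp: hharm_def harmonic_on_def)
qed

lemma hharm_zero: "hharm S d (\<lambda>x. 0)"
proof -
  have "Ck_on k S (\<lambda>x. 0 :: real)" for k
    by (induction k) auto
  then show ?thesis by (simp add: hharm_def harmonic_on_def laplacian_def homogeneous_on_def)
qed

lemma hharm_sum:
  assumes "open S" "\<And>i. i \<in> I \<Longrightarrow> hharm S d (f i)"
  shows "hharm S d (\<lambda>x. \<Sum>i\<in>I. f i x)"
  using assms(2)
  by (induction I rule: infinite_finite_induct) (simp_all add: hharm_zero hharm_add[OF assms(1)])

lemma laplacian_U:
  assumes "x \<noteq> 0"
  shows "laplacian (U n m s) x = 0"
proof -
  have S: "open (- {0 :: real ^ 3})" "x \<in> - {0}" using assms by auto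
  have p: "partial i (\<lambda>y. a * U n m s y + b * U n' m' s' y) x
      = a * partial i (U n m s) x + b * partial i (U n' m' s') x" for i a b n m s n' m' s'
    using U_differentiable[OF assms] by (simp add: partial_add partial_cmult)
  have P1: "partial 1 (partial 1 (U n m s)) x
      = (of_int n + real m) * (of_int n + real m - 1) * U (n - 2) m s x"
  proof -
    have "partial 1 (partial 1 (U n m s)) x
      = partial 1 (\<lambda>y. (of_int n + real m) * U (n - 1) m s y + 0 * U n m s y) x"
      by (rule partial_cong_open[OF S]) (simp add: partial_1_U)
    then show ?thesis
      unfolding p by (simp add: partial_1_U[OF assms] algebra_simps)
  qed
  show ?thesis
  proof (cases m)
    case 0
    have P2: "partial 2 (partial 2 (U n m s)) x
        = partial 2 (\<lambda>y. (if s = Plus then 1 else 0) * U (n - 1) (Suc 0) Plus y + 0 * U n m s y) x"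
      by (rule partial_cong_open[OF S]) (simp add: partial_2_U_0 0)
    have P3: "partial 3 (partial 3 (U n m s)) x
        = partial 3 (\<lambda>y. (if s = Plus then 1 else 0) * U (n - 1) (Suc 0) Minus y + 0 * U n m s y) x"
      by (rule partial_cong_open[OF S]) (simp add: partial_3_U_0 0)
    show ?thesis
      unfolding laplacian_def sum_3 P1 P2 P3 p
      by (cases s) (simp_all add: partial_2_U_Suc[OF assms] partial_3_U_Suc[OF assms] 0 U_0_Minus
          field_simps)
  next
    case (Suc j)
    define c where "c = (of_int n + real j + 1) * (of_int n + real j)"
    have P2: "partial 2 (partial 2 (U n m s)) x
        = partial 2 (\<lambda>y. 1 / 2 * U (n - 1) (Suc (Suc j)) s y + - c / 2 * U (n - 1) j s y) x"
      by (rule partial_cong_open[OF S]) (simp add: partial_2_U_Suc Suc c_def diff_divide_distrib)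
    have P3: "partial 3 (partial 3 (U n m s)) x
        = partial 3 (\<lambda>y. pm s / 2 * U (n - 1) (Suc (Suc j)) (flip s) y
            + pm s * c / 2 * U (n - 1) j (flip s) y) x"
      by (rule partial_cong_open[OF S])
         (simp add: partial_3_U_Suc Suc c_def add_divide_distrib algebra_simps)
    show ?thesis
    proof (cases j)
      case 0
      show ?thesis
        unfolding laplacian_def sum_3 P1 P2 P3 p
        by (cases s) (simp_all add: partial_2_U_Suc[OF assms] partial_3_U_Suc[OF assms]
            partial_2_U_0[OF assms] partial_3_U_0[OF assms] Suc 0 c_def field_simps)
    next
      case (Suc i)
      show ?thesis
        unfolding laplacian_def sum_3 P1 P2 P3 p
        by (cases s) (simp_all add: partial_2_U_Suc[OF assms] partial_3_U_Suc[OF assms]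
            \<open>m = Suc j\<close> Suc c_def field_simps)
    qed
  qed
qed

text \<open>Identities proved away from the origin extend to it by continuity.\<close>

lemma continuous_on_open_eq_0:
  fixes f :: "real ^ 3 \<Rightarrow> 'b::real_normed_vector"
  assumes "open S" "continuous_on S f" "\<And>x. x \<in> S \<Longrightarrow> x \<noteq> 0 \<Longrightarrow> f x = 0" "x \<in> S"
  shows "f x = 0"
proof (cases "x = 0")
  case True
  have "(f \<longlongrightarrow> f x) (at x)"
    using assms(1,2,4) continuous_on_eq_continuous_at isCont_def by blast
  moreover have "\<forall>\<^sub>F y in at x. f y = 0"
    using eventually_at_topological assms True by (metis (mono_tags, lifting))
  then have "(f \<longlongrightarrow> 0) (at x)"
    by (rule tendsto_eventually)
  ultimately show ?thesis
    using tendsto_unique[of "at x"] by simp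
qed (use assms in auto)

lemma elementary_laplacian: "open S \<Longrightarrow> elementary S f \<Longrightarrow> elementary S (laplacian f)"
  unfolding laplacian_def[abs_def] by (intro elementary_sum elementary_partial)

lemma hharm_U:
  assumes "open S" "0 \<notin> S \<or> n \<ge> 1"
  shows "hharm S n (U n m s)"
proof -
  have e: "elementary S (U n m s)"
    using assms elementary_U elementary_U_nonneg by blast
  have "laplacian (U n m s) x = 0" if "x \<in> S" for x
    using continuous_on_open_eq_0[OF assms(1) elementary_continuous[OF assms(1) elementary_laplacian[OF assms(1) e]]]
      laplacian_U that by blast
  then show ?thesis
    using Ck_on_elementary[OF assms(1) e] homogeneous_U by (simp add: hharm_def harmonic_on_def)
qed

lemma Euler:
  fixes f :: "real ^ 3 \<Rightarrow> real"
  assumes "open S" "homogeneous_on S d f" "x \<in> S" "f differentiable (at x)"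
  shows "x$1 * partial 1 f x + x$2 * partial 2 f x + x$3 * partial 3 f x = of_int d * f x"
proof -
  have f: "(f has_derivative (\<lambda>h. \<Sum>i\<in>UNIV. h$i *\<^sub>R partial i f x)) (at x)"
    by (rule has_derivative_partial[OF assms(4)])
  have 1: "((\<lambda>t. t *\<^sub>R x) has_derivative (\<lambda>h. h *\<^sub>R x)) (at 1)"
    by (auto intro!: derivative_eq_intros)
  have "((\<lambda>t. f (t *\<^sub>R x)) has_derivative (\<lambda>h. \<Sum>i\<in>UNIV. (h *\<^sub>R x)$i *\<^sub>R partial i f x)) (at 1)"
    using has_derivative_compose[OF 1, unfolded scaleR_one, OF f] .
  moreover have "((\<lambda>t. t powi d * f x) has_derivative (\<lambda>h. h * of_int d * f x)) (at 1)"
    by (auto intro!: derivative_eq_intros)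
  then have "((\<lambda>t. f (t *\<^sub>R x)) has_derivative (\<lambda>h. h * of_int d * f x)) (at 1)"
  proof (rule has_derivative_transform_within_open)
    show "open ({0<..} \<inter> (\<lambda>t. t *\<^sub>R x) -` S)"
      by (intro open_Int open_vimage assms continuous_intros open_greaterThan)
    show "t powi d * f x = f (t *\<^sub>R x)" if "t \<in> {0<..} \<inter> (\<lambda>t. t *\<^sub>R x) -` S" for t
      using homogeneous_onD[OF assms(2,3), of t] that by auto
  qed (use assms(3) in auto)
  ultimately have "(\<lambda>h. \<Sum>i\<in>UNIV. (h *\<^sub>R x)$i *\<^sub>R partial i f x) = (\<lambda>h. h * of_int d * f x)"
    by (rule has_derivative_unique)
  from fun_cong[OF this, of 1] show ?thesis
    by (simp add: sum_3)
qed

lemma partial_diff: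
  "f differentiable (at x) \<Longrightarrow> g differentiable (at x) \<Longrightarrow>
     partial i (\<lambda>x. f x - g x) x = partial i f x - partial i g x"
  by (rule partial_eqI[OF has_derivative_diff[OF has_derivative_partial has_derivative_partial],
        THEN trans]) (auto simp: axis_def if_distrib if_distribR cong: if_cong)

lemma partial_rot_deriv:
  assumes "Ck_on 2 S f" "x \<in> S"
  shows "partial c (rot_deriv a b f) x = (if c = a then partial b f x else 0) + x$a * partial c (partial b f) x
     - ((if c = b then partial a f x else 0) + x$b * partial c (partial a f) x)"
proof -
  have "(\<lambda>x::real^3. x$j) differentiable (at x)" for j
    by (rule bounded_linear_imp_differentiable[OF bounded_linear_vec_nth])
  moreover have "partial j f differentiable (at x)" for j
    using assms by (simp add: Ck_on_2_iff)
  ultimately show ?thesis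
    unfolding rot_deriv_def[abs_def] by (subst partial_diff; simp add: partial_mult)
qed

lemma Ck_on_rot_deriv:
  assumes "Ck_on 2 S f" "open S"
  shows "Ck_on 1 S (rot_deriv a b f)"
proof -
  have "Ck_on 1 S (\<lambda>x. x$a * partial b f x + (-1) * (x$b * partial a f x))"
    using Ck_on_2_imp_1[OF assms(1)] Ck_on_elementary[OF assms(2) elementary.coordinate]
    by (intro Ck_on_add Ck_on_mult Ck_on_scale assms(2)) auto
  moreover have "rot_deriv a b f = (\<lambda>x. x$a * partial b f x + (-1) * (x$b * partial a f x))"
    by (simp add: rot_deriv_def fun_eq_iff)
  ultimately show ?thesis by simp
qed

text \<open>The sum of squares is \<open>|x|\<^sup>2 \<Delta> - (E\<^sup>2 + E)\<close> with the Euler operator \<open>E = \<Sum> x\<^sub>i \<partial>\<^sub>i\<close>, and \<open>E\<close> acts as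
  \<open>d\<close>; this is the Laplace--Beltrami operator of the spheres.\<close>

lemma sphere_laplacian:
  assumes "open S" "0 \<notin> S" "hharm S d u" "x \<in> S"
  shows "rot_deriv 1 2 (rot_deriv 1 2 u) x + rot_deriv 1 3 (rot_deriv 1 3 u) x
     + rot_deriv 2 3 (rot_deriv 2 3 u) x = - (of_int d * (of_int d + 1)) * u x"
proof -
  have C: "Ck_on 2 S u" and L: "laplacian u x = 0" and h: "homogeneous_on S d u"
    using assms by (auto simp: hharm_def harmonic_on_def)
  have d: "u differentiable (at y)" "partial i u differentiable (at y)" if "y \<in> S" for i y
    using C that by (auto simp: Ck_on_2_iff)
  have h': "homogeneous_on S (d - 1) (partial i u)" for i
    by (rule partial_homogeneous[OF assms(1,2) h d(1)])
  have E0: "x$1 * partial 1 u x + x$2 * partial 2 u x + x$3 * partial 3 u x = of_int d * u x"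
    by (rule Euler[OF assms(1) h assms(4) d(1)[OF assms(4)]])
  have E: "x$1 * partial 1 (partial i u) x + x$2 * partial 2 (partial i u) x + x$3 * partial 3 (partial i u) x
      = (of_int d - 1) * partial i u x" for i
    using Euler[OF assms(1) h' assms(4) d(2)[OF assms(4)], of i] by simp
  have Lx: "partial 1 (partial 1 u) x + partial 2 (partial 2 u) x + partial 3 (partial 3 u) x = 0"
    using L by (simp add: laplacian_def sum_3)
  have "rot_deriv a b (rot_deriv a b u) x
      = x$a * (x$a * partial b (partial b u) x - partial a u x - x$b * partial b (partial a u) x)
      - x$b * (partial b u x + x$a * partial a (partial b u) x - x$b * partial a (partial a u) x)"
    if "a \<noteq> b" for a b
    unfolding rot_deriv_def[of a b "rot_deriv a b u"] partial_rot_deriv[OF C assms(4)] using that by simp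
  note this[of 1 2] this[of 1 3] this[of 2 3]
  then show ?thesis
    using E[of 1] E[of 2] E[of 3] E0 Lx by simp algebra
qed

text \<open>Each generator is skew, so the sum of their squares is symmetric, and its eigenfunctions for different
  eigenvalues are orthogonal.\<close>

lemma wip_eigenvalue_orthogonal:
  assumes u: "hharm (punctured \<sigma>) d u" and v: "hharm (punctured \<sigma>) e v"
    and ad: "admissible \<sigma> (w + d + e)" and ne: "d * (d + 1) \<noteq> e * (e + 1)"
  shows "wip \<sigma> w u v = 0"
proof -
  let ?P = "punctured \<sigma>"
  have C: "Ck_on 2 ?P u" "Ck_on 2 ?P v" and h: "homogeneous_on ?P d u" "homogeneous_on ?P e v"
    using u v by (auto simp: hharm_def harmonic_on_def)
  have C1: "Ck_on 1 ?P u" "Ck_on 1 ?P v" "Ck_on 1 ?P (rot_deriv a b u)" "Ck_on 1 ?P (rot_deriv a b v)" for a b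
    using C Ck_on_2_imp_1(1) Ck_on_rot_deriv[OF _ open_punctured] by blast+
  have h1: "homogeneous_on ?P d (rot_deriv a b u)" "homogeneous_on ?P e (rot_deriv a b v)" for a b
    using rot_deriv_regular(2) C1 h by blast+
  have h2: "homogeneous_on ?P d (rot_deriv a b (rot_deriv a b u))"
    "homogeneous_on ?P e (rot_deriv a b (rot_deriv a b v))" for a b
    using rot_deriv_regular(2) C1 h1 by blast+
  have c0: "continuous_on ?P u" "continuous_on ?P v"
    using C1 Ck_on_SucD[of 0] by simp_all
  have c2: "continuous_on ?P (rot_deriv a b (rot_deriv a b u))"
    "continuous_on ?P (rot_deriv a b (rot_deriv a b v))" for a b
    using rot_deriv_regular(1) C1 h1 by blast+
  have ad': "admissible \<sigma> (w + e + d)" using ad by (simp add: algebra_simps)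
  have swap: "wip \<sigma> w (rot_deriv a b (rot_deriv a b u)) v = wip \<sigma> w (rot_deriv a b (rot_deriv a b v)) u"
    if "a \<noteq> b" for a b
  proof -
    have "wip \<sigma> w (rot_deriv a b (rot_deriv a b u)) v = - wip \<sigma> w (rot_deriv a b u) (rot_deriv a b v)"
      by (rule wip_rot_deriv[OF that C1(3,2) h1(1) h(2) ad])
    moreover have "wip \<sigma> w (rot_deriv a b (rot_deriv a b v)) u = - wip \<sigma> w (rot_deriv a b v) (rot_deriv a b u)"
      by (rule wip_rot_deriv[OF that C1(4,1) h1(2) h(1) ad'])
    ultimately show ?thesis by (metis wip_commute)
  qed
  let ?S = "\<lambda>u x. rot_deriv 1 2 (rot_deriv 1 2 u) x + rot_deriv 1 3 (rot_deriv 1 3 u) x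
      + rot_deriv 2 3 (rot_deriv 2 3 u) x"
  have eu: "wip \<sigma> w (?S u) v = - (of_int d * (of_int d + 1)) * wip \<sigma> w u v"
    unfolding wip_scale(1)[symmetric]
    by (rule wip_cong[OF _ refl]) (use sphere_laplacian[OF open_punctured _ u] in simp)
  have ev: "wip \<sigma> w (?S v) u = - (of_int e * (of_int e + 1)) * wip \<sigma> w v u"
    unfolding wip_scale(1)[symmetric]
    by (rule wip_cong[OF _ refl]) (use sphere_laplacian[OF open_punctured _ v] in simp)
  have su: "wip \<sigma> w (?S u) v = wip \<sigma> w (rot_deriv 1 2 (rot_deriv 1 2 u)) v
      + wip \<sigma> w (rot_deriv 1 3 (rot_deriv 1 3 u)) v + wip \<sigma> w (rot_deriv 2 3 (rot_deriv 2 3 u)) v"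
    by (simp add: wip_add[OF _ _ _ _ _ _ ad] continuous_on_add homogeneous_on_add c0 c2 h h2)
  have sv: "wip \<sigma> w (?S v) u = wip \<sigma> w (rot_deriv 1 2 (rot_deriv 1 2 v)) u
      + wip \<sigma> w (rot_deriv 1 3 (rot_deriv 1 3 v)) u + wip \<sigma> w (rot_deriv 2 3 (rot_deriv 2 3 v)) u"
    by (simp add: wip_add[OF _ _ _ _ _ _ ad'] continuous_on_add homogeneous_on_add c0 c2 h h2)
  have "wip \<sigma> w (?S u) v = wip \<sigma> w (?S v) u"
    unfolding su sv by (simp add: swap)
  then have "of_int d * (of_int d + 1) * wip \<sigma> w u v = of_int e * (of_int e + 1) * wip \<sigma> w u v"
    unfolding eu ev wip_commute[of \<sigma> w v u] by simp
  then have "of_int (d * (d + 1)) * wip \<sigma> w u v = of_int (e * (e + 1)) * wip \<sigma> w u v"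
    by simp
  then show ?thesis
    using ne by (metis mult_cancel_right of_int_eq_iff)
qed

section \<open>Completeness of the solid harmonics\<close>

text \<open>Functions whose restrictions to the unit sphere lie in the span of all \<open>U\<close>.\<close>

inductive spherical :: "(real ^ 3 \<Rightarrow> real) \<Rightarrow> bool" where
  U: "spherical (U n m s)"
| add: "spherical p \<Longrightarrow> spherical q \<Longrightarrow> spherical (\<lambda>x. p x + q x)"
| scale: "spherical p \<Longrightarrow> spherical (\<lambda>x. c * p x)"
| cong: "spherical p \<Longrightarrow> (\<And>x. norm x = 1 \<Longrightarrow> p x = q x) \<Longrightarrow> spherical q"

lemma legendre_index_reflect: "legendre_index (- n - 1) = legendre_index n"
  by (auto simp: legendre_index_def)

lemma U_eq_norm_powi:
  assumes "x \<noteq> 0" "legendre_index n = legendre_index n'"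
  shows "U n m s x = norm x powi (n - n') * U n' m s x"
proof -
  have "norm x powi n = norm x powi (n - n') * norm x powi n'"
    using assms(1) by (simp flip: power_int_add)
  then show ?thesis
    using assms(2) by (simp add: U_def legendre_assoc_def Let_def legendre_index_def)
qed

lemma unit_nonzero: "norm x = 1 \<Longrightarrow> x \<noteq> (0 :: real ^ 3)"
  by auto

lemma spherical_partial_U: "spherical (partial i (U n m s))"
proof -
  consider "i = 1" | "i = 2" | "i = 3" using exhaust_3[of i] by auto
  then show ?thesis
  proof cases
    case 1
    show ?thesis
      by (rule spherical.cong[OF spherical.scale[OF spherical.U, of "of_int n + real m" "n - 1" m s]])
         (simp add: 1 partial_1_U[OF unit_nonzero])
  next
    case 2
    show ?thesis
    proof (cases m)
      case 0
      show ?thesis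
        by (rule spherical.cong[OF spherical.scale[OF spherical.U, of "if s = Plus then 1 else 0" "n - 1" 1 Plus]])
           (simp add: 2 0 partial_2_U_0[OF unit_nonzero])
    next
      case (Suc j)
      show ?thesis
        by (rule spherical.cong[OF spherical.add[OF spherical.scale[OF spherical.U]
              spherical.scale[OF spherical.U]], of "1 / 2" "n - 1" "Suc (Suc j)" s
              "- ((of_int n + real j + 1) * (of_int n + real j)) / 2" "n - 1" j s])
           (simp add: 2 Suc partial_2_U_Suc[OF unit_nonzero] field_simps)
    qed
  next
    case 3
    show ?thesis
    proof (cases m)
      case 0
      show ?thesis
        by (rule spherical.cong[OF spherical.scale[OF spherical.U, of "if s = Plus then 1 else 0" "n - 1" 1 Minus]])
           (simp add: 3 0 partial_3_U_0[OF unit_nonzero])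
    next
      case (Suc j)
      show ?thesis
        by (rule spherical.cong[OF spherical.add[OF spherical.scale[OF spherical.U]
              spherical.scale[OF spherical.U]], of "pm s / 2" "n - 1" "Suc (Suc j)" "flip s"
              "pm s * ((of_int n + real j + 1) * (of_int n + real j)) / 2" "n - 1" j "flip s"])
           (simp add: 3 Suc partial_3_U_Suc[OF unit_nonzero] field_simps)
    qed
  qed
qed

text \<open>On the sphere \<open>U\<^sub>n\<close> and its Kelvin transform \<open>U\<^sub>-\<^sub>n\<^sub>-\<^sub>1\<close> agree, but their derivatives differ by
  \<open>(2n + 1) x\<^sub>i U\<^sub>n\<close>. As both derivatives are again spherical, so is the product with a coordinate.\<close>

lemma spherical_mult_coordinate: "spherical p \<Longrightarrow> spherical (\<lambda>x. x$i * p x)"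
proof (induction rule: spherical.induct)
  case (U n m s)
  have eq: "(of_int (2 * n + 1)) * (x$i * U n m s x) = partial i (U n m s) x - partial i (U (- n - 1) m s) x"
    if "norm x = 1" for x
  proof -
    have x: "x \<noteq> 0" using that by auto
    have "partial i (U (- n - 1) m s) x = partial i (\<lambda>x. norm x powi (- n - 1 - n) * U n m s x) x"
      by (intro partial_cong_open[of "- {0}"] U_eq_norm_powi)
         (use x in \<open>auto simp: legendre_index_reflect\<close>)
    also have "\<dots> = partial i (U n m s) x + of_int (- n - 1 - n) * (x$i * U n m s x)"
      using x U_differentiable[OF x, of n m s] norm_powi_has_derivative[OF x, THEN differentiableI]
      by (simp add: partial_mult partial_norm_powi that)
    finally show ?thesis by (simp add: algebra_simps)
  qed
  have "odd (2 * n + 1)" by simp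
  then have nz: "of_int (2 * n + 1) \<noteq> (0 :: real)"
    by (metis even_zero of_int_eq_0_iff)
  show ?case
    by (rule spherical.cong[OF spherical.scale[OF spherical.add[OF spherical_partial_U
          spherical.scale[OF spherical_partial_U]]], of "1 / of_int (2 * n + 1)" i n m s "-1" i "- n - 1" m s])
       (use eq nz in \<open>simp add: field_simps\<close>)
next
  case (add p q)
  then show ?case using spherical.add by (fastforce simp: distrib_left)
next
  case (scale p c)
  then show ?case using spherical.scale[of "\<lambda>x. x$i * p x" c] by (simp add: mult.left_commute)
next
  case (cong p q)
  show ?case by (rule spherical.cong[OF cong.IH]) (use cong in simp)
qed

lemma spherical_sum:
  assumes "spherical (\<lambda>x. 0)" "\<And>i. i \<in> I \<Longrightarrow> spherical (f i)"
  shows "spherical (\<lambda>x. \<Sum>i\<in>I. f i x)"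
  using assms(2) by (induction I rule: infinite_finite_induct) (simp_all add: assms(1) spherical.add)

lemma spherical_mult_polynomial:
  "real_polynomial_function q \<Longrightarrow> spherical p \<Longrightarrow> spherical (\<lambda>x. q x * p x)"
proof (induction arbitrary: p rule: real_polynomial_function.induct)
  case (linear f)
  have fx: "f x = (\<Sum>i\<in>UNIV. x$i * f (axis i 1))" for x
  proof -
    have lin: "linear f"
      using linear.hyps by (rule bounded_linear.linear)
    have "x = (\<Sum>i\<in>UNIV. x$i *\<^sub>R axis i 1)"
      by (metis basis_expansion scalar_mult_eq_scaleR)
    then have "f x = f (\<Sum>i\<in>UNIV. x$i *\<^sub>R axis i 1)"
      by (rule arg_cong)
    also have "\<dots> = (\<Sum>i\<in>UNIV. f (x$i *\<^sub>R axis i 1))"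
      by (rule linear_sum[OF lin])
    also have "\<dots> = (\<Sum>i\<in>UNIV. x$i * f (axis i 1))"
      by (simp only: linear_scale[OF lin] real_scaleR_def)
    finally show ?thesis .
  qed
  have eq: "f x * p x = (\<Sum>i\<in>UNIV. f (axis i 1) * (x$i * p x))" for x
    by (subst fx) (simp add: sum_distrib_left sum_distrib_right mult_ac)
  show ?case
    unfolding eq
    using spherical.scale[OF linear.prems, of 0]
    by (intro spherical_sum spherical.scale spherical_mult_coordinate linear) simp
next
  case (const c)
  then show ?case by (rule spherical.scale)
next
  case (add f g)
  then show ?case using spherical.add[OF add.IH(1)[OF add.prems] add.IH(2)[OF add.prems]]
    by (simp add: distrib_right)
next
  case (mult f g)
  then show ?case using mult.IH(1)[OF mult.IH(2)[OF mult.prems]] by (simp add: mult.assoc)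
qed

lemma U_0_0: "x \<noteq> 0 \<Longrightarrow> U 0 0 Plus x = 1"
  by (simp add: U_cartesian LP_def legendre_index_def legendre_def)

lemma spherical_polynomial:
  assumes "real_polynomial_function q"
  shows "spherical q"
  by (rule spherical.cong[OF spherical_mult_polynomial[OF assms spherical.U[of 0 0 Plus]]])
     (simp add: U_0_0[OF unit_nonzero])

lemma continuous_on_direction:
  assumes "continuous_on (sphere 0 1) p"
  shows "continuous_on (punctured \<sigma>) (\<lambda>x. p (x /\<^sub>R norm x))"
  by (rule continuous_on_compose2[OF assms])
     (auto intro!: continuous_intros dest: punctured_nonzero)

lemma homogeneous_direction: "homogeneous_on S 0 (\<lambda>x. p (x /\<^sub>R norm x) :: real)"
proof -
  have "(t *\<^sub>R x) /\<^sub>R norm (t *\<^sub>R x) = x /\<^sub>R norm x" if "t > 0" for t and x :: "real ^ 3"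
    using that by (simp add: divide_simps)
  note * = this
  show ?thesis
    unfolding homogeneous_on_def
    by (intro ballI allI impI) (simp only: * power_int_0_right scaleR_one)
qed

lemma Ck_on_imp_continuous: "Ck_on k S f \<Longrightarrow> continuous_on S f"
proof (induction k)
  case (Suc k)
  then show ?case using Ck_on_SucD by blast
qed simp

lemma hharm_regular:
  assumes "hharm S d u"
  shows "continuous_on S u" and "homogeneous_on S d u"
  using assms Ck_on_imp_continuous by (auto simp: hharm_def harmonic_on_def)

text \<open>If \<open>U\<^sub>n\<close> has another eigenvalue than \<open>u\<close>, it is orthogonal to \<open>u\<close> anyway; if it has the same one,
  then \<open>n\<close> is \<open>d\<close> or \<open>-d - 1\<close>, and \<open>U\<^sub>n\<close> agrees with \<open>U\<^sub>d\<close> on the sphere. Dividing the argument by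
  its norm makes \<open>p\<close> homogeneous of degree \<open>0\<close>, which the shift of the weight by \<open>d\<close> compensates.\<close>

lemma spherical_orthogonal:
  assumes u: "hharm (punctured \<sigma>) d u" and ad: "admissible \<sigma> (w + d + d)"
    and orth: "\<And>m s. wip \<sigma> w u (U d m s) = 0"
    and "spherical p"
  shows "continuous_on (sphere 0 1) p \<and> wip \<sigma> (w + d) u (\<lambda>x. p (x /\<^sub>R norm x)) = 0"
  using assms(4)
proof (induction rule: spherical.induct)
  have c: "continuous_on (punctured \<sigma>) u" and h: "homogeneous_on (punctured \<sigma>) d u"
    using hharm_regular[OF u] by auto
  have ad': "admissible \<sigma> (w + d + 0 + d)" using ad by simp
  {
    case (U n m s)
    have "continuous_on (- {0}) (U n m s)"
      by (intro elementary_continuous elementary_U) auto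
    then have "continuous_on (sphere 0 1) (U n m s)"
      by (rule continuous_on_subset) auto
    moreover have "wip \<sigma> (w + d) u (\<lambda>x. U n m s (x /\<^sub>R norm x)) = 0"
    proof -
      have dir: "U n m s (x /\<^sub>R norm x) = norm x powi (- n) * U n m s x" if "x \<in> punctured \<sigma>" for x
        using homogeneous_onD[OF homogeneous_U, of x UNIV "inverse (norm x)" n m s] punctured_nonzero[OF that]
        by (simp add: power_int_inverse power_int_minus)
      have *: "wip \<sigma> (w + d) u (\<lambda>x. U n m s (x /\<^sub>R norm x)) = wip \<sigma> (w + d - n) u (U n m s)"
        unfolding wip_def
      proof (rule Bochner_Integration.integral_cong[OF refl])
        fix x assume "x \<in> space (lebesgue_on (punctured \<sigma>))"
        then have x: "x \<in> punctured \<sigma>" "x \<noteq> 0" by auto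
        have "norm x powi (w + d - n) = norm x powi (w + d) * norm x powi (- n)"
          using x(2) by (simp flip: power_int_add)
        then show "norm x powi (w + d) * (u x * U n m s (x /\<^sub>R norm x))
            = norm x powi (w + d - n) * (u x * U n m s x)"
          unfolding dir[OF x(1)] by simp
      qed
      show ?thesis
      proof (cases "d * (d + 1) = n * (n + 1)")
        case False
        have "wip \<sigma> (w + d - n) u (U n m s) = 0"
          by (rule wip_eigenvalue_orthogonal[OF u hharm_U[OF open_punctured] _ False]) (use ad in simp_all)
        then show ?thesis using * by simp
      next
        case True
        then have "(d - n) * (d + n + 1) = 0" by (simp add: algebra_simps)
        then have "d = n \<or> n = - d - 1" by auto
        then have ix: "legendre_index n = legendre_index d"
          using legendre_index_reflect[of d] by auto
        have "wip \<sigma> (w + d - n) u (U n m s) = wip \<sigma> w u (U d m s)"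
          unfolding wip_def
        proof (rule Bochner_Integration.integral_cong[OF refl])
          fix x assume "x \<in> space (lebesgue_on (punctured \<sigma>))"
          then have x: "x \<in> punctured \<sigma>" "x \<noteq> 0" by auto
          have "norm x powi (w + d - n) * norm x powi (n - d) = norm x powi w"
            using x(2) by (simp flip: power_int_add)
          then show "norm x powi (w + d - n) * (u x * U n m s x) = norm x powi w * (u x * U d m s x)"
            unfolding U_eq_norm_powi[OF x(2) ix] by (simp add: mult_ac)
        qed
        then show ?thesis using * orth by simp
      qed
    qed
    ultimately show ?case by blast
  next
    case (add p q)
    then have "wip \<sigma> (w + d) (\<lambda>x. p (x /\<^sub>R norm x) + q (x /\<^sub>R norm x)) u
        = wip \<sigma> (w + d) (\<lambda>x. p (x /\<^sub>R norm x)) u + wip \<sigma> (w + d) (\<lambda>x. q (x /\<^sub>R norm x)) u"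
      by (intro wip_add[OF _ _ _ _ _ _ ad'] continuous_on_direction homogeneous_direction c h) auto
    then show ?case
      using add by (simp add: wip_commute[of _ _ u] continuous_on_add)
  next
    case (scale p c)
    then show ?case by (simp add: wip_scale continuous_on_mult_left)
  next
    case (cong p q)
    have "continuous_on (sphere 0 1) q"
      by (rule continuous_on_eq[of _ p]) (use cong in auto)
    moreover have "wip \<sigma> (w + d) u (\<lambda>x. p (x /\<^sub>R norm x)) = wip \<sigma> (w + d) u (\<lambda>x. q (x /\<^sub>R norm x))"
      by (rule wip_cong[OF refl]) (use cong punctured_nonzero in auto)
    ultimately show ?case using cong by simp
  }
qed

text \<open>Let \<open>v\<close> be \<open>u\<close> on a sphere inside the region, moved to the unit sphere. Uniform approximation of \<open>v\<close>
  by polynomials, to all of which \<open>u\<close> is orthogonal, shows that \<open>u\<close> is orthogonal to \<open>v\<close> extended by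
  degree \<open>0\<close>. Up to the radial factor this is the norm of \<open>u\<close>.\<close>

lemma hharm_orthogonal_eq_0:
  assumes u: "hharm (punctured \<sigma>) d u" and ad: "admissible \<sigma> (w + d + d)"
    and orth: "\<And>m s. wip \<sigma> w u (U d m s) = 0" and x: "x \<in> punctured \<sigma>"
  shows "u x = 0"
proof -
  let ?P = "punctured \<sigma>"
  have c: "continuous_on ?P u" and h: "homogeneous_on ?P d u"
    using hharm_regular[OF u] by auto
  define r where "r = ref_radius \<sigma>"
  have r: "r > 0" "\<And>x. norm x = r \<Longrightarrow> x \<in> ?P"
    using ref_radius(1)[of \<sigma>] ref_radius(2)[of _ \<sigma>] by (auto simp: r_def)
  define v where "v y = u (r *\<^sub>R y)" for y
  have v: "continuous_on (sphere 0 1) v"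
    unfolding v_def by (rule continuous_on_compose2[OF c]) (use r in \<open>auto intro!: continuous_intros\<close>)
  have ad': "admissible \<sigma> (w + d + d + 0)" "admissible \<sigma> (w + d + 0 + d)" using ad by simp_all
  have uv: "norm x powi d * v (x /\<^sub>R norm x) = r powi d * u x" if x: "x \<in> ?P" for x
  proof -
    have n: "norm x > 0" using punctured_nonzero[OF x] by simp
    have "v (x /\<^sub>R norm x) = u ((r / norm x) *\<^sub>R x)"
      by (simp add: v_def divide_inverse)
    also have "\<dots> = (r / norm x) powi d * u x"
      using homogeneous_onD[OF h x, of "r / norm x"] n r by simp
    finally show ?thesis
      using n by (simp add: power_int_divide_distrib)
  qed
  define I where "I = lint \<sigma> (\<lambda>x. norm x powi (w + d) * (\<bar>u x\<bar> * 1))"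
  have int_abs: "integrable (lebesgue_on ?P) (\<lambda>x. norm x powi (w + d) * (\<bar>u x\<bar> * 1))"
    by (rule integrable_wip[OF _ _ _ _ ad'(1)])
       (use c h in \<open>auto intro!: continuous_intros simp: homogeneous_on_def abs_mult power_int_abs\<close>)
  have "\<bar>wip \<sigma> (w + d) u (\<lambda>x. v (x /\<^sub>R norm x))\<bar> \<le> e * I" if e: "e > 0" for e
  proof -
    obtain p where p: "real_polynomial_function p" "\<And>y. y \<in> sphere 0 1 \<Longrightarrow> \<bar>v y - p y\<bar> < e"
      using Stone_Weierstrass_real_polynomial_function[OF compact_sphere v e] by blast
    have so: "continuous_on (sphere 0 1) p" "wip \<sigma> (w + d) u (\<lambda>x. p (x /\<^sub>R norm x)) = 0"
      using spherical_orthogonal[OF u ad orth spherical_polynomial[OF p(1)]] by blast+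
    have vi: "integrable (lebesgue_on ?P) (\<lambda>x. norm x powi (w + d) * (u x * q (x /\<^sub>R norm x)))"
      if "continuous_on (sphere 0 1) q" for q
      by (intro integrable_wip[OF _ _ _ _ ad'(1)] continuous_on_direction homogeneous_direction c h that)
    have "wip \<sigma> (w + d) u (\<lambda>x. v (x /\<^sub>R norm x))
        = lint \<sigma> (\<lambda>x. norm x powi (w + d) * (u x * v (x /\<^sub>R norm x)) - norm x powi (w + d) * (u x * p (x /\<^sub>R norm x)))"
      using so(2) unfolding wip_def
      by (subst Bochner_Integration.integral_diff[OF vi[OF v] vi[OF so(1)]]) simp
    also have "\<bar>\<dots>\<bar> \<le> lint \<sigma> (\<lambda>x. e * (norm x powi (w + d) * (\<bar>u x\<bar> * 1)))"
    proof (rule integral_abs_bound_integral)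
      show "integrable (lebesgue_on ?P) (\<lambda>x. norm x powi (w + d) * (u x * v (x /\<^sub>R norm x)) - norm x powi (w + d) * (u x * p (x /\<^sub>R norm x)))"
        by (intro Bochner_Integration.integrable_diff vi v so)
      show "integrable (lebesgue_on ?P) (\<lambda>x. e * (norm x powi (w + d) * (\<bar>u x\<bar> * 1)))"
        using int_abs by simp
      fix x assume "x \<in> space (lebesgue_on ?P)"
      then have "x \<noteq> 0" by auto
      then have "\<bar>v (x /\<^sub>R norm x) - p (x /\<^sub>R norm x)\<bar> \<le> e"
        using p(2)[of "x /\<^sub>R norm x"] by simp
      then have "norm x powi (w + d) * \<bar>u x\<bar> * \<bar>v (x /\<^sub>R norm x) - p (x /\<^sub>R norm x)\<bar>
          \<le> norm x powi (w + d) * \<bar>u x\<bar> * e"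
        by (intro mult_left_mono) auto
      moreover have "\<bar>norm x powi (w + d) * (u x * v (x /\<^sub>R norm x)) - norm x powi (w + d) * (u x * p (x /\<^sub>R norm x))\<bar>
          = norm x powi (w + d) * \<bar>u x\<bar> * \<bar>v (x /\<^sub>R norm x) - p (x /\<^sub>R norm x)\<bar>"
        by (simp add: abs_mult power_int_abs flip: right_diff_distrib)
      ultimately show "\<bar>norm x powi (w + d) * (u x * v (x /\<^sub>R norm x)) - norm x powi (w + d) * (u x * p (x /\<^sub>R norm x))\<bar>
          \<le> e * (norm x powi (w + d) * (\<bar>u x\<bar> * 1))"
        by (simp add: mult_ac)
    qed
    finally show ?thesis by (simp add: I_def)
  qed
  then have small: "\<bar>wip \<sigma> (w + d) u (\<lambda>x. v (x /\<^sub>R norm x))\<bar> \<le> e" if "e > 0" for e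
  proof -
    have "\<bar>wip \<sigma> (w + d) u (\<lambda>x. v (x /\<^sub>R norm x))\<bar> \<le> e / (\<bar>I\<bar> + 1) * I"
      using \<open>\<And>e. e > 0 \<Longrightarrow> _\<close>[of "e / (\<bar>I\<bar> + 1)"] that by simp
    also have "\<dots> \<le> e / (\<bar>I\<bar> + 1) * (\<bar>I\<bar> + 1)"
      using that by (intro mult_left_mono) auto
    also have "\<dots> = e" by (simp add: add_nonneg_eq_0_iff)
    finally show ?thesis .
  qed
  have "wip \<sigma> (w + d) u (\<lambda>x. v (x /\<^sub>R norm x)) = 0"
  proof (rule ccontr)
    assume "wip \<sigma> (w + d) u (\<lambda>x. v (x /\<^sub>R norm x)) \<noteq> 0"
    then show False
      using small[of "\<bar>wip \<sigma> (w + d) u (\<lambda>x. v (x /\<^sub>R norm x))\<bar> / 2"] by simp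
  qed
  moreover have "wip \<sigma> (w + d) u (\<lambda>x. v (x /\<^sub>R norm x)) = lint \<sigma> (\<lambda>x. r powi d * (norm x powi w * (u x * u x)))"
    unfolding wip_def
  proof (rule Bochner_Integration.integral_cong[OF refl])
    fix x assume "x \<in> space (lebesgue_on ?P)"
    then have x: "x \<in> ?P" "x \<noteq> 0" by auto
    have "norm x powi (w + d) * (u x * v (x /\<^sub>R norm x)) = norm x powi w * u x * (norm x powi d * v (x /\<^sub>R norm x))"
      using x(2) by (simp add: power_int_add mult_ac)
    then show "norm x powi (w + d) * (u x * v (x /\<^sub>R norm x)) = r powi d * (norm x powi w * (u x * u x))"
      unfolding uv[OF x(1)] by (simp add: mult_ac)
  qed
  ultimately have "lint \<sigma> (\<lambda>x. norm x powi w * (u x * u x)) = 0"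
    using r by simp
  then have "norm x powi w * (u x * u x) = 0"
    using x c h ad
    by (intro lint_eq_0D[of \<sigma> "\<lambda>x. norm x powi w * (u x * u x)"] integrable_wip[of _ _ _ d d])
       (auto intro!: continuous_on_mult continuous_norm_powi)
  then show ?thesis
    using punctured_nonzero[OF x] by simp
qed

definition modes :: "int \<Rightarrow> (nat \<times> sgn_pm) set" where
  "modes n = {..legendre_index n} \<times> {Plus, Minus}"

lemma finite_modes [simp]: "finite (modes n)"
  by (simp add: modes_def)

text \<open>The difference of \<open>u\<close> and its orthogonal projection vanishes by the preceding lemma. A harmonic
  function of degree \<open>n + 1 = -1\<close> on the exterior is not square integrable, hence a weight there.\<close>

theorem hharm_expansion:
  assumes u: "hharm (punctured \<sigma>) d u" and d: "\<sigma> = Inner \<Longrightarrow> d \<ge> 0" "\<sigma> = Outer \<Longrightarrow> d \<le> -1"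
  obtains c where "\<And>x. x \<in> punctured \<sigma> \<Longrightarrow> u x = (\<Sum>(m, s)\<in>modes d. c m s * U d m s x)"
proof -
  let ?P = "punctured \<sigma>"
  define w :: int where "w = (if \<sigma> = Outer then -2 else 0)"
  have ad: "admissible \<sigma> (w + d + d)"
    using d by (cases \<sigma>) (auto simp: w_def admissible_def)
  define c where "c m s = wip \<sigma> w u (U d m s) / wip \<sigma> w (U d m s) (U d m s)" for m s
  define b where "b m s = - c m s" for m s
  define v where "v x = u x + (\<Sum>(m, s)\<in>modes d. b m s * U d m s x)" for x
  \<comment> \<open>If \<open>U d m s\<close> vanishes, its coefficient is \<open>0 / 0 = 0\<close>.\<close>
  have hv: "hharm ?P d (\<lambda>x. b (fst i) (snd i) * U d (fst i) (snd i) x)" for i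
    by (intro hharm_scale hharm_U open_punctured) simp
  have hS: "hharm ?P d (\<lambda>x. \<Sum>(m, s)\<in>F. b m s * U d m s x)" for F
    unfolding split_beta by (intro hharm_sum open_punctured hv)
  have reg: "continuous_on ?P f \<and> homogeneous_on ?P d f" if "hharm ?P d f" for f
    using hharm_regular[OF that] by auto
  have add: "wip \<sigma> w (\<lambda>x. f x + g x) (U d m s) = wip \<sigma> w f (U d m s) + wip \<sigma> w g (U d m s)"
    if "hharm ?P d f" "hharm ?P d g" for f g m s
    using reg[OF that(1)] reg[OF that(2)] by (intro wip_add[OF _ _ _ _ _ _ ad] U_regular) auto
  have sum: "wip \<sigma> w (\<lambda>x. \<Sum>(m, s)\<in>F. b m s * U d m s x) (U d m' s')
      = (\<Sum>(m, s)\<in>F. b m s * wip \<sigma> w (U d m s) (U d m' s'))" if "finite F" for F m' s'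
    using that
  proof (induction F)
    case empty
    then show ?case by (simp add: wip_def)
  next
    case (insert i F)
    then show ?case
      using add[OF hv hS, of i F m' s'] by (simp add: split_beta wip_scale)
  qed
  have "wip \<sigma> w v (U d m s) = 0" for m s
  proof (cases "(m, s) \<in> modes d")
    case True
    have "(\<Sum>(m', s')\<in>modes d. b m' s' * wip \<sigma> w (U d m' s') (U d m s))
      = (\<Sum>i\<in>modes d. if i = (m, s) then b m s * wip \<sigma> w (U d m s) (U d m s) else 0)"
    proof (rule sum.cong[OF refl])
      fix i assume "i \<in> modes d"
      show "(case i of (m', s') \<Rightarrow> b m' s' * wip \<sigma> w (U d m' s') (U d m s))
          = (if i = (m, s) then b m s * wip \<sigma> w (U d m s) (U d m s) else 0)"
        using wip_U_orthogonal[OF ad, of "fst i" "snd i" m s]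
        by (cases "i = (m, s)") (auto simp: split_beta prod_eq_iff)
    qed
    also have "\<dots> = b m s * wip \<sigma> w (U d m s) (U d m s)"
      using True by simp
    also have "\<dots> = - wip \<sigma> w u (U d m s)"
    proof (cases "wip \<sigma> w (U d m s) (U d m s) = 0")
      case True
      have "U d m s x = 0" if "x \<in> ?P" for x
      proof -
        have "norm x powi w * (U d m s x * U d m s x) = 0"
          using True[unfolded wip_def] that
          by (intro lint_eq_0D[of \<sigma> "\<lambda>x. norm x powi w * (U d m s x * U d m s x)"]
              integrable_wip[OF _ _ _ _ ad])
             (auto intro!: continuous_on_mult continuous_norm_powi U_regular)
        then show ?thesis using punctured_nonzero[OF that] by simp
      qed
      then have "wip \<sigma> w u (U d m s) = wip \<sigma> w u (\<lambda>x. 0 * u x)"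
        by (intro wip_cong) auto
      then show ?thesis using True unfolding wip_scale by simp
    qed (simp add: b_def c_def)
    finally show ?thesis
      unfolding v_def using add[OF u hS] sum[OF finite_modes] by simp
  next
    case False
    then have "m > legendre_index d"
      by (cases s) (auto simp: modes_def)
    then have "wip \<sigma> w v (U d m s) = wip \<sigma> w v (\<lambda>x. 0 * v x)"
      by (intro wip_cong) (auto simp: U_eq_0)
    then show ?thesis unfolding wip_scale by simp
  qed
  moreover have "hharm ?P d v"
    unfolding v_def by (intro hharm_add open_punctured u hS)
  ultimately have "v x = 0" if "x \<in> ?P" for x
    using hharm_orthogonal_eq_0[OF _ ad _ that] by blast
  then have "u x = (\<Sum>(m, s)\<in>modes d. c m s * U d m s x)" if "x \<in> ?P" for x
    using that by (simp add: v_def b_def split_beta sum_negf)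
  then show thesis by (rule that)
qed

section \<open>The function spaces\<close>

text \<open>An element of the complement of \<open>K\<close>, less its projection to the span of the \<open>b i\<close>, is orthogonal to
  a spanning set of \<open>V\<close>, hence to itself.\<close>

lemma orthogonal_complement_basis:
  fixes V :: "'a::real_vector set" and B :: "'a \<Rightarrow> 'a \<Rightarrow> real" and b :: "'i \<Rightarrow> 'a"
  assumes V: "subspace V"
    and add: "\<And>x y z. x \<in> V \<Longrightarrow> y \<in> V \<Longrightarrow> z \<in> V \<Longrightarrow> B (x + y) z = B x z + B y z"
    and scale: "\<And>c x z. x \<in> V \<Longrightarrow> z \<in> V \<Longrightarrow> B (c *\<^sub>R x) z = c * B x z"
    and sym: "\<And>x y. x \<in> V \<Longrightarrow> y \<in> V \<Longrightarrow> B x y = B y x"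
    and definite: "\<And>x. x \<in> V \<Longrightarrow> B x x = 0 \<Longrightarrow> x = 0"
    and I: "finite I" "\<And>i. i \<in> I \<Longrightarrow> b i \<in> V" "\<And>i. i \<in> I \<Longrightarrow> b i \<noteq> 0"
    and orth: "\<And>i j. i \<in> I \<Longrightarrow> j \<in> I \<Longrightarrow> i \<noteq> j \<Longrightarrow> B (b i) (b j) = 0"
    and K: "K \<subseteq> V" "\<And>i k. i \<in> I \<Longrightarrow> k \<in> K \<Longrightarrow> B (b i) k = 0"
    and spans: "V \<subseteq> span (b ` I \<union> K)"
  shows "inj_on b I" and "independent (b ` I)"
    and "span (b ` I) = {x \<in> V. \<forall>k\<in>K. B x k = 0}"
proof -
  have nz: "B (b i) (b i) \<noteq> 0" if "i \<in> I" for i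
    using definite I that by blast
  show inj: "inj_on b I"
    using nz orth by (metis inj_onI)
  have sum_in: "(\<Sum>i\<in>J. f i) \<in> V" if "\<And>i. i \<in> J \<Longrightarrow> f i \<in> V" for J :: "'i set" and f
    by (rule subspace_sum[OF V that])
  have sumB: "B (\<Sum>i\<in>J. c i *\<^sub>R b i) z = (\<Sum>i\<in>J. c i * B (b i) z)"
    if "finite J" "J \<subseteq> I" "z \<in> V" for J c z
    using that
  proof (induction J rule: finite_induct)
    case empty
    have "B (0 *\<^sub>R z) z = 0 * B z z" by (rule scale) (use empty in auto)
    then show ?case by simp
  next
    case (insert i J)
    then have "c i *\<^sub>R b i \<in> V" "(\<Sum>i\<in>J. c i *\<^sub>R b i) \<in> V"
      using I(2) by (auto intro!: subspace_scale[OF V] sum_in)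
    then show ?case
      using insert I(2) by (simp add: add scale)
  qed
  show "independent (b ` I)"
  proof
    assume "dependent (b ` I)"
    then obtain u v where u: "v \<in> b ` I" "u v \<noteq> 0" "(\<Sum>v\<in>b ` I. u v *\<^sub>R v) = 0"
      using dependent_finite[of "b ` I"] I(1) by auto
    then obtain j where j: "j \<in> I" "v = b j" by auto
    have "0 = B (\<Sum>i\<in>I. u (b i) *\<^sub>R b i) (b j)"
      using u(3) scale[of "b j" "b j" 0] I(2) j by (simp add: sum.reindex[OF inj] o_def)
    also have "\<dots> = (\<Sum>i\<in>I. u (b i) * B (b i) (b j))"
      by (rule sumB) (use I j in auto)
    also have "\<dots> = (\<Sum>i\<in>I. if i = j then u v * B (b j) (b j) else 0)"
      by (rule sum.cong) (use orth j in auto)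
    finally show False
      using u j nz I(1) by simp
  qed
  show "span (b ` I) = {x \<in> V. \<forall>k\<in>K. B x k = 0}"
  proof (intro subset_antisym subsetI)
    fix x assume "x \<in> span (b ` I)"
    then obtain u where x: "x = (\<Sum>v\<in>b ` I. u v *\<^sub>R v)"
      using span_finite[of "b ` I"] I(1) by auto
    then have x: "x = (\<Sum>i\<in>I. u (b i) *\<^sub>R b i)"
      by (simp add: sum.reindex[OF inj])
    have "x \<in> V"
      unfolding x by (intro sum_in subspace_scale[OF V] I)
    moreover have "B x k = 0" if "k \<in> K" for k
      unfolding x using that K I by (subst sumB) auto
    ultimately show "x \<in> {x \<in> V. \<forall>k\<in>K. B x k = 0}" by blast
  next
    fix x assume x: "x \<in> {x \<in> V. \<forall>k\<in>K. B x k = 0}"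
    define p where "p = (\<Sum>i\<in>I. (B x (b i) / B (b i) (b i)) *\<^sub>R b i)"
    define y where "y = x + (-1) *\<^sub>R p"
    have p: "p \<in> V"
      unfolding p_def by (intro sum_in subspace_scale[OF V] I)
    have p_span: "p \<in> span (b ` I)"
      unfolding p_def by (intro span_sum span_scale span_base imageI)
    have y: "y \<in> V"
      unfolding y_def using x p by (intro subspace_add[OF V] subspace_scale[OF V]) auto
    have By: "B y z = B x z - B p z" if "z \<in> V" for z
    proof -
      have "x \<in> V" "(-1) *\<^sub>R p \<in> V"
        using x p subspace_scale[OF V] by blast+
      then show ?thesis
        using add[of x "(-1) *\<^sub>R p" z] scale[OF p that, of "-1"] that unfolding y_def by simp
    qed
    have "B y (b j) = 0" if j: "j \<in> I" for j
    proof -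
      have "B p (b j) = (\<Sum>i\<in>I. B x (b i) / B (b i) (b i) * B (b i) (b j))"
        unfolding p_def by (rule sumB) (use I j in auto)
      also have "\<dots> = (\<Sum>i\<in>I. if i = j then B x (b j) else 0)"
        by (rule sum.cong) (use orth j nz in auto)
      finally show ?thesis using By I j by simp
    qed
    moreover have "B y k = 0" if "k \<in> K" for k
    proof -
      have "B p k = 0"
        unfolding p_def using that K I by (subst sumB) auto
      then show ?thesis using By[of k] x that K by auto
    qed
    moreover have "subspace {z \<in> V. B y z = 0}"
    proof (rule subspaceI)
      have "B (0 *\<^sub>R y) y = 0 * B y y" by (rule scale) (use y in auto)
      then show "0 \<in> {z \<in> V. B y z = 0}"
        using sym[of y 0] y subspace_0[OF V] by simp
      show "u + v \<in> {z \<in> V. B y z = 0}" if "u \<in> {z \<in> V. B y z = 0}" "v \<in> {z \<in> V. B y z = 0}" for u v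
        using that y add[of u v y] sym subspace_add[OF V] by auto
      show "c *\<^sub>R u \<in> {z \<in> V. B y z = 0}" if "u \<in> {z \<in> V. B y z = 0}" for c u
        using that y scale[of u y c] sym[of y] subspace_scale[OF V] by auto
    qed
    ultimately have "span (b ` I \<union> K) \<subseteq> {z \<in> V. B y z = 0}"
      using I K by (intro span_minimal) auto
    then have "B y y = 0" using spans y by auto
    then have "y = 0" using definite y by blast
    then show "x \<in> span (b ` I)" using p_span by (simp add: y_def)
  qed
qed

text \<open>The degrees of the theorem, at which continuous homogeneous functions are square integrable.\<close>

definition L2_degree :: "side \<Rightarrow> int \<Rightarrow> bool" where
  "L2_degree \<sigma> n \<longleftrightarrow> (case \<sigma> of Inner \<Rightarrow> n \<ge> 1 | Outer \<Rightarrow> n \<le> -2)"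

lemma admissible_L2_degree: "L2_degree \<sigma> n \<Longrightarrow> admissible \<sigma> (0 + n + n)"
  by (cases \<sigma>) (auto simp: L2_degree_def admissible_def)

lemma L2_degree_region: "L2_degree \<sigma> n \<Longrightarrow> 0 \<notin> region \<sigma> \<or> n \<ge> 1"
  by (cases \<sigma>) (auto simp: L2_degree_def)

lemma punctured_subset_region: "punctured \<sigma> \<subseteq> region \<sigma>"
  by (auto simp: punctured_def)

text \<open>The punctured region carries the integration theory because weights and solid harmonics of negative
  degree are singular at the origin.\<close>

lemma region_integral:
  assumes "continuous_on (region \<sigma>) h" "homogeneous_on (region \<sigma>) N h" "admissible \<sigma> N"
  shows "integrable (lebesgue_on (region \<sigma>)) h" "(LINT x|lebesgue_on (region \<sigma>). h x) = lint \<sigma> h"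
proof -
  have P: "integrable (lebesgue_on (punctured \<sigma>)) h"
    by (rule integrable_homogeneous[OF continuous_on_subset[OF assms(1) punctured_subset_region]
          homogeneous_on_subset[OF assms(2) punctured_subset_region] assms(3)])
  have neg: "negligible {x \<in> punctured \<sigma> - region \<sigma>. h x \<noteq> 0}"
    "negligible {x \<in> region \<sigma> - punctured \<sigma>. h x \<noteq> 0}"
    by (rule negligible_subset[of "{0}"]; force simp: punctured_def)+
  have "h absolutely_integrable_on punctured \<sigma>"
    using P by (simp add: set_integrable_def integrable_restrict_space)
  then have "h absolutely_integrable_on region \<sigma>"
    by (rule absolutely_integrable_spike_set[OF _ neg])
  then show R: "integrable (lebesgue_on (region \<sigma>)) h"
    by (simp add: set_integrable_def integrable_restrict_space)
  have "integral (region \<sigma>) h = integral (punctured \<sigma>) h"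
    by (rule integral_spike_set[OF neg(2,1)])
  then show "(LINT x|lebesgue_on (region \<sigma>). h x) = lint \<sigma> h"
    using lebesgue_integral_eq_integral[OF R] lebesgue_integral_eq_integral[OF P] by simp
qed

lemma homogeneous_vanishes_at_0:
  fixes f :: "real ^ 3 \<Rightarrow> 'b::real_vector"
  assumes "L2_degree \<sigma> n" "homogeneous_on (region \<sigma>) n f" "0 \<in> region \<sigma>"
  shows "f 0 = 0"
proof -
  have "n \<ge> 1" using L2_degree_region[OF assms(1)] assms(3) by blast
  then have "(2 :: real) powi n \<noteq> 1"
    using power_int_strict_increasing[of 0 n "2 :: real"] by simp
  moreover have "f 0 = (2 powi n) *\<^sub>R f 0"
    using homogeneous_onD[OF assms(2,3), of 2] assms(3) by simp
  ultimately show ?thesis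
    by (metis scaleR_one scaleR_right_imp_eq)
qed

lemma homogeneous_L2:
  fixes f :: "real ^ 3 \<Rightarrow> 'b::real_normed_vector"
  assumes "L2_degree \<sigma> n" "continuous_on (region \<sigma>) f" "homogeneous_on (region \<sigma>) n f"
  shows "L2_on (region \<sigma>) f"
proof -
  have "homogeneous_on (region \<sigma>) (n + n) (\<lambda>x. (norm (f x))\<^sup>2)"
  proof -
    have "(norm ((t powi n) *\<^sub>R y))\<^sup>2 = (t powi (n + n)) *\<^sub>R (norm y)\<^sup>2" if "t > 0" for t and y :: 'b
    proof -
      have "t powi (n + n) = t powi n * t powi n"
        using that by (intro power_int_add) auto
      then show ?thesis by (simp only: norm_scaleR) (simp add: power2_eq_square)
    qed
    then show ?thesis
      using assms(3) unfolding homogeneous_on_def by simp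
  qed
  then have "integrable (lebesgue_on (region \<sigma>)) (\<lambda>x. (norm (f x))\<^sup>2)"
    using admissible_L2_degree[OF assms(1)] by (intro region_integral continuous_intros assms(2)) auto
  then show ?thesis
    unfolding L2_on_def using continuous_imp_measurable_on_sets_lebesgue[OF assms(2)] by simp
qed

lemma harmonics_iff:
  assumes "L2_degree \<sigma> n"
  shows "u \<in> harmonics \<sigma> n \<longleftrightarrow> vanishes_outside (region \<sigma>) u \<and> hharm (region \<sigma>) n u"
  using homogeneous_L2[OF assms] hharm_regular by (auto simp: harmonics_def hharm_def)

lemma harmonics_add:
  assumes "L2_degree \<sigma> n" "u \<in> harmonics \<sigma> n" "v \<in> harmonics \<sigma> n"
  shows "(\<lambda>x. u x + v x) \<in> harmonics \<sigma> n"
  using assms hharm_add[OF open_region] by (auto simp: harmonics_iff vanishes_outside_def)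

lemma harmonics_scale:
  assumes "L2_degree \<sigma> n" "u \<in> harmonics \<sigma> n"
  shows "(\<lambda>x. c * u x) \<in> harmonics \<sigma> n"
  using assms hharm_scale[OF open_region] by (auto simp: harmonics_iff vanishes_outside_def)

lemma harmonics_zero: "L2_degree \<sigma> n \<Longrightarrow> (\<lambda>x. 0) \<in> harmonics \<sigma> n"
  by (simp add: harmonics_iff hharm_zero vanishes_outside_def)

lemma harmonics_U: "L2_degree \<sigma> n \<Longrightarrow> restr (region \<sigma>) (U n m s) \<in> harmonics \<sigma> n"
  using hharm_U[OF open_region L2_degree_region]
    hharm_cong[OF open_region, of \<sigma> "restr (region \<sigma>) (U n m s)" "U n m s"]
  by (auto simp: harmonics_iff vanishes_outside_def restr_def)

lemma subspace_harmonics3: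
  assumes "L2_degree \<sigma> n"
  shows "subspace (harmonics3 \<sigma> n)"
  by (rule subspaceI)
     (auto simp: harmonics3_def scaleR_fun_def reduced_quats_def harmonics_zero[OF assms]
       harmonics_add[OF assms] harmonics_scale[OF assms])

definition U_unit :: "side \<Rightarrow> int \<Rightarrow> 4 \<Rightarrow> nat \<Rightarrow> sgn_pm \<Rightarrow> real ^ 3 \<Rightarrow> quat" where
  "U_unit \<sigma> n i m s = (\<lambda>x. restr (region \<sigma>) (U n m s) x *\<^sub>R axis i 1)"

lemma U_unit_in_harmonics3:
  assumes "L2_degree \<sigma> n" "i \<noteq> 4"
  shows "U_unit \<sigma> n i m s \<in> harmonics3 \<sigma> n"
proof -
  have "(\<lambda>x. U_unit \<sigma> n i m s x $ j) \<in> harmonics \<sigma> n" for j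
    using harmonics_U[OF assms(1), of m s] harmonics_zero[OF assms(1)]
    by (cases "j = i") (simp_all add: U_unit_def axis_def)
  moreover have "U_unit \<sigma> n i m s x $ 4 = 0" for x
    using assms(2) by (simp add: U_unit_def axis_def)
  ultimately show ?thesis
    unfolding harmonics3_def reduced_quats_def by blast
qed

lemma harmonics_expansion:
  assumes "L2_degree \<sigma> n" "u \<in> harmonics \<sigma> n"
  obtains c where "\<And>x. u x = (\<Sum>(m, s)\<in>modes n. c m s * restr (region \<sigma>) (U n m s) x)"
proof -
  have u: "hharm (region \<sigma>) n u" "vanishes_outside (region \<sigma>) u"
    using assms by (simp_all add: harmonics_iff)
  have n: "\<sigma> = Inner \<Longrightarrow> n \<ge> 0" "\<sigma> = Outer \<Longrightarrow> n \<le> -1"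
    using assms(1) by (auto simp: L2_degree_def)
  obtain c where c: "\<And>x. x \<in> punctured \<sigma> \<Longrightarrow> u x = (\<Sum>(m, s)\<in>modes n. c m s * U n m s x)"
    using hharm_expansion[OF hharm_subset[OF u(1) punctured_subset_region] n] by blast
  have "u x = (\<Sum>(m, s)\<in>modes n. c m s * restr (region \<sigma>) (U n m s) x)" for x
  proof (cases "x \<in> region \<sigma>")
    case True
    then show ?thesis
    proof (cases "x = 0")
      case x: True
      then show ?thesis
        using True homogeneous_vanishes_at_0[OF assms(1) hharm_regular(2)[OF u(1)]]
          homogeneous_vanishes_at_0[OF assms(1) homogeneous_U] by (simp add: restr_def)
    next
      case False
      then show ?thesis using c[of x] True by (simp add: restr_def punctured_def)
    qed
  next
    case False
    then show ?thesis using u(2) by (simp add: restr_def vanishes_outside_def split_beta)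
  qed
  then show thesis by (rule that)
qed

lemma sum_fun_apply: "(\<Sum>i\<in>I. f i) x = (\<Sum>i\<in>I. f i x)" for f :: "'i \<Rightarrow> 'a \<Rightarrow> 'b::comm_monoid_add"
  by (induction I rule: infinite_finite_induct) simp_all

lemma harmonics3_span:
  assumes "L2_degree \<sigma> n"
  shows "harmonics3 \<sigma> n \<subseteq> span {U_unit \<sigma> n i m s | i m s. i \<noteq> 4 \<and> m \<le> legendre_index n}"
proof
  fix f assume f: "f \<in> harmonics3 \<sigma> n"
  have "\<forall>i. \<exists>c. i \<noteq> 4 \<longrightarrow>
      (\<forall>x. f x $ i = (\<Sum>(m, s)\<in>modes n. c m s * restr (region \<sigma>) (U n m s) x))"
  proof
    fix i :: 4
    show "\<exists>c. i \<noteq> 4 \<longrightarrow>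
        (\<forall>x. f x $ i = (\<Sum>(m, s)\<in>modes n. c m s * restr (region \<sigma>) (U n m s) x))"
    proof (cases "i = 4")
      case False
      then have "i = 1 \<or> i = 2 \<or> i = 3" using exhaust_4[of i] by auto
      then have "(\<lambda>x. f x $ i) \<in> harmonics \<sigma> n"
        using f by (auto simp: harmonics3_def)
      from harmonics_expansion[OF assms this] show ?thesis by blast
    qed simp
  qed
  from choice[OF this] obtain c where c: "\<And>i x. i \<noteq> 4 \<Longrightarrow>
      f x $ i = (\<Sum>(m, s)\<in>modes n. c i m s * restr (region \<sigma>) (U n m s) x)"
    by blast
  have "f = (\<Sum>i\<in>{1, 2, 3}. \<Sum>(m, s)\<in>modes n. c i m s *\<^sub>R U_unit \<sigma> n i m s)"
  proof
    fix x
    have g: "(\<Sum>i\<in>{1, 2, 3}. \<Sum>(m, s)\<in>modes n. c i m s *\<^sub>R U_unit \<sigma> n i m s) x $ j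
        = (\<Sum>i\<in>{1, 2, 3}. if i = j then (\<Sum>(m, s)\<in>modes n. c j m s * restr (region \<sigma>) (U n m s) x) else 0)"
      for j
      unfolding sum_fun_apply sum_component split_beta
      by (rule sum.cong) (auto simp: U_unit_def axis_def scaleR_fun_def)
    show "f x = (\<Sum>i\<in>{1, 2, 3}. \<Sum>(m, s)\<in>modes n. c i m s *\<^sub>R U_unit \<sigma> n i m s) x"
      unfolding vec_eq_iff g
    proof
      fix j :: 4
      have "f x $ 4 = 0" using f by (simp add: harmonics3_def reduced_quats_def)
      then show "f x $ j = (\<Sum>i\<in>{1, 2, 3}. if i = j then (\<Sum>(m, s)\<in>modes n. c j m s * restr (region \<sigma>) (U n m s) x) else 0)"
        using c[of j x] exhaust_4[of j] by auto
    qed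
  qed
  moreover have "(\<Sum>i\<in>{1, 2, 3}. \<Sum>(m, s)\<in>modes n. c i m s *\<^sub>R U_unit \<sigma> n i m s)
      \<in> span {U_unit \<sigma> n i m s | i m s. i \<noteq> 4 \<and> m \<le> legendre_index n}"
  proof -
    have base: "U_unit \<sigma> n i m s \<in> span {U_unit \<sigma> n i m s | i m s. i \<noteq> 4 \<and> m \<le> legendre_index n}"
      if "i \<noteq> 4" "m \<le> legendre_index n" for i m s
      by (rule span_base) (use that in blast)
    show ?thesis
      unfolding split_beta by (intro span_sum span_scale base) (auto simp: modes_def)
  qed
  ultimately show "f \<in> span {U_unit \<sigma> n i m s | i m s. i \<noteq> 4 \<and> m \<le> legendre_index n}"
    by simp
qed

lemma harmonics3_component:
  assumes "L2_degree \<sigma> n" "f \<in> harmonics3 \<sigma> n" "i \<noteq> 4"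
  shows "hharm (region \<sigma>) n (\<lambda>x. f x $ i)"
  using assms exhaust_4[of i] by (auto simp: harmonics3_def harmonics_iff)

lemma ip_eq_wip:
  assumes "L2_degree \<sigma> n" "f \<in> harmonics3 \<sigma> n" "g \<in> harmonics3 \<sigma> n"
  shows "ip \<sigma> f g = wip \<sigma> 0 (\<lambda>x. f x $ 1) (\<lambda>x. g x $ 1) + wip \<sigma> 0 (\<lambda>x. f x $ 2) (\<lambda>x. g x $ 2)
     + wip \<sigma> 0 (\<lambda>x. f x $ 3) (\<lambda>x. g x $ 3)"
proof -
  have c: "continuous_on (region \<sigma>) (\<lambda>x. f x $ i * g x $ i)"
    "homogeneous_on (region \<sigma>) (n + n) (\<lambda>x. f x $ i * g x $ i)" if "i \<noteq> 4" for i
    using hharm_regular[OF harmonics3_component[OF assms(1,2) that]]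
      hharm_regular[OF harmonics3_component[OF assms(1,3) that]]
    by (simp only: continuous_on_mult, simp only: homogeneous_on_mult)
  have ad: "admissible \<sigma> (n + n)" using admissible_L2_degree[OF assms(1)] by simp
  note R = region_integral[OF c ad]
  show ?thesis
    unfolding ip_def
    by (subst Bochner_Integration.integral_add; (intro Bochner_Integration.integrable_add R)?; simp?)
       (simp add: Bochner_Integration.integral_add R wip_def)
qed

lemma ip_commute: "ip \<sigma> f g = ip \<sigma> g f"
  by (simp add: ip_def mult.commute)

lemma ip_add:
  assumes "L2_degree \<sigma> n" "f \<in> harmonics3 \<sigma> n" "g \<in> harmonics3 \<sigma> n" "h \<in> harmonics3 \<sigma> n"
  shows "ip \<sigma> (f + g) h = ip \<sigma> f h + ip \<sigma> g h"
proof -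
  have H: "hharm (punctured \<sigma>) n (\<lambda>x. k x $ i)" if "k \<in> harmonics3 \<sigma> n" "i \<noteq> 4" for k i
    by (rule hharm_subset[OF harmonics3_component[OF assms(1) that] punctured_subset_region])
  have fg: "f + g \<in> harmonics3 \<sigma> n"
    by (rule subspace_add[OF subspace_harmonics3]) fact+
  have "wip \<sigma> 0 (\<lambda>x. f x $ i + g x $ i) (\<lambda>x. h x $ i)
      = wip \<sigma> 0 (\<lambda>x. f x $ i) (\<lambda>x. h x $ i) + wip \<sigma> 0 (\<lambda>x. g x $ i) (\<lambda>x. h x $ i)" if "i \<noteq> 4" for i
    by (intro wip_add[OF _ _ _ _ _ _ admissible_L2_degree[OF assms(1)]] hharm_regular[OF H] that assms)
  then show ?thesis
    using fg by (simp add: ip_eq_wip[OF assms(1)] assms)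
qed

lemma ip_scale: "ip \<sigma> (c *\<^sub>R f) g = c * ip \<sigma> f g"
proof -
  have "ip \<sigma> (c *\<^sub>R f) g = (LINT x|lebesgue_on (region \<sigma>).
      c * (f x $ 1 * g x $ 1 + f x $ 2 * g x $ 2 + f x $ 3 * g x $ 3))"
    by (simp add: ip_def scaleR_fun_def algebra_simps)
  then show ?thesis by (simp add: ip_def)
qed

lemma ip_definite:
  assumes "L2_degree \<sigma> n" "f \<in> harmonics3 \<sigma> n" "ip \<sigma> f f = 0"
  shows "f = 0"
proof -
  have H: "hharm (region \<sigma>) n (\<lambda>x. f x $ i)" if "i \<noteq> 4" for i
    by (rule harmonics3_component[OF assms(1,2) that])
  have c: "continuous_on (punctured \<sigma>) (\<lambda>x. f x $ i)" "homogeneous_on (punctured \<sigma>) n (\<lambda>x. f x $ i)"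
    if "i \<noteq> 4" for i
    using hharm_regular[OF hharm_subset[OF H[OF that] punctured_subset_region]] .
  have int: "integrable (lebesgue_on (punctured \<sigma>)) (\<lambda>x. norm x powi 0 * (f x $ i * f x $ i))" if "i \<noteq> 4" for i
    by (rule integrable_wip[OF c(1) c(1) c(2) c(2) admissible_L2_degree[OF assms(1)]]) (fact that)+
  have nn: "wip \<sigma> 0 (\<lambda>x. f x $ i) (\<lambda>x. f x $ i) \<ge> 0" for i
    unfolding wip_def by (rule Bochner_Integration.integral_nonneg) simp
  have "wip \<sigma> 0 (\<lambda>x. f x $ i) (\<lambda>x. f x $ i) = 0" if "i \<noteq> 4" for i
    using assms(3) nn[of 1] nn[of 2] nn[of 3] exhaust_4[of i] that
    unfolding ip_eq_wip[OF assms(1,2,2)] by auto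
  then have P: "f x $ i = 0" if "x \<in> punctured \<sigma>" "i \<noteq> 4" for x i
  proof -
    have "norm x powi 0 * (f x $ i * f x $ i) = 0"
      by (rule lint_eq_0D[OF _ _ int[OF that(2)] _ that(1)])
         (use \<open>\<And>i. i \<noteq> 4 \<Longrightarrow> wip \<sigma> 0 _ _ = 0\<close>[OF that(2)] c(1)[OF that(2)] in
          \<open>auto simp: wip_def intro!: continuous_on_mult\<close>)
    then show ?thesis by simp
  qed
  have Z: "f x $ i = 0" if "i \<noteq> 4" for x i
  proof (cases "x \<in> region \<sigma>")
    case True
    then show ?thesis
      using P[of x i] that homogeneous_vanishes_at_0[OF assms(1) hharm_regular(2)[OF H[OF that]]]
      by (cases "x = 0") (auto simp: punctured_def)
  next
    case False
    then show ?thesis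
      using assms(2) exhaust_4[of i] that by (auto simp: harmonics3_def harmonics_def vanishes_outside_def)
  qed
  moreover have "f x $ 4 = 0" for x
    using assms(2) by (simp add: harmonics3_def reduced_quats_def)
  ultimately show ?thesis by (simp add: fun_eq_iff quat_eq_iff)
qed

section \<open>Monogenic functions as conjugate gradients\<close>

lemma partial_component: "f differentiable (at x) \<Longrightarrow> partial i f x $ j = partial i (\<lambda>x. f x $ j) x"
  using partial_bounded_linear[OF bounded_linear_vec_nth] by metis

lemma dbar_components:
  assumes "f differentiable (at x)"
  shows "dbar f x $ 1 = partial 1 (\<lambda>x. f x $ 1) x - partial 2 (\<lambda>x. f x $ 2) x - partial 3 (\<lambda>x. f x $ 3) x"
    and "dbar f x $ 2 = partial 1 (\<lambda>x. f x $ 2) x + partial 2 (\<lambda>x. f x $ 1) x + partial 3 (\<lambda>x. f x $ 4) x"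
    and "dbar f x $ 3 = partial 1 (\<lambda>x. f x $ 3) x - partial 2 (\<lambda>x. f x $ 4) x + partial 3 (\<lambda>x. f x $ 1) x"
    and "dbar f x $ 4 = partial 1 (\<lambda>x. f x $ 4) x + partial 2 (\<lambda>x. f x $ 3) x - partial 3 (\<lambda>x. f x $ 2) x"
  by (simp_all add: dbar_def qmult_def e1_def e2_def flip: partial_component[OF assms])

text \<open>The horizontal derivatives of \<open>U\<close> of degree \<open>n + 1\<close>, written in functions of degree \<open>n\<close>. Unlike the
  derivatives of \<open>U\<close> themselves, these expressions are also usable at the origin.\<close>

definition grad_2 :: "int \<Rightarrow> nat \<Rightarrow> sgn_pm \<Rightarrow> real ^ 3 \<Rightarrow> real" where
  "grad_2 n m s x = (case m of 0 \<Rightarrow> (if s = Plus then U n 1 Plus x else 0)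
     | Suc j \<Rightarrow> (U n (Suc (Suc j)) s x - (of_int n + real j + 2) * (of_int n + real j + 1) * U n j s x) / 2)"

definition grad_3 :: "int \<Rightarrow> nat \<Rightarrow> sgn_pm \<Rightarrow> real ^ 3 \<Rightarrow> real" where
  "grad_3 n m s x = (case m of 0 \<Rightarrow> (if s = Plus then U n 1 Minus x else 0)
     | Suc j \<Rightarrow> pm s * (U n (Suc (Suc j)) (flip s) x
         + (of_int n + real j + 2) * (of_int n + real j + 1) * U n j (flip s) x) / 2)"

lemma partial_U_grad:
  assumes "x \<noteq> 0"
  shows "partial 1 (U (n + 1) m s) x = (of_int n + 1 + real m) * U n m s x"
    and "partial 2 (U (n + 1) m s) x = grad_2 n m s x"
    and "partial 3 (U (n + 1) m s) x = grad_3 n m s x"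
  by (simp_all add: grad_2_def grad_3_def partial_1_U[OF assms] partial_2_U_0[OF assms]
      partial_3_U_0[OF assms] partial_2_U_Suc[OF assms] partial_3_U_Suc[OF assms] algebra_simps
      split: nat.split)

definition conj_grad :: "int \<Rightarrow> nat \<Rightarrow> sgn_pm \<Rightarrow> real ^ 3 \<Rightarrow> quat" where
  "conj_grad n m s x = mk_quat ((of_int n + 1 + real m) * U n m s x) (- grad_2 n m s x) (- grad_3 n m s x) 0"

lemma Ck_on_quat:
  fixes f :: "real ^ 3 \<Rightarrow> quat"
  assumes "open S" "\<And>j. Ck_on k S (\<lambda>x. f x $ j)"
  shows "Ck_on k S f"
proof -
  have b: "Ck_on k S (\<lambda>x. f x $ j *\<^sub>R axis j 1 :: quat)" for j
    by (rule Ck_on_bounded_linear[OF assms(1) bounded_linear_scaleR_left assms(2)])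
  have "Ck_on k S (\<lambda>x. f x $ 1 *\<^sub>R axis 1 1 + f x $ 2 *\<^sub>R axis 2 1 + (f x $ 3 *\<^sub>R axis 3 1 + f x $ 4 *\<^sub>R axis 4 1) :: quat)"
    by (intro Ck_on_add[OF assms(1)] b)
  moreover have "(\<lambda>x. f x $ 1 *\<^sub>R axis 1 1 + f x $ 2 *\<^sub>R axis 2 1 + (f x $ 3 *\<^sub>R axis 3 1 + f x $ 4 *\<^sub>R axis 4 1)) = f"
    by (simp add: fun_eq_iff quat_eq_iff axis_def)
  ultimately show ?thesis by simp
qed

lemma homogeneous_grad:
  "homogeneous_on S n (grad_2 n m s)" "homogeneous_on S n (grad_3 n m s)"
proof -
  have U: "t *\<^sub>R x \<in> S \<Longrightarrow> x \<in> S \<Longrightarrow> t > 0 \<Longrightarrow> U n m s (t *\<^sub>R x) = t powi n * U n m s x" for t x m s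
    using homogeneous_onD[OF homogeneous_U[of S n m s], of x t] by simp
  show "homogeneous_on S n (grad_2 n m s)" "homogeneous_on S n (grad_3 n m s)"
    unfolding homogeneous_on_def grad_2_def grad_3_def
    by (auto simp: U algebra_simps split: nat.split)
qed

lemma elementary_grad:
  assumes "0 \<notin> S \<or> n \<ge> 1"
  shows "elementary S (grad_2 n m s)" "elementary S (grad_3 n m s)"
proof -
  have U: "elementary S (U n m s)" for m s
    using assms elementary_U elementary_U_nonneg by blast
  show "elementary S (grad_2 n m s)"
  proof (cases m)
    case 0
    have "elementary S (\<lambda>x. (if s = Plus then 1 else 0) * U n 1 Plus x)"
      by (intro elementary.mult elementary.const U)
    then show ?thesis
      by (rule elementary.cong) (simp add: grad_2_def 0)
  next
    case (Suc j)
    have "elementary S (\<lambda>x. 1 / 2 * (U n (Suc (Suc j)) s x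
        + (- ((of_int n + real j + 2) * (of_int n + real j + 1))) * U n j s x))"
      by (intro elementary.mult elementary.add elementary.const U)
    then show ?thesis
      by (rule elementary.cong) (simp add: grad_2_def Suc)
  qed
  show "elementary S (grad_3 n m s)"
  proof (cases m)
    case 0
    have "elementary S (\<lambda>x. (if s = Plus then 1 else 0) * U n 1 Minus x)"
      by (intro elementary.mult elementary.const U)
    then show ?thesis
      by (rule elementary.cong) (simp add: grad_3_def 0)
  next
    case (Suc j)
    have "elementary S (\<lambda>x. pm s / 2 * (U n (Suc (Suc j)) (flip s) x
        + (of_int n + real j + 2) * (of_int n + real j + 1) * U n j (flip s) x))"
      by (intro elementary.mult elementary.add elementary.const U)
    then show ?thesis
      by (rule elementary.cong) (simp add: grad_3_def Suc)
  qed
qed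

text \<open>Away from the origin the monogenic system for a conjugate gradient consists of the symmetry of
  second derivatives and of Laplace's equation; the origin follows by continuity.\<close>

lemma conj_grad_monogenic:
  assumes "L2_degree \<sigma> n"
  shows "restr (region \<sigma>) (conj_grad n m s) \<in> monogenics \<sigma> n"
proof -
  let ?S = "region \<sigma>" and ?f = "conj_grad n m s"
  note S = open_region[of \<sigma>]
  have eU: "elementary ?S (U n m s)"
    using L2_degree_region[OF assms] elementary_U elementary_U_nonneg by blast
  have e1: "elementary ?S (\<lambda>x. (of_int n + 1 + real m) * U n m s x)"
    by (intro elementary.mult elementary.const eU)
  have "elementary ?S (\<lambda>x. (-1) * grad_2 n m s x)" "elementary ?S (\<lambda>x. (-1) * grad_3 n m s x)"
    by (intro elementary.mult elementary.const elementary_grad L2_degree_region[OF assms])+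
  then have e: "elementary ?S (\<lambda>x. ?f x $ j)" for j
    using e1 elementary.const[of ?S 0] exhaust_4[of j] by (auto simp: conj_grad_def)
  have sm: "smooth_on ?S ?f"
    unfolding smooth_on_def by (intro allI Ck_on_quat S Ck_on_elementary e)
  then have "Ck_on 1 ?S ?f" by (simp add: smooth_on_def)
  then have d: "?f differentiable (at x)" if "x \<in> ?S" for x using that by simp
  have dbar0: "dbar ?f x = 0" if x: "x \<in> ?S" "x \<noteq> 0" for x
  proof -
    define u where "u = U (n + 1) m s"
    have T: "open (- {0 :: real ^ 3})" "x \<in> - {0}" using x by auto
    have u: "elementary (- {0}) u" unfolding u_def by (intro elementary_U) auto
    have du: "partial j u differentiable (at x)" for j
      by (rule elementary_differentiable[OF T(1) elementary_partial[OF T(1) u] T(2)])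
    have c: "partial i (\<lambda>x. ?f x $ 1) x = partial i (partial 1 u) x"
      "partial i (\<lambda>x. ?f x $ 2) x = partial i (\<lambda>x. (-1) * partial 2 u x) x"
      "partial i (\<lambda>x. ?f x $ 3) x = partial i (\<lambda>x. (-1) * partial 3 u x) x" for i
      by (rule partial_cong_open[OF T]; simp add: u_def conj_grad_def partial_U_grad)+
    have c4: "(\<lambda>x. ?f x $ 4) = (\<lambda>x. 0)" by (simp add: conj_grad_def)
    have lap: "partial 1 (partial 1 u) x + partial 2 (partial 2 u) x + partial 3 (partial 3 u) x = 0"
      using laplacian_U[OF x(2), of "n + 1" m s] by (simp add: laplacian_def sum_3 u_def)
    show ?thesis
      unfolding quat_eq_iff dbar_components[OF d[OF x(1)]] c c4 partial_cmult[OF du]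
      using lap elementary_partial_commute[OF T(1) u T(2), of 1 2]
        elementary_partial_commute[OF T(1) u T(2), of 1 3]
        elementary_partial_commute[OF T(1) u T(2), of 2 3]
      by simp
  qed
  have cont: "continuous_on ?S (dbar ?f)"
  proof -
    have p: "continuous_on ?S (partial i (\<lambda>x. ?f x $ j))" for i j
      by (intro elementary_continuous elementary_partial S e)
    have "continuous_on ?S (\<lambda>x. dbar ?f x $ j)" for j
    proof -
      consider "j = 1" | "j = 2" | "j = 3" | "j = 4" using exhaust_4[of j] by auto
      then show ?thesis
        by cases (simp_all add: dbar_components[OF d] p continuous_on_add continuous_on_diff
            cong: continuous_on_cong)
    qed
    then have "continuous_on ?S (\<lambda>x. \<chi> j. dbar ?f x $ j)"
      by (intro continuous_on_vec_lambda)
    then show ?thesis by simp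
  qed
  have db: "dbar ?f x = 0" if "x \<in> ?S" for x
    using continuous_on_open_eq_0[OF S cont dbar0 that] .
  have "?f x \<in> reduced_quats" for x by (simp add: conj_grad_def reduced_quats_def)
  then have mono: "monogenic_on ?S ?f" using sm db by (simp add: monogenic_on_def)
  have hom: "homogeneous_on ?S n ?f"
    using homogeneous_grad[of ?S n m s] homogeneous_U[of ?S n m s]
    by (simp add: homogeneous_on_def conj_grad_def quat_eq_iff)
  have eq: "restr ?S ?f x = ?f x" if "x \<in> ?S" for x using that by (simp add: restr_def)
  have "dbar (restr ?S ?f) x = dbar ?f x" if "x \<in> ?S" for x
  proof -
    have "partial i (restr ?S ?f) x = partial i ?f x" for i
      by (rule partial_cong_open[OF S that]) (rule eq)
    then show ?thesis by (simp add: dbar_def)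
  qed
  then have "monogenic_on ?S (restr ?S ?f)"
    using mono smooth_on_cong[OF S eq] eq by (auto simp: monogenic_on_def)
  moreover have hom': "homogeneous_on ?S n (restr ?S ?f)"
    using hom eq by (simp add: homogeneous_on_def)
  moreover have "smooth_on ?S (restr ?S ?f)"
    using sm smooth_on_cong[of ?S "restr ?S ?f" ?f] S eq by blast
  then have "L2_on ?S (restr ?S ?f)"
    by (intro homogeneous_L2[OF assms _ hom'] Ck_on_imp_continuous[of 0]) (simp only: smooth_on_def)
  moreover have "vanishes_outside ?S (restr ?S ?f)"
    by (simp add: vanishes_outside_def restr_def)
  ultimately show ?thesis
    by (simp add: monogenics_def)
qed

text \<open>With \<open>F = (f\<^sub>0, -f\<^sub>1, -f\<^sub>2)\<close> the monogenic system says that \<open>\<partial>\<^sub>iF\<^sub>j = \<partial>\<^sub>jF\<^sub>i\<close> and that the divergence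
  vanishes. Then \<open>\<partial>\<^sub>i(x \<cdot> F) = F\<^sub>i + \<Sum> x\<^sub>j \<partial>\<^sub>jF\<^sub>i = (n + 1) F\<^sub>i\<close>, so \<open>x \<cdot> F / (n + 1)\<close> is a harmonic
  potential; it is expanded in solid harmonics and differentiated.\<close>

lemma monogenics_expansion:
  assumes deg: "L2_degree \<sigma> n" and f: "f \<in> monogenics \<sigma> n"
  obtains c where "f = (\<Sum>(m, s)\<in>modes (n + 1). c m s *\<^sub>R restr (region \<sigma>) (conj_grad n m s))"
proof -
  let ?S = "region \<sigma>" and ?P = "punctured \<sigma>"
  have mono: "monogenic_on ?S f" and hom: "homogeneous_on ?S n f" and van: "vanishes_outside ?S f"
    using f by (auto simp: monogenics_def)
  have sub: "x \<in> ?S" if "x \<in> ?P" for x using that punctured_subset_region by blast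
  have "Ck_on 1 ?S f" using mono by (simp add: monogenic_on_def smooth_on_def)
  then have C: "Ck_on 1 ?P f" by (rule Ck_on_subset[OF _ punctured_subset_region])
  then have d: "f differentiable (at x)" if "x \<in> ?P" for x using that by simp
  have Cj: "Ck_on 1 ?P (\<lambda>x. f x $ j)" for j
    by (rule Ck_on_bounded_linear[OF open_punctured bounded_linear_vec_nth C])
  then have dj: "(\<lambda>x. f x $ j) differentiable (at x)" if "x \<in> ?P" for x j using that by simp
  have f4: "f x $ 4 = 0" if "x \<in> ?S" for x
    using mono that by (auto simp: monogenic_on_def reduced_quats_def)
  have p4: "partial i (\<lambda>x. f x $ 4) x = 0" if "x \<in> ?P" for i x
    using partial_cong_open[OF open_punctured that, of "\<lambda>x. f x $ 4" "\<lambda>x. 0"] f4 sub by simp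
  define F where "F j x = (if j = 1 then f x $ 1 else if j = 2 then - (f x $ 2) else - (f x $ 3))"
    for j :: 3 and x
  have F: "F 1 = (\<lambda>x. f x $ 1)" "F 2 = (\<lambda>x. (-1) * f x $ 2)" "F 3 = (\<lambda>x. (-1) * f x $ 3)"
    by (auto simp: F_def fun_eq_iff)
  have CF: "Ck_on 1 ?P (F j)" for j
    using Cj Ck_on_scale[OF open_punctured Cj, of "-1"] exhaust_3[of j] by (auto simp: F)
  then have dF: "F j differentiable (at x)" if "x \<in> ?P" for x j using that by simp
  have hF: "homogeneous_on ?P n (F j)" for j
    using homogeneous_on_subset[OF hom punctured_subset_region]
    by (auto simp: homogeneous_on_def F_def)
  have pF: "partial i (F 1) x = partial i (\<lambda>x. f x $ 1) x"
    "partial i (F 2) x = - partial i (\<lambda>x. f x $ 2) x"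
    "partial i (F 3) x = - partial i (\<lambda>x. f x $ 3) x" if "x \<in> ?P" for i x
    unfolding F partial_cmult[OF dj[OF that]] by simp_all
  have curl: "partial i (F j) x = partial j (F i) x" and div: "partial 1 (F 1) x + partial 2 (F 2) x + partial 3 (F 3) x = 0"
    if x: "x \<in> ?P" for i j x
  proof -
    have "dbar f x = 0" using mono sub[OF x] by (simp add: monogenic_on_def)
    then have eqs: "partial 1 (\<lambda>x. f x $ 1) x - partial 2 (\<lambda>x. f x $ 2) x - partial 3 (\<lambda>x. f x $ 3) x = 0"
      "partial 1 (\<lambda>x. f x $ 2) x + partial 2 (\<lambda>x. f x $ 1) x = 0"
      "partial 1 (\<lambda>x. f x $ 3) x + partial 3 (\<lambda>x. f x $ 1) x = 0"
      "partial 2 (\<lambda>x. f x $ 3) x = partial 3 (\<lambda>x. f x $ 2) x"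
      using dbar_components[OF d[OF x]] p4[OF x] by simp_all
    then show "partial 1 (F 1) x + partial 2 (F 2) x + partial 3 (F 3) x = 0"
      by (simp add: pF[OF x])
    show "partial i (F j) x = partial j (F i) x"
      using exhaust_3[of i] exhaust_3[of j] eqs by (auto simp: pF[OF x])
  qed
  define N :: real where "N = of_int n + 1"
  have N: "N \<noteq> 0" using deg by (cases \<sigma>) (auto simp: L2_degree_def N_def)
  define u where "u x = inverse N * (x$1 * F 1 x + (x$2 * F 2 x + x$3 * F 3 x))" for x
  have coord: "(\<lambda>x::real^3. x$j) differentiable (at x)" for j x
    by (rule bounded_linear_imp_differentiable[OF bounded_linear_vec_nth])
  have Cu: "Ck_on 1 ?P u"
    unfolding u_def using CF Ck_on_elementary[OF open_punctured elementary.coordinate]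
    by (intro Ck_on_scale Ck_on_add Ck_on_mult open_punctured)
  have pu: "partial i u x = F i x" if x: "x \<in> ?P" for i x
  proof -
    have "partial i u x = inverse N * ((x$1 * partial i (F 1) x + (if i = 1 then F 1 x else 0))
      + ((x$2 * partial i (F 2) x + (if i = 2 then F 2 x else 0))
      + (x$3 * partial i (F 3) x + (if i = 3 then F 3 x else 0))))"
      unfolding u_def using dF[OF x] coord
      by (subst partial_cmult, simp, subst partial_add, simp, simp, subst partial_add, simp, simp)
         (simp add: partial_mult)
    also have "\<dots> = inverse N * ((x$1 * partial 1 (F i) x + x$2 * partial 2 (F i) x + x$3 * partial 3 (F i) x) + F i x)"
      unfolding curl[OF x, of i] using exhaust_3[of i] by auto
    also have "\<dots> = inverse N * (N * F i x)"
      unfolding Euler[OF open_punctured hF x dF[OF x]] by (simp add: N_def algebra_simps)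
    also have "\<dots> = F i x" using N by simp
    finally show ?thesis .
  qed
  have "Ck_on 1 ?P (partial i u)" for i
    using Ck_on_cong[of ?P "partial i u" "F i" 1] open_punctured pu CF by blast
  then have C2: "Ck_on 2 ?P u"
    using Cu by (simp add: numeral_2_eq_2)
  have "laplacian u x = 0" if x: "x \<in> ?P" for x
  proof -
    have "partial i (partial i u) x = partial i (F i) x" for i
      by (rule partial_cong_open[OF open_punctured x pu])
    then show ?thesis using div[OF x] by (simp add: laplacian_def sum_3)
  qed
  moreover have "homogeneous_on ?P (n + 1) u"
  proof -
    have "homogeneous_on ?P 1 (\<lambda>x. x$j)" for j by (simp add: homogeneous_on_def)
    then have "homogeneous_on ?P (1 + n) u"
      unfolding u_def by (intro homogeneous_on_scale homogeneous_on_add homogeneous_on_mult hF)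
    then show ?thesis by (simp add: add.commute)
  qed
  ultimately have hu: "hharm ?P (n + 1) u"
    using C2 by (simp add: hharm_def harmonic_on_def)
  have n: "\<sigma> = Inner \<Longrightarrow> n + 1 \<ge> 0" "\<sigma> = Outer \<Longrightarrow> n + 1 \<le> -1"
    using deg by (auto simp: L2_degree_def)
  obtain c where c: "\<And>x. x \<in> ?P \<Longrightarrow> u x = (\<Sum>(m, s)\<in>modes (n + 1). c m s * U (n + 1) m s x)"
    using hharm_expansion[OF hu n] by blast
  have "partial i u x = (\<Sum>(m, s)\<in>modes (n + 1). c m s * partial i (U (n + 1) m s) x)" if x: "x \<in> ?P" for i x
  proof -
    have "partial i (\<lambda>x. \<Sum>(m, s)\<in>M. c m s * U (n + 1) m s x) x = (\<Sum>(m, s)\<in>M. c m s * partial i (U (n + 1) m s) x)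
        \<and> (\<lambda>x. \<Sum>(m, s)\<in>M. c m s * U (n + 1) m s x) differentiable (at x)" if "finite M" for M
      using that
    proof (induction M rule: finite_induct)
      case (insert a M)
      then show ?case
        using U_differentiable[OF punctured_nonzero[OF x]]
        by (simp add: split_beta partial_add partial_cmult)
    qed simp
    then show ?thesis
      using partial_cong_open[OF open_punctured x c, where i = i] by simp
  qed
  then have Fc: "F i x = (\<Sum>(m, s)\<in>modes (n + 1). c m s * partial i (U (n + 1) m s) x)" if "x \<in> ?P" for i x
    using pu that by simp
  have "f x = (\<Sum>(m, s)\<in>modes (n + 1). c m s *\<^sub>R restr ?S (conj_grad n m s)) x" for x
  proof (cases "x \<in> ?P")
    case x: True
    have "f x $ 1 = F 1 x" "f x $ 2 = - F 2 x" "f x $ 3 = - F 3 x" "f x $ 4 = 0"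
      using f4 sub[OF x] by (simp_all add: F_def)
    then show ?thesis
      using sub[OF x]
      by (simp add: quat_eq_iff Fc[OF x] sum_fun_apply split_beta scaleR_fun_def restr_def conj_grad_def
          partial_U_grad[OF punctured_nonzero[OF x]] sum_negf)
  next
    case False
    have "f x = 0 \<and> (\<forall>m s. restr ?S (conj_grad n m s) x = 0)"
    proof (cases "x \<in> ?S")
      case True
      then have "x = 0" using False by (simp add: punctured_def)
      moreover have "homogeneous_on ?S n (conj_grad n m s)" for m s
        using homogeneous_grad[of ?S n m s] homogeneous_U[of ?S n m s]
        by (simp add: homogeneous_on_def conj_grad_def quat_eq_iff)
      ultimately show ?thesis
        using True homogeneous_vanishes_at_0[OF deg hom] homogeneous_vanishes_at_0[OF deg]
        by (auto simp: restr_def)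
    next
      case False
      then show ?thesis using van by (simp add: vanishes_outside_def restr_def)
    qed
    then show ?thesis by (simp add: sum_fun_apply split_beta scaleR_fun_def)
  qed
  then show thesis by (intro that[of c]) (simp add: fun_eq_iff)
qed

section \<open>The contragenic basis\<close>

text \<open>The terms of order \<open>m + 1\<close> and of order \<open>m - 1\<close> from which both the horizontal gradient of
  \<open>U\<close> of degree \<open>n + 1\<close> and order \<open>m\<close>, and \<open>Z\<close> of order \<open>m\<close>, are made. In complex notation they are
  multiples of \<open>V\<close> and of its conjugate.\<close>

definition raised :: "side \<Rightarrow> int \<Rightarrow> nat \<Rightarrow> sgn_pm \<Rightarrow> real ^ 3 \<Rightarrow> quat" where
  "raised \<sigma> n m s = U_unit \<sigma> n 2 (Suc m) (flip s) + (- pm s) *\<^sub>R U_unit \<sigma> n 3 (Suc m) s"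

definition lowered :: "side \<Rightarrow> int \<Rightarrow> nat \<Rightarrow> sgn_pm \<Rightarrow> real ^ 3 \<Rightarrow> quat" where
  "lowered \<sigma> n m s = U_unit \<sigma> n 2 (m - 1) (flip s) + pm s *\<^sub>R U_unit \<sigma> n 3 (m - 1) s"

definition scalar_grad :: "side \<Rightarrow> int \<Rightarrow> nat \<Rightarrow> sgn_pm \<Rightarrow> real ^ 3 \<Rightarrow> quat" where
  "scalar_grad \<sigma> n m s = (of_int n + 1 + real m) *\<^sub>R U_unit \<sigma> n 1 m s"

definition vector_grad :: "side \<Rightarrow> int \<Rightarrow> nat \<Rightarrow> sgn_pm \<Rightarrow> real ^ 3 \<Rightarrow> quat" where
  "vector_grad \<sigma> n m s = (if m = 0 then (if s = Plus then raised \<sigma> n 0 Minus else 0)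
     else (1 / 2) *\<^sub>R (raised \<sigma> n m (flip s)
       + (- ((of_int n + real m + 1) * (of_int n + real m))) *\<^sub>R lowered \<sigma> n m (flip s)))"

lemma conj_grad_split: "restr (region \<sigma>) (conj_grad n m s) = scalar_grad \<sigma> n m s + (-1) *\<^sub>R vector_grad \<sigma> n m s"
proof
  fix x
  show "restr (region \<sigma>) (conj_grad n m s) x = (scalar_grad \<sigma> n m s + (-1) *\<^sub>R vector_grad \<sigma> n m s) x"
    by (cases m; cases s)
       (auto simp: quat_eq_iff restr_def conj_grad_def scalar_grad_def vector_grad_def raised_def lowered_def U_unit_def scaleR_fun_def
         axis_def grad_2_def grad_3_def U_0_Minus field_simps)
qed

lemma qconj_conj_grad_split:
  "(\<lambda>x. qconj (restr (region \<sigma>) (conj_grad n m s) x)) = scalar_grad \<sigma> n m s + vector_grad \<sigma> n m s"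
proof
  fix x
  have "(scalar_grad \<sigma> n m s + (-1) *\<^sub>R vector_grad \<sigma> n m s) x $ i = scalar_grad \<sigma> n m s x $ i - vector_grad \<sigma> n m s x $ i" for i
    by (simp add: scaleR_fun_def)
  moreover have "vector_grad \<sigma> n m s x $ 1 = 0" "scalar_grad \<sigma> n m s x $ 2 = 0" "scalar_grad \<sigma> n m s x $ 3 = 0"
    "scalar_grad \<sigma> n m s x $ 4 = 0" "vector_grad \<sigma> n m s x $ 4 = 0"
    by (simp_all add: scalar_grad_def vector_grad_def raised_def lowered_def U_unit_def scaleR_fun_def axis_def)
  ultimately show "qconj (restr (region \<sigma>) (conj_grad n m s) x) = (scalar_grad \<sigma> n m s + vector_grad \<sigma> n m s) x"
    by (simp add: conj_grad_split quat_eq_iff qconj_def)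
qed

lemma Z_eq:
  "Z \<sigma> n Zero = raised \<sigma> n 0 Plus"
  "Z \<sigma> n (Mid m s) = raised \<sigma> n m s + ((of_int n - real m) * (of_int n - real m + 1)) *\<^sub>R lowered \<sigma> n m s"
  "Z \<sigma> n (Last s) = U_unit \<sigma> n 1 (nat (- n - 1)) s"
  by (auto simp: Z_def Z0_def Zpm_def Zlast_def Let_def fun_eq_iff quat_eq_iff restr_def raised_def lowered_def
      U_unit_def scaleR_fun_def axis_def e1_def e2_def of_scalar_def algebra_simps)

lemma harmonics3_closed:
  assumes "L2_degree \<sigma> n"
  shows "f \<in> harmonics3 \<sigma> n \<Longrightarrow> g \<in> harmonics3 \<sigma> n \<Longrightarrow> f + g \<in> harmonics3 \<sigma> n"
    and "f \<in> harmonics3 \<sigma> n \<Longrightarrow> c *\<^sub>R f \<in> harmonics3 \<sigma> n"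
    and "0 \<in> harmonics3 \<sigma> n"
    and "f \<in> harmonics3 \<sigma> n \<Longrightarrow> g \<in> harmonics3 \<sigma> n \<Longrightarrow> f - g \<in> harmonics3 \<sigma> n"
    and "f \<in> harmonics3 \<sigma> n \<Longrightarrow> - f \<in> harmonics3 \<sigma> n"
    and "raised \<sigma> n m s \<in> harmonics3 \<sigma> n" and "lowered \<sigma> n m s \<in> harmonics3 \<sigma> n"
    and "scalar_grad \<sigma> n m s \<in> harmonics3 \<sigma> n" and "vector_grad \<sigma> n m s \<in> harmonics3 \<sigma> n"
    and "Z \<sigma> n l \<in> harmonics3 \<sigma> n"
proof -
  note V = subspace_harmonics3[OF assms]
  show add: "f + g \<in> harmonics3 \<sigma> n" if "f \<in> harmonics3 \<sigma> n" "g \<in> harmonics3 \<sigma> n" for f g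
    using subspace_add[OF V] that .
  show scale: "c *\<^sub>R f \<in> harmonics3 \<sigma> n" if "f \<in> harmonics3 \<sigma> n" for f c
    using subspace_scale[OF V] that .
  show zero: "0 \<in> harmonics3 \<sigma> n"
    using subspace_0[OF V] .
  show "f - g \<in> harmonics3 \<sigma> n" if "f \<in> harmonics3 \<sigma> n" "g \<in> harmonics3 \<sigma> n"
    using subspace_diff[OF V] that .
  show "- f \<in> harmonics3 \<sigma> n" if "f \<in> harmonics3 \<sigma> n"
    using subspace_neg[OF V] that .
  have U_unit: "U_unit \<sigma> n i m s \<in> harmonics3 \<sigma> n" if "i \<noteq> 4" for i m s
    using U_unit_in_harmonics3[OF assms that] .
  show A: "raised \<sigma> n m s \<in> harmonics3 \<sigma> n" for m s
    unfolding raised_def by (intro add scale U_unit) auto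
  show B: "lowered \<sigma> n m s \<in> harmonics3 \<sigma> n" for m s
    unfolding lowered_def by (intro add scale U_unit) auto
  show "scalar_grad \<sigma> n m s \<in> harmonics3 \<sigma> n"
    unfolding scalar_grad_def by (intro add scale U_unit) auto
  show "vector_grad \<sigma> n m s \<in> harmonics3 \<sigma> n"
    unfolding vector_grad_def by (auto simp del: scaleR_minus_left intro!: A B add scale zero)
  show "Z \<sigma> n l \<in> harmonics3 \<sigma> n"
    using A B add scale U_unit by (cases l) (auto simp: Z_eq)
qed

lemma ip_scale_right: "ip \<sigma> f (c *\<^sub>R g) = c * ip \<sigma> f g"
  using ip_scale[of \<sigma> c g f] by (simp add: ip_commute[of \<sigma> f])

lemma ip_minus: "ip \<sigma> (- f) g = - ip \<sigma> f g" "ip \<sigma> f (- g) = - ip \<sigma> f g"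
  using ip_scale[of \<sigma> "-1" f g] ip_scale_right[of \<sigma> f "-1" g] by simp_all

lemma ip_linear:
  assumes "L2_degree \<sigma> n" "f \<in> harmonics3 \<sigma> n" "g \<in> harmonics3 \<sigma> n" "h \<in> harmonics3 \<sigma> n"
  shows "ip \<sigma> f (g + h) = ip \<sigma> f g + ip \<sigma> f h"
    and "ip \<sigma> (f - g) h = ip \<sigma> f h - ip \<sigma> g h"
    and "ip \<sigma> f (g - h) = ip \<sigma> f g - ip \<sigma> f h"
proof -
  note H = harmonics3_closed[OF assms(1)]
  have add: "ip \<sigma> f (g + h) = ip \<sigma> f g + ip \<sigma> f h" if "h \<in> harmonics3 \<sigma> n" for h
    using ip_add[OF assms(1,3) that assms(2)] by (simp add: ip_commute[of \<sigma> f])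
  show "ip \<sigma> f (g + h) = ip \<sigma> f g + ip \<sigma> f h"
    by (rule add[OF assms(4)])
  show "ip \<sigma> (f - g) h = ip \<sigma> f h - ip \<sigma> g h"
    using ip_add[OF assms(1,2) H(5)[OF assms(3)] assms(4)] by (simp add: ip_minus)
  show "ip \<sigma> f (g - h) = ip \<sigma> f g - ip \<sigma> f h"
    using add[OF H(5)[OF assms(4)]] by (simp add: ip_minus)
qed

lemma ip_U_unit:
  assumes "L2_degree \<sigma> n" "i \<noteq> 4" "j \<noteq> 4"
  shows "ip \<sigma> (U_unit \<sigma> n i m s) (U_unit \<sigma> n j m' s')
     = (if i = j \<and> m = m' \<and> s = s' then wip \<sigma> 0 (U n m s) (U n m s) else 0)"
proof -
  have comp: "wip \<sigma> 0 (\<lambda>x. U_unit \<sigma> n i m s x $ l) (\<lambda>x. U_unit \<sigma> n j m' s' x $ l)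
      = (if l = i \<and> l = j then wip \<sigma> 0 (U n m s) (U n m' s') else 0)" for l
  proof (cases "l = i \<and> l = j")
    case True
    then show ?thesis
      by (auto intro!: wip_cong simp: U_unit_def axis_def restr_def punctured_def)
  next
    case False
    then show ?thesis
      by (auto simp: wip_def U_unit_def axis_def)
  qed
  have "ip \<sigma> (U_unit \<sigma> n i m s) (U_unit \<sigma> n j m' s') = (if i = j then wip \<sigma> 0 (U n m s) (U n m' s') else 0)"
    using exhaust_4[of i] exhaust_4[of j] assms(2,3)
    by (auto simp: ip_eq_wip[OF assms(1) U_unit_in_harmonics3[OF assms(1,2)] U_unit_in_harmonics3[OF assms(1,3)]] comp)
  then show ?thesis
    using wip_U_orthogonal[OF admissible_L2_degree[OF assms(1)], of m s m' s'] by auto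
qed

lemma wip_U_eq_order_norm:
  assumes "L2_degree \<sigma> n"
  shows "wip \<sigma> 0 (U n (Suc m) s) (U n (Suc m) s) = order_norm \<sigma> n (Suc m) / 2"
  using wip_U_flip[OF admissible_L2_degree[OF assms], of "Suc m" Plus] by (cases s) (auto simp: order_norm_def)

lemma
  assumes deg: "L2_degree \<sigma> n"
  shows ip_raised_raised: "ip \<sigma> (raised \<sigma> n m s) (raised \<sigma> n m' s') = (if m = m' \<and> s = s' then order_norm \<sigma> n (Suc m) else 0)"
    and ip_lowered_lowered: "m \<ge> 1 \<Longrightarrow> m' \<ge> 1 \<Longrightarrow>
      ip \<sigma> (lowered \<sigma> n m s) (lowered \<sigma> n m' s') = (if m = m' \<and> s = s' then order_norm \<sigma> n (m - 1) else 0)"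
    and ip_raised_lowered: "m' \<ge> 1 \<Longrightarrow> ip \<sigma> (raised \<sigma> n m s) (lowered \<sigma> n m' s') = 0"
    and ip_U_unit_raised: "ip \<sigma> (U_unit \<sigma> n 1 k t) (raised \<sigma> n m s) = 0"
    and ip_U_unit_lowered: "ip \<sigma> (U_unit \<sigma> n 1 k t) (lowered \<sigma> n m s) = 0"
proof -
  note H = harmonics3_closed[OF deg] U_unit_in_harmonics3[OF deg]
  note L = ip_add[OF deg] ip_scale ip_scale_right ip_minus ip_linear[OF deg] ip_U_unit[OF deg]
  show "ip \<sigma> (raised \<sigma> n m s) (raised \<sigma> n m' s') = (if m = m' \<and> s = s' then order_norm \<sigma> n (Suc m) else 0)"
    unfolding raised_def by (cases s; cases s') (auto simp: L H wip_U_eq_order_norm[OF deg])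
  show "ip \<sigma> (lowered \<sigma> n m s) (lowered \<sigma> n m' s') = (if m = m' \<and> s = s' then order_norm \<sigma> n (m - 1) else 0)"
    if "m \<ge> 1" "m' \<ge> 1"
    unfolding lowered_def order_norm_def using that by (cases s; cases s') (auto simp: L H)
  show "ip \<sigma> (raised \<sigma> n m s) (lowered \<sigma> n m' s') = 0" if "m' \<ge> 1"
  proof -
    obtain i where i: "m' = Suc i" using \<open>m' \<ge> 1\<close> by (cases m') auto
    show ?thesis
      unfolding raised_def lowered_def i by (cases s; cases s') (auto simp: L H wip_U_eq_order_norm[OF deg])
  qed
  show "ip \<sigma> (U_unit \<sigma> n 1 k t) (raised \<sigma> n m s) = 0"
    unfolding raised_def by (simp add: L H)
  show "ip \<sigma> (U_unit \<sigma> n 1 k t) (lowered \<sigma> n m s) = 0"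
    unfolding lowered_def by (simp add: L H)
qed

text \<open>One computation for three purposes: two \<open>Z\<close>, a \<open>Z\<close> and a gradient, and the norm of a \<open>Z\<close>.\<close>

lemma ip_raised_lowered_combination:
  assumes deg: "L2_degree \<sigma> n" and m: "m \<ge> 1" "m' \<ge> 1"
  shows "ip \<sigma> (raised \<sigma> n m s + a *\<^sub>R lowered \<sigma> n m s) (raised \<sigma> n m' s' + b *\<^sub>R lowered \<sigma> n m' s')
     = (if m = m' \<and> s = s' then order_norm \<sigma> n (Suc m) + a * b * order_norm \<sigma> n (m - 1) else 0)"
proof -
  note H = harmonics3_closed[OF deg]
  note L = ip_add[OF deg] ip_scale ip_scale_right ip_minus ip_linear[OF deg] ip_raised_raised[OF deg] ip_lowered_lowered[OF deg m]
    ip_raised_lowered[OF deg m(2)] ip_raised_lowered[OF deg m(1)] ip_commute[of \<sigma> "lowered \<sigma> n m s" "raised \<sigma> n m' s'"]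
  show ?thesis by (simp add: L H)
qed

lemma order_norm_nonneg: "order_norm \<sigma> n m \<ge> 0"
  unfolding order_norm_def wip_def
  by (intro add_nonneg_nonneg Bochner_Integration.integral_nonneg) auto

lemma legendre_nonzero: "legendre k \<noteq> 0"
proof -
  have d: "degree ((pderiv ^^ k) p) = degree p - k" for k and p :: "real poly"
    by (induction k) (simp_all add: degree_pderiv)
  show ?thesis
  proof (cases "k = 0")
    case False
    then have "degree (legendre k) \<noteq> 0"
      by (simp add: legendre_def d degree_power_eq)
    then show ?thesis by auto
  qed (simp add: legendre_def)
qed

lemma U_0_Plus_nonzero: "\<exists>x\<in>punctured \<sigma>. U n 0 Plus x \<noteq> 0"
proof -
  have "finite {t. lp n 0 t = 0}"
    by (rule poly_roots_finite) (simp add: LP_def legendre_nonzero)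
  then have "infinite ({0<..<1} - {t. lp n 0 t = 0})"
    using infinite_Ioo[of 0 "1 :: real"] by (intro Diff_infinite_finite) auto
  then have "{0<..<1} - {t. lp n 0 t = 0} \<noteq> {}"
    by (rule infinite_imp_nonempty)
  then obtain t where "t \<in> {0<..<1} - {t. lp n 0 t = 0}"
    by blast
  then have t: "0 < t" "t < 1" "lp n 0 t \<noteq> 0"
    by simp_all
  define r where "r = ref_radius \<sigma>"
  have r: "r > 0" using ref_radius(1) by (simp add: r_def)
  define x :: "real ^ 3" where "x = vector [r * t, r * sqrt (1 - t\<^sup>2), 0]"
  have "t\<^sup>2 \<le> 1" using t by (simp add: power_le_one)
  then have "(norm x)\<^sup>2 = r\<^sup>2"
    by (simp add: norm3_squared x_def power_mult_distrib algebra_simps)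
  then have n: "norm x = r" using r by (simp add: power2_eq_iff_nonneg)
  then have "x \<in> punctured \<sigma>" using ref_radius(2) by (simp add: r_def)
  moreover have "U n 0 Plus x \<noteq> 0"
    using n r t by (subst U_cartesian) (auto simp: x_def)
  ultimately show ?thesis by blast
qed

text \<open>The ratio of consecutive norms is nonzero up to the top order, so only order \<open>0\<close> has to be exhibited
  as nonzero.\<close>

lemma order_norm_pos:
  assumes deg: "L2_degree \<sigma> n" and "m \<le> legendre_index n"
  shows "order_norm \<sigma> n m > 0"
proof -
  have "order_norm \<sigma> n m \<noteq> 0"
    using assms(2)
  proof (induction m)
    case 0
    show ?case
    proof
      assume "order_norm \<sigma> n 0 = 0"
      then have "wip \<sigma> 0 (U n 0 Plus) (U n 0 Plus) = 0"
        by (simp add: order_norm_def U_0_Minus wip_def)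
      then have "U n 0 Plus x * U n 0 Plus x = 0" if "x \<in> punctured \<sigma>" for x
        using that integrable_wip[OF U_regular(2) U_regular(2) U_regular(3) U_regular(3) admissible_L2_degree[OF deg],
            of 0 Plus 0 Plus]
        by (intro lint_eq_0D[of \<sigma> "\<lambda>x. U n 0 Plus x * U n 0 Plus x"])
           (auto simp: wip_def intro!: continuous_on_mult U_regular)
      then show False using U_0_Plus_nonzero[of \<sigma> n] by auto
    qed
  next
    case (Suc m)
    have ad: "admissible \<sigma> (n + n)" using admissible_L2_degree[OF deg] by simp
    have "of_int n + real m + 1 \<noteq> 0 \<and> of_int n - real m \<noteq> 0"
      using Suc.prems deg by (cases \<sigma>) (auto simp: L2_degree_def legendre_index_def split: if_splits)
    then show ?case
      using Suc order_norm_Suc[OF ad, of m] by simp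
  qed
  then show ?thesis using order_norm_nonneg[of \<sigma> n m] by simp
qed

lemma Mid_in_labels:
  assumes "L2_degree \<sigma> n"
  shows "Mid m s \<in> labels \<sigma> n \<longleftrightarrow> 1 \<le> m \<and> int m \<le> (case \<sigma> of Inner \<Rightarrow> n - 1 | Outer \<Rightarrow> - n)"
proof -
  have "real m \<le> \<bar>of_int n - 1/2\<bar> - 1/2 \<longleftrightarrow> int m \<le> (case \<sigma> of Inner \<Rightarrow> n - 1 | Outer \<Rightarrow> - n)"
    using assms by (cases \<sigma>) (auto simp: L2_degree_def abs_if)
  then show ?thesis by (auto simp: labels_def)
qed

lemma finite_labels: "finite (labels \<sigma> n)"
proof -
  define N where "N = nat \<lceil>\<bar>of_int n - 1/2 :: real\<bar>\<rceil>"
  have "labels \<sigma> n \<subseteq> {Zero, Last Plus, Last Minus} \<union> (\<lambda>(m, s). Mid m s) ` ({..N} \<times> {Plus, Minus})"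
  proof
    fix l assume l: "l \<in> labels \<sigma> n"
    have "m \<le> N" if "real m \<le> \<bar>of_int n - 1/2\<bar> - 1/2" for m
    proof -
      have "real m \<le> of_int \<lceil>\<bar>of_int n - 1/2 :: real\<bar>\<rceil>"
        using that le_of_int_ceiling[of "\<bar>of_int n - 1/2 :: real\<bar>"] by linarith
      then show ?thesis unfolding N_def by linarith
    qed
    moreover have "s \<in> {Plus, Minus}" for s by (cases s) auto
    ultimately show "l \<in> {Zero, Last Plus, Last Minus} \<union> (\<lambda>(m, s). Mid m s) ` ({..N} \<times> {Plus, Minus})"
      using l unfolding labels_def by (force split: if_splits)
  qed
  then show ?thesis by (rule finite_subset) simp
qed

lemma U_unit_eq_0: "m > legendre_index n \<Longrightarrow> U_unit \<sigma> n i m s = 0"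
  by (simp add: U_unit_def fun_eq_iff restr_def U_eq_0)

lemma U_unit_0_Minus: "U_unit \<sigma> n i 0 Minus = 0"
  by (simp add: U_unit_def fun_eq_iff restr_def U_0_Minus)

definition grad_parts :: "side \<Rightarrow> int \<Rightarrow> (real ^ 3 \<Rightarrow> quat) set" where
  "grad_parts \<sigma> n = {scalar_grad \<sigma> n m s | m s. True} \<union> {vector_grad \<sigma> n m s | m s. True}"

text \<open>A conjugate gradient and its conjugate are the difference and the sum of the two parts, so
  orthogonality to all of them separates into the parts. The zero function, which is the case
  \<open>m = 0\<close> with sign minus, serves as the other summand.\<close>

lemma contragenics_eq:
  assumes deg: "L2_degree \<sigma> n"
  shows "contragenics \<sigma> n = {f \<in> harmonics3 \<sigma> n. \<forall>k\<in>grad_parts \<sigma> n. ip \<sigma> f k = 0}"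
proof (intro subset_antisym subsetI)
  note H = harmonics3_closed[OF deg]
  fix f assume f: "f \<in> contragenics \<sigma> n"
  then have fH: "f \<in> harmonics3 \<sigma> n" by (simp add: contragenics_def)
  have orth: "ip \<sigma> f (a + b) = 0" if "a \<in> monogenics \<sigma> n" "b \<in> antimonogenics \<sigma> n" for a b
    using f that by (auto simp: contragenics_def)
  have M: "scalar_grad \<sigma> n m s + (-1) *\<^sub>R vector_grad \<sigma> n m s \<in> monogenics \<sigma> n" for m s
    using conj_grad_monogenic[OF deg, of m s] by (simp only: conj_grad_split)
  have Mbar: "scalar_grad \<sigma> n m s + vector_grad \<sigma> n m s \<in> antimonogenics \<sigma> n" for m s
    using conj_grad_monogenic[OF deg, of m s] qconj_conj_grad_split[of \<sigma> n m s]
    unfolding antimonogenics_def by (metis imageI)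
  have z: "scalar_grad \<sigma> n 0 Minus = 0" "vector_grad \<sigma> n 0 Minus = 0"
    by (simp_all add: scalar_grad_def vector_grad_def U_unit_0_Minus)
  have 0: "0 \<in> monogenics \<sigma> n" "0 \<in> antimonogenics \<sigma> n"
    using M[of 0 Minus] Mbar[of 0 Minus] by (simp_all add: z)
  have "ip \<sigma> f (scalar_grad \<sigma> n m s) = 0 \<and> ip \<sigma> f (vector_grad \<sigma> n m s) = 0" for m s
  proof -
    have "ip \<sigma> f (scalar_grad \<sigma> n m s + (-1) *\<^sub>R vector_grad \<sigma> n m s) = 0" "ip \<sigma> f (scalar_grad \<sigma> n m s + vector_grad \<sigma> n m s) = 0"
      using orth[OF M 0(2), of m s] orth[OF 0(1) Mbar, of m s] by simp_all
    then show ?thesis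
      by (simp add: ip_linear[OF deg] fH H)
  qed
  then show "f \<in> {f \<in> harmonics3 \<sigma> n. \<forall>k\<in>grad_parts \<sigma> n. ip \<sigma> f k = 0}"
    using fH by (auto simp: grad_parts_def)
next
  note H = harmonics3_closed[OF deg]
  fix f assume f: "f \<in> {f \<in> harmonics3 \<sigma> n. \<forall>k\<in>grad_parts \<sigma> n. ip \<sigma> f k = 0}"
  then have fH: "f \<in> harmonics3 \<sigma> n"
    and K: "ip \<sigma> f (scalar_grad \<sigma> n m s) = 0" "ip \<sigma> f (vector_grad \<sigma> n m s) = 0" for m s
    unfolding grad_parts_def by blast+
  define W where "W = {g \<in> harmonics3 \<sigma> n. ip \<sigma> f g = 0}"
  have W: "subspace W"
  proof (rule subspaceI)
    show "0 \<in> W" using ip_scale_right[of \<sigma> f 0 0] H(3) by (simp add: W_def)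
  qed (auto simp: W_def H ip_linear[OF deg fH] ip_scale_right)
  have WST: "scalar_grad \<sigma> n m s \<in> W" "vector_grad \<sigma> n m s \<in> W" for m s
    by (simp_all add: W_def H K)
  have M: "a \<in> W" if a: "a \<in> monogenics \<sigma> n" for a
  proof -
    obtain c where "a = (\<Sum>(m, s)\<in>modes (n + 1). c m s *\<^sub>R restr (region \<sigma>) (conj_grad n m s))"
      using monogenics_expansion[OF deg a] by blast
    then show ?thesis
      unfolding split_beta conj_grad_split
      by (simp only:) (intro subspace_sum[OF W] subspace_scale[OF W] subspace_add[OF W] WST)
  qed
  have Mbar: "b \<in> W" if b: "b \<in> antimonogenics \<sigma> n" for b
  proof -
    obtain a where a: "a \<in> monogenics \<sigma> n" "b = (\<lambda>x. qconj (a x))"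
      using b by (auto simp: antimonogenics_def)
    obtain c where c: "a = (\<Sum>(m, s)\<in>modes (n + 1). c m s *\<^sub>R restr (region \<sigma>) (conj_grad n m s))"
      using monogenics_expansion[OF deg a(1)] by blast
    have "b = (\<Sum>(m, s)\<in>modes (n + 1). c m s *\<^sub>R (\<lambda>x. qconj (restr (region \<sigma>) (conj_grad n m s) x)))"
      unfolding a(2) c
      by (simp add: fun_eq_iff quat_eq_iff qconj_def sum_fun_apply split_beta scaleR_fun_def sum_negf)
    then show ?thesis
      unfolding split_beta qconj_conj_grad_split
      by (simp only:) (intro subspace_sum[OF W] subspace_scale[OF W] subspace_add[OF W] WST)
  qed
  have "ip \<sigma> f (a + b) = 0" if "a \<in> monogenics \<sigma> n" "b \<in> antimonogenics \<sigma> n" for a b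
    using subspace_add[OF W M[OF that(1)] Mbar[OF that(2)]] by (simp add: W_def)
  then show "f \<in> contragenics \<sigma> n"
    using fH by (auto simp: contragenics_def)
qed

text \<open>For each order \<open>m\<close> that carries a \<open>Z\<close>, the vectors \<open>A + c B\<close> and \<open>A - c' B\<close> determine \<open>A\<close> and
  \<open>B\<close>, because \<open>c + c' = 2n(n + 1) + 2m\<^sup>2 > 0\<close>. Otherwise \<open>A = 0\<close>, and \<open>B\<close> is a multiple of the
  gradient (in the ball) or zero (in the exterior). Sums and differences of \<open>A\<close> and \<open>B\<close> of
  neighbouring orders recover the components.\<close>

lemma harmonics3_spanned:
  assumes deg: "L2_degree \<sigma> n"
  shows "harmonics3 \<sigma> n \<subseteq> span (Z \<sigma> n ` labels \<sigma> n \<union> grad_parts \<sigma> n)"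
proof -
  define W where "W = span (Z \<sigma> n ` labels \<sigma> n \<union> grad_parts \<sigma> n)"
  have sub: "f \<in> W \<Longrightarrow> g \<in> W \<Longrightarrow> f + g \<in> W" "f \<in> W \<Longrightarrow> c *\<^sub>R f \<in> W" "0 \<in> W" for f g c
    by (simp_all add: W_def span_add span_scale span_zero)
  have ZW: "Z \<sigma> n l \<in> W" if "l \<in> labels \<sigma> n" for l
    unfolding W_def by (rule span_base) (use that in blast)
  have SW: "scalar_grad \<sigma> n m s \<in> W" and TW: "vector_grad \<sigma> n m s \<in> W" for m s
    unfolding W_def by (rule span_base; auto simp: grad_parts_def)+
  have U1: "U_unit \<sigma> n 1 m s \<in> W" for m s
  proof (cases "of_int n + 1 + real m = 0")
    case False
    have "(1 / (of_int n + 1 + real m)) *\<^sub>R scalar_grad \<sigma> n m s \<in> W" by (intro sub SW)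
    then show ?thesis using False by (simp add: scalar_grad_def)
  next
    case True
    then have m: "int m = - n - 1" by linarith
    then have "\<sigma> = Outer" using deg by (cases \<sigma>) (auto simp: L2_degree_def)
    then have "Last s \<in> labels \<sigma> n" by (cases s) (auto simp: labels_def)
    moreover have "nat (- n - 1) = m" using m by simp
    ultimately show ?thesis using ZW[of "Last s"] by (simp only: Z_eq)
  qed
  have AB: "raised \<sigma> n m s \<in> W \<and> lowered \<sigma> n m s \<in> W" if m: "m \<ge> 1" for m s
  proof -
    define c where "c = (of_int n - real m) * (of_int n - real m + 1)"
    define c' where "c' = (of_int n + real m + 1) * (of_int n + real m)"
    have "2 *\<^sub>R vector_grad \<sigma> n m (flip s) \<in> W" by (intro sub TW)
    then have T: "raised \<sigma> n m s + (- c') *\<^sub>R lowered \<sigma> n m s \<in> W"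
      using m by (simp add: vector_grad_def c'_def)
    show ?thesis
    proof (cases "Mid m s \<in> labels \<sigma> n")
      case True
      then have "raised \<sigma> n m s + c *\<^sub>R lowered \<sigma> n m s \<in> W"
        using ZW[OF True] by (simp add: Z_eq c_def)
      then have "(raised \<sigma> n m s + c *\<^sub>R lowered \<sigma> n m s) + (-1) *\<^sub>R (raised \<sigma> n m s + (- c') *\<^sub>R lowered \<sigma> n m s) \<in> W"
        by (rule sub(1)[OF _ sub(2)[OF T]])
      then have B: "(c + c') *\<^sub>R lowered \<sigma> n m s \<in> W"
        by (simp add: algebra_simps)
      have "(0 :: real) \<le> of_int (n * (n + 1))"
        using deg by (cases \<sigma>) (auto simp: L2_degree_def intro!: mult_nonneg_nonneg mult_nonpos_nonpos)
      moreover have "c + c' = 2 * of_int (n * (n + 1)) + 2 * (real m * real m)"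
        by (simp add: c_def c'_def algebra_simps)
      moreover have "real m * real m > 0" using m by simp
      ultimately have "c + c' > 0" by linarith
      then have "lowered \<sigma> n m s \<in> W"
        using sub(2)[OF B, of "1 / (c + c')"] by simp
      moreover from sub(1)[OF T sub(2)[OF this, of c']] have "raised \<sigma> n m s \<in> W"
        by (simp add: algebra_simps)
      ultimately show ?thesis by blast
    next
      case False
      have A0: "raised \<sigma> n m s = 0"
      proof -
        have "Suc m > legendre_index n"
          using False m deg by (cases \<sigma>) (auto simp: Mid_in_labels L2_degree_def legendre_index_def)
        then show ?thesis by (simp add: raised_def U_unit_eq_0)
      qed
      have "lowered \<sigma> n m s \<in> W"
      proof (cases \<sigma>)
        case Inner
        then have "c' \<noteq> 0" using deg m by (simp add: c'_def L2_degree_def)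
        then show ?thesis using sub(2)[OF T, of "- 1 / c'"] by (simp add: A0)
      next
        case Outer
        then have "m - 1 > legendre_index n"
          using False m deg by (auto simp: Mid_in_labels L2_degree_def legendre_index_def)
        then show ?thesis by (simp add: lowered_def U_unit_eq_0 sub)
      qed
      then show ?thesis by (simp add: A0 sub)
    qed
  qed
  have A: "raised \<sigma> n m s \<in> W" for m s
  proof (cases "m = 0")
    case True
    have "Zero \<in> labels \<sigma> n" by (simp add: labels_def)
    then show ?thesis
      using ZW[of Zero] TW[of 0 Plus] True by (cases s) (simp_all add: Z_eq vector_grad_def)
  qed (use AB in simp)
  have U23: "U_unit \<sigma> n 2 m s \<in> W \<and> U_unit \<sigma> n 3 m s \<in> W" for m s
  proof (cases m)
    case 0
    have "lowered \<sigma> n 1 Plus \<in> W" "lowered \<sigma> n 1 Minus \<in> W" using AB by simp_all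
    then show ?thesis
      using 0 sub by (cases s) (simp_all add: lowered_def U_unit_0_Minus)
  next
    case (Suc j)
    have "(1 / 2) *\<^sub>R (raised \<sigma> n j (flip s) + lowered \<sigma> n (Suc m) (flip s)) \<in> W"
      "(pm s / 2) *\<^sub>R (lowered \<sigma> n (Suc m) s + (-1) *\<^sub>R raised \<sigma> n j s) \<in> W"
      using A AB[of "Suc m"] by (intro sub; simp)+
    moreover have "(1 / 2) *\<^sub>R (raised \<sigma> n j (flip s) + lowered \<sigma> n (Suc m) (flip s)) = U_unit \<sigma> n 2 m s"
      by (simp add: raised_def lowered_def Suc fun_eq_iff scaleR_fun_def algebra_simps flip: scaleR_add_left)
    moreover have "(pm s / 2) *\<^sub>R (lowered \<sigma> n (Suc m) s + (-1) *\<^sub>R raised \<sigma> n j s) = U_unit \<sigma> n 3 m s"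
      by (cases s) (simp_all add: raised_def lowered_def Suc fun_eq_iff scaleR_fun_def algebra_simps flip: scaleR_add_left)
    ultimately show ?thesis by simp
  qed
  have "U_unit \<sigma> n i m s \<in> W" if "i \<noteq> 4" for i m s
    using U1 U23 exhaust_4[of i] that by auto
  then have "span {U_unit \<sigma> n i m s | i m s. i \<noteq> 4 \<and> m \<le> legendre_index n} \<subseteq> W"
    unfolding W_def by (intro span_minimal) auto
  then show ?thesis
    using harmonics3_span[OF deg] by (simp add: W_def)
qed

lemma order_norm_ratio:
  assumes deg: "L2_degree \<sigma> n" and m: "m \<ge> 1"
  shows "order_norm \<sigma> n (Suc m) = ((of_int n - real m) * (of_int n - real m + 1))
     * ((of_int n + real m + 1) * (of_int n + real m)) * order_norm \<sigma> n (m - 1)"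
proof -
  obtain j where j: "m = Suc j" using m by (cases m) auto
  have ad: "admissible \<sigma> (n + n)" using admissible_L2_degree[OF deg] by simp
  show ?thesis
    using order_norm_Suc[OF ad, of "Suc j"] order_norm_Suc[OF ad, of j] by (simp add: j algebra_simps)
qed

lemma ip_Z_grad_parts:
  assumes deg: "L2_degree \<sigma> n" and l: "l \<in> labels \<sigma> n" and k: "k \<in> grad_parts \<sigma> n"
  shows "ip \<sigma> (Z \<sigma> n l) k = 0"
proof -
  note H = harmonics3_closed[OF deg] U_unit_in_harmonics3[OF deg]
  note L = ip_add[OF deg] ip_scale ip_scale_right ip_minus ip_linear[OF deg]
  have comm: "ip \<sigma> (raised \<sigma> n m s) (U_unit \<sigma> n 1 m' s') = 0" "ip \<sigma> (lowered \<sigma> n m s) (U_unit \<sigma> n 1 m' s') = 0" for m s m' s'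
    using ip_U_unit_raised[OF deg] ip_U_unit_lowered[OF deg] ip_commute by metis+
  have zero: "ip \<sigma> f 0 = 0" for f
    by (simp add: ip_def)
  from k consider (S) m s where "k = scalar_grad \<sigma> n m s" | (T) m s where "k = vector_grad \<sigma> n m s"
    by (auto simp: grad_parts_def)
  then show ?thesis
  proof cases
    case S
    show ?thesis
    proof (cases l)
      case (Last t)
      then have "\<sigma> = Outer" using l by (auto simp: labels_def split: if_splits)
      then have "real (nat (- n - 1)) = - of_int n - 1" using deg by (simp add: L2_degree_def)
      then show ?thesis
        by (simp add: Last S Z_eq scalar_grad_def L H ip_U_unit[OF deg])
    qed (simp_all add: S Z_eq scalar_grad_def L H comm)
  next
    case T
    show ?thesis
    proof (cases "m = 0")
      case True
      have B: "ip \<sigma> (lowered \<sigma> n j t) (raised \<sigma> n 0 Minus) = 0" if "j \<ge> 1" for j t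
        using ip_raised_lowered[OF deg that] ip_commute by metis
      show ?thesis
      proof (cases s)
        case Plus
        show ?thesis
          using l by (cases l) (auto simp: T True Plus vector_grad_def Z_eq L H ip_raised_raised[OF deg] B
              ip_U_unit_raised[OF deg] Mid_in_labels[OF deg])
      qed (simp add: T True vector_grad_def zero)
    next
      case False
      then have m: "m \<ge> 1" by simp
      show ?thesis
      proof (cases l)
        case Zero
        then show ?thesis
          using m by (simp add: T vector_grad_def Z_eq L H ip_raised_raised[OF deg] ip_raised_lowered[OF deg m])
      next
        case (Mid j t)
        then have j: "j \<ge> 1" using l by (simp add: Mid_in_labels[OF deg])
        show ?thesis
          using m order_norm_ratio[OF deg m]
          by (simp add: T vector_grad_def Mid Z_eq ip_scale_right H ip_raised_lowered_combination[OF deg j m]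
              del: scaleR_minus_left)
      next
        case (Last t)
        then show ?thesis
          using m by (simp add: T vector_grad_def Z_eq L H ip_U_unit_raised[OF deg] ip_U_unit_lowered[OF deg])
      qed
    qed
  qed
qed

lemma ip_Z_orthogonal:
  assumes deg: "L2_degree \<sigma> n" and l: "l \<in> labels \<sigma> n" "l' \<in> labels \<sigma> n" "l \<noteq> l'"
  shows "ip \<sigma> (Z \<sigma> n l) (Z \<sigma> n l') = 0"
proof -
  note H = harmonics3_closed[OF deg] U_unit_in_harmonics3[OF deg]
  note L = ip_add[OF deg] ip_scale ip_scale_right ip_minus ip_linear[OF deg]
  have comm: "ip \<sigma> (raised \<sigma> n m s) (U_unit \<sigma> n 1 m' s') = 0" "ip \<sigma> (lowered \<sigma> n m s) (U_unit \<sigma> n 1 m' s') = 0" for m s m' s'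
    using ip_U_unit_raised[OF deg] ip_U_unit_lowered[OF deg] ip_commute by metis+
  have BA: "ip \<sigma> (lowered \<sigma> n j t) (raised \<sigma> n m s) = 0" if "j \<ge> 1" for j t m s
    using ip_raised_lowered[OF deg that] ip_commute by metis
  have M: "m \<ge> 1" if "Mid m s = l \<or> Mid m s = l'" for m s
    using l that Mid_in_labels[OF deg] by blast
  show ?thesis
  proof (cases l)
    case Zero
    then show ?thesis
      using l M by (cases l') (auto simp: Z_eq L H ip_raised_raised[OF deg] ip_raised_lowered[OF deg] comm)
  next
    case (Mid m s)
    have m: "m \<ge> 1" using M Mid by blast
    show ?thesis
    proof (cases l')
      case Zero
      then show ?thesis using m by (simp add: Mid Z_eq L H ip_raised_raised[OF deg] BA)
    next
      case (Mid m' s')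
      then have m': "m' \<ge> 1" using M by blast
      show ?thesis
        using l(3) by (auto simp add: Mid \<open>l = Mid m s\<close> Z_eq ip_raised_lowered_combination[OF deg m m'])
    next
      case (Last t)
      then show ?thesis by (simp add: Mid Z_eq L H comm)
    qed
  next
    case (Last t)
    then show ?thesis
      using l(3) by (cases l')
        (auto simp: Z_eq L H ip_U_unit[OF deg] ip_U_unit_raised[OF deg] ip_U_unit_lowered[OF deg])
  qed
qed

lemma Z_nonzero:
  assumes deg: "L2_degree \<sigma> n" and l: "l \<in> labels \<sigma> n"
  shows "Z \<sigma> n l \<noteq> 0"
proof -
  define k where "k = legendre_index n"
  have k: "k \<ge> 1" using deg by (cases \<sigma>) (auto simp: L2_degree_def legendre_index_def k_def)
  have "ip \<sigma> (Z \<sigma> n l) (Z \<sigma> n l) > 0"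
  proof (cases l)
    case Zero
    then show ?thesis
      using order_norm_pos[OF deg, of 1] k by (simp add: Z_eq ip_raised_raised[OF deg] k_def)
  next
    case (Mid m s)
    define c where "c = (of_int n - real m) * (of_int n - real m + 1)"
    have m: "m \<ge> 1" "m - 1 \<le> k"
      using l Mid deg by (cases \<sigma>; auto simp: Mid_in_labels L2_degree_def k_def legendre_index_def)+
    have "c \<noteq> 0"
      using l Mid deg by (cases \<sigma>) (auto simp: Mid_in_labels L2_degree_def c_def)
    then have "c * c > 0"
      using not_real_square_gt_zero[of c] by blast
    then have "c * c * order_norm \<sigma> n (m - 1) > 0"
      using order_norm_pos[OF deg, of "m - 1"] m by (simp add: k_def)
    then show ?thesis
      using order_norm_nonneg[of \<sigma> n "Suc m"]
      by (simp add: Mid Z_eq ip_raised_lowered_combination[OF deg m(1) m(1)] c_def)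
  next
    case (Last s)
    then have "\<sigma> = Outer" using l by (auto simp: labels_def split: if_splits)
    then have "nat (- n - 1) = k" using deg by (simp add: k_def legendre_index_def L2_degree_def)
    moreover obtain j where "k = Suc j" using k by (cases k) auto
    ultimately show ?thesis
      using order_norm_pos[OF deg, of k] by (simp add: Last Z_eq ip_U_unit[OF deg] wip_U_eq_order_norm[OF deg] k_def)
  qed
  moreover have "ip \<sigma> 0 0 = 0" by (simp add: ip_def)
  ultimately show ?thesis by auto
qed

text \<open>The complement of the parts of the gradients has the family \<open>Z\<close> as an orthogonal basis, since \<open>Z\<close> and
  these parts are orthogonal to each other and together span \<open>(\<H>)\<^sup>3\<close>.\<close>

theorem theorem7:
  fixes \<sigma> :: side and n :: int
  assumes "\<sigma> = Inner \<Longrightarrow> n \<ge> 1"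
    and "\<sigma> = Outer \<Longrightarrow> n \<le> -2"
  shows "orthogonal_basis \<sigma> (labels \<sigma> n) (Z \<sigma> n) (contragenics \<sigma> n)"
proof -
  have deg: "L2_degree \<sigma> n" using assms by (cases \<sigma>) (auto simp: L2_degree_def)
  note H = harmonics3_closed[OF deg]
  have "grad_parts \<sigma> n \<subseteq> harmonics3 \<sigma> n"
    using H by (auto simp: grad_parts_def)
  note basis = orthogonal_complement_basis[OF subspace_harmonics3[OF deg] ip_add[OF deg] ip_scale
      ip_commute ip_definite[OF deg] finite_labels[of \<sigma> n] H(10) Z_nonzero[OF deg]
      ip_Z_orthogonal[OF deg] this ip_Z_grad_parts[OF deg] harmonics3_spanned[OF deg]]
  show ?thesis
    unfolding orthogonal_basis_def contragenics_eq[OF deg]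
    using basis ip_Z_orthogonal[OF deg] by blast
qed

end
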